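(* Let $S=K[x_1,\dots,x_n]$ be a polynomial ring over a field $K$, $m=(x_1,\dots,x_n)$, and let $I=\bigcap_{i=1}^s P_i$ and $I'=\bigcap_{i=1}^s P'_i$ be squarefree monomial ideals of $S$, where $P_1,\dots,P_s$ (respectively $P'_1,\dots,P'_s$) are the distinct minimal monomial prime ideals of $S/I$ (respectively $S/I'$). Suppose that $\sum_{i=1}^s P_i=m=\sum_{i=1}^s P'_i$, $\operatorname{bigsize}(I)=\operatorname{bigsize}(I')=2$ and $q(I)=q(I')$. If the graphs associated to $I$ and $I'$ coincide, then $\operatorname{depth}_S I=\operatorname{depth}_S I'$.
   Context: Depth is taken with respect to $m$. The bigsize of a squarefree monomial ideal $I$ with minimal primes $P_1,\dots,P_s$ is $t+(n-h)-1$, where $h$ is the height of $\sum_{j=1}^sP_j$ and $t$ is the minimal number $e$ such that for all integers $1\le i_1<\dots<i_e\le s$ one has $\sum_{k=1}^eP_{i_k}=\sum_{j=1}^sP_j$. Set $q(I)=\min\{\dim S/(P_i+P_j): j\neq i,\ P_i+P_j\ne m\}$ (and likewise $q(I')$ with the $P'_i$). The graph associated to $I$ is the simple graph on $[s]=\{1,\dots,s\}$ in which $\{i,j\}$ ($i\ne j$) is an edge if and only if $P_i+P_j=m$ (and likewise for $I'$ with the $P_i'$). *)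

theory Defs
  imports "HOL-Algebra.Algebra" "HOL-Algebra.Algebraic_Closure_Type"
    "HOL-Library.Poly_Mapping" "HOL-Library.Extended_Nat"
begin

section \<open>Prime ideals and dimension in a commutative ring\<close>

definition minimal_primes :: "('a, 'b) ring_scheme \<Rightarrow> 'a set \<Rightarrow> 'a set set" where
  "minimal_primes R I =
    {P. primeideal P R \<and> I \<subseteq> P \<and> (\<forall>Q. primeideal Q R \<and> I \<subseteq> Q \<and> Q \<subseteq> P \<longrightarrow> Q = P)}"

definition prime_chain :: "('a, 'b) ring_scheme \<Rightarrow> nat \<Rightarrow> (nat \<Rightarrow> 'a set) \<Rightarrow> bool" where
  "prime_chain R l c \<longleftrightarrow> (\<forall>i\<le>l. primeideal (c i) R) \<and> (\<forall>i<l. c i \<subset> c (Suc i))"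

text \<open>The zero ring has no prime ideals and gets the value \<open>0\<close> here.\<close>

definition krull_dim :: "('a, 'b) ring_scheme \<Rightarrow> enat" where
  "krull_dim R = Sup {enat l | l. \<exists>c. prime_chain R l c}"

definition prime_height :: "('a, 'b) ring_scheme \<Rightarrow> 'a set \<Rightarrow> enat" where
  "prime_height R P = Sup {enat l | l. \<exists>c. prime_chain R l c \<and> c l = P}"

definition ideal_height :: "('a, 'b) ring_scheme \<Rightarrow> 'a set \<Rightarrow> enat" where
  "ideal_height R J = Inf {prime_height R P | P. primeideal P R \<and> J \<subseteq> P}"

text \<open>The sum of a family of ideals; for two ideals the library has \<open>set_add\<close>.\<close>

definition ideal_sum :: "('a, 'b) ring_scheme \<Rightarrow> 'a set set \<Rightarrow> 'a set" where
  "ideal_sum R \<P> = genideal R (\<Union>\<P>)"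

section \<open>Depth of a module with respect to an ideal\<close>

text \<open>\<open>J M\<close>, the submodule of \<open>M\<close> generated by the products of elements of \<open>J\<close> and \<open>M\<close>.\<close>

definition ideal_smult ::
  "('a, 'c) ring_scheme \<Rightarrow> 'a set \<Rightarrow> ('a, 'b, 'd) module_scheme \<Rightarrow> 'b set" where
  "ideal_smult R J M =
    \<Inter>{N. submodule N R M \<and> (\<forall>a\<in>J. \<forall>x\<in>carrier M. a \<odot>\<^bsub>M\<^esub> x \<in> N)}"

text \<open>Every \<open>f\<^sub>i\<close> is a nonzerodivisor on \<open>M / (f\<^sub>1, \<dots>, f\<^bsub>i-1\<^esub>) M\<close>, and \<open>(f\<^sub>1, \<dots>, f\<^sub>r) M \<noteq> M\<close>.
  List positions count from \<open>0\<close>.\<close>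

definition regular_sequence ::
  "('a, 'c) ring_scheme \<Rightarrow> ('a, 'b, 'd) module_scheme \<Rightarrow> 'a list \<Rightarrow> bool" where
  "regular_sequence R M fs \<longleftrightarrow>
    set fs \<subseteq> carrier R \<and>
    (\<forall>i<length fs. \<forall>x\<in>carrier M.
       (fs ! i) \<odot>\<^bsub>M\<^esub> x \<in> ideal_smult R (genideal R (set (take i fs))) M \<longrightarrow>
       x \<in> ideal_smult R (genideal R (set (take i fs))) M) \<and>
    ideal_smult R (genideal R (set fs)) M \<noteq> carrier M"

text \<open>The usual convention is that the depth is infinite if \<open>J M = M\<close>.\<close>

definition depth ::
  "('a, 'c) ring_scheme \<Rightarrow> 'a set \<Rightarrow> ('a, 'b, 'd) module_scheme \<Rightarrow> enat" where
  "depth R J M =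
    (if ideal_smult R J M = carrier M then \<infinity>
     else Sup {enat (length fs) | fs. set fs \<subseteq> J \<and> regular_sequence R M fs})"

text \<open>The fields \<open>mult\<close> and \<open>one\<close> are present in every module record but play no role.\<close>

definition ideal_module :: "('a, 'b) ring_scheme \<Rightarrow> 'a set \<Rightarrow> ('a, 'a) module" where
  "ideal_module R I =
    \<lparr>carrier = I, monoid.mult = monoid.mult R, one = one R, ring.zero = ring.zero R, add = add R,
     module.smult = monoid.mult R\<rparr>"

section \<open>Monomial ideals in \<open>K[x\<^sub>1, \<dots>, x\<^sub>n]\<close>\<close>

text \<open>The variables are indexed by a finite type \<open>'n\<close>, so the number \<open>n\<close> of variables is
  the cardinality of \<open>'n\<close>. Polynomials are finitely supported maps from exponent vectors to coefficients.\<close>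

type_synonym ('n, 'k) mpoly = "('n \<Rightarrow>\<^sub>0 nat) \<Rightarrow>\<^sub>0 'k"

definition mpoly_ring :: "('n::finite, 'k::field) mpoly ring" where
  "mpoly_ring = ring_of_type_algebra"

definition power_product :: "('n \<Rightarrow>\<^sub>0 nat) \<Rightarrow> ('n::finite, 'k::field) mpoly" where
  "power_product e = Poly_Mapping.single e 1"

definition variable :: "'n \<Rightarrow> ('n::finite, 'k::field) mpoly" where
  "variable i = power_product (Poly_Mapping.single i 1)"

definition irrelevant_ideal :: "('n::finite, 'k::field) mpoly set" where
  "irrelevant_ideal = genideal mpoly_ring (range variable)"

definition monomial_ideal :: "('n::finite, 'k::field) mpoly set \<Rightarrow> bool" where
  "monomial_ideal I \<longleftrightarrow> (\<exists>E. I = genideal mpoly_ring (power_product ` E))"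

definition squarefree_monomial_ideal :: "('n::finite, 'k::field) mpoly set \<Rightarrow> bool" where
  "squarefree_monomial_ideal I \<longleftrightarrow>
    (\<exists>E. (\<forall>e\<in>E. \<forall>i. Poly_Mapping.lookup e i \<le> 1) \<and>
         I = genideal mpoly_ring (power_product ` E))"

text \<open>Choosing indices \<open>i\<^sub>1 < \<dots> < i\<^sub>e\<close> amounts to choosing a set \<open>\<A>\<close> of \<open>e\<close> minimal primes.\<close>

definition bigsize_t :: "('n::finite, 'k::field) mpoly set \<Rightarrow> nat" where
  "bigsize_t I =
    (LEAST e. e \<ge> 1 \<and>
      (\<forall>\<A> \<subseteq> minimal_primes mpoly_ring I. finite \<A> \<and> card \<A> = e \<longrightarrow>
         ideal_sum mpoly_ring \<A> = ideal_sum mpoly_ring (minimal_primes mpoly_ring I)))"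

definition bigsize :: "('n::finite, 'k::field) mpoly set \<Rightarrow> int" where
  "bigsize I =
    (let h = the_enat (ideal_height mpoly_ring
                         (ideal_sum mpoly_ring (minimal_primes mpoly_ring I)))
     in int (bigsize_t I) + (int (card (UNIV :: 'n set)) - int h) - 1)"

text \<open>The infimum is a minimum unless the set is empty, which gives \<open>\<infinity>\<close>.\<close>

definition q_invariant :: "('n::finite, 'k::field) mpoly set \<Rightarrow> enat" where
  "q_invariant I =
    Inf {krull_dim (mpoly_ring Quot (P <+>\<^bsub>mpoly_ring\<^esub> Q)) | P Q.
           P \<in> minimal_primes mpoly_ring I \<and> Q \<in> minimal_primes mpoly_ring I \<and> P \<noteq> Q \<and>
           P <+>\<^bsub>mpoly_ring\<^esub> Q \<noteq> irrelevant_ideal}"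

text \<open>The pair of the vertex set and the edge set; an edge is a two-element set.\<close>

definition associated_graph ::
  "nat \<Rightarrow> (nat \<Rightarrow> ('n::finite, 'k::field) mpoly set) \<Rightarrow> nat set \<times> nat set set" where
  "associated_graph s P =
    ({1..s},
     {{i, j} | i j. i \<in> {1..s} \<and> j \<in> {1..s} \<and> i \<noteq> j \<and>
        P i <+>\<^bsub>mpoly_ring\<^esub> P j = irrelevant_ideal})"

end

theory Submission
  imports Defs
begin

text \<open>
  Let \<open>F\<^sub>i\<close> be the set of variables outside \<open>P\<^sub>i\<close>. Then \<open>I\<close> is the Stanley-Reisner ideal of the simplicial
  complex with facets \<open>F\<^sub>1, \<dots>, F\<^sub>s\<close>. The sum \<open>P\<^sub>i + P\<^sub>j\<close> is the ideal of the variables outside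
  \<open>F\<^sub>i \<inter> F\<^sub>j\<close>. As all \<open>P\<^sub>i\<close> together generate the maximal ideal, bigsize two says that any three
  facets have empty intersection while some two facets meet, the edges of the associated graph are the
  pairs of disjoint facets, and \<open>q(I)\<close> is the least size of a nonempty \<open>F\<^sub>i \<inter> F\<^sub>j\<close>.
  Without triple intersections the nerve of the facets is the graph of meeting facets, the complement of the associated graph, and the link of a nonempty face is a
  simplex or two simplices glued along a face. Hence the local cohomology of \<open>I\<close> is visible on the
  graph of meeting facets: the depth of \<open>I\<close> is \<open>2\<close> if this graph is disconnected, \<open>3\<close> if it is connected
  with a cycle, and \<open>q(I) + 2\<close> if it is a tree (\<open>depth_from_graph\<close>). The right-hand side only depends on
  the associated graph and \<open>q(I)\<close>.

  Upper bounds for regular sequences come from Koszul cohomology with respect to the variables. A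
  regular sequence of length \<open>r\<close> in the ideal of the variables, homogeneous or not, makes it vanish
  below degree \<open>r\<close> (\<open>koszul_cohomology_vanishes\<close>). Explicit classes in degrees \<open>2\<close>, \<open>q + 2\<close> and \<open>3\<close>
  come from a set of vertices that disconnects the complex (\<open>regular_length_separated\<close>) and from a
  cycle of facets (\<open>regular_length_cycle\<close>).

  Lower bounds use one sequence for all ideals, the elementary symmetric polynomials. They are regular
  on \<open>S / P\<^sub>i\<close> up to the number of vertices of \<open>F\<^sub>i\<close> (\<open>esym_regular_face\<close>), and one more of them is
  regular on \<open>P\<^sub>i\<close>. Facets are then added one at a time along the edges of the graph of meeting
  facets; the Mayer-Vietoris sequence (\<open>regular_on_Int\<close>) reduces each step to the smaller complex along which
  the new facet is glued.

  Bigsize and \<open>q(I)\<close> are defined by height and Krull dimension. The dimension of a face ring is found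
  by counting: too many polynomials are algebraically dependent, and such a dependence bounds the
  length of prime chains (\<open>prime_chain_length_le\<close>).
\<close>

section \<open>Regular sequences on a quotient of two ideals\<close>

definition ideal_set :: "'a::comm_ring_1 set \<Rightarrow> bool" where
  "ideal_set J \<longleftrightarrow> 0 \<in> J \<and> (\<forall>x\<in>J. \<forall>y\<in>J. x + y \<in> J) \<and> (\<forall>x\<in>J. \<forall>c. c * x \<in> J)"

lemma ideal_setI:
  "0 \<in> J \<Longrightarrow> (\<And>x y. x \<in> J \<Longrightarrow> y \<in> J \<Longrightarrow> x + y \<in> J) \<Longrightarrow> (\<And>c x. x \<in> J \<Longrightarrow> c * x \<in> J) \<Longrightarrow> ideal_set J"
  by (simp add: ideal_set_def)

lemma ideal_set_zero: "ideal_set J \<Longrightarrow> 0 \<in> J"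
  and ideal_set_add: "ideal_set J \<Longrightarrow> x \<in> J \<Longrightarrow> y \<in> J \<Longrightarrow> x + y \<in> J"
  and ideal_set_mult: "ideal_set J \<Longrightarrow> x \<in> J \<Longrightarrow> c * x \<in> J"
  by (auto simp: ideal_set_def)

lemma ideal_set_mult_right: "ideal_set J \<Longrightarrow> x \<in> J \<Longrightarrow> x * c \<in> J"
  using ideal_set_mult[of J x c] by (simp add: mult.commute)

lemma ideal_set_uminus: "ideal_set J \<Longrightarrow> x \<in> J \<Longrightarrow> - x \<in> J"
  using ideal_set_mult[of J x "-1"] by simp

lemma ideal_set_diff: "ideal_set J \<Longrightarrow> x \<in> J \<Longrightarrow> y \<in> J \<Longrightarrow> x - y \<in> J"
  using ideal_set_add[of J x "-y"] ideal_set_uminus[of J y] by simp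

lemma ideal_set_sum: "ideal_set J \<Longrightarrow> (\<And>a. a \<in> A \<Longrightarrow> f a \<in> J) \<Longrightarrow> sum f A \<in> J"
  by (induction A rule: infinite_finite_induct) (auto intro: ideal_set_zero ideal_set_add)

lemma ideal_set_UNIV: "ideal_set UNIV" and ideal_set_0: "ideal_set {0}"
  by (auto simp: ideal_set_def)

definition ideal_plus :: "'a::comm_ring_1 set \<Rightarrow> 'a set \<Rightarrow> 'a set" where
  "ideal_plus J K = {a + b | a b. a \<in> J \<and> b \<in> K}"

lemma ideal_plusI: "a \<in> J \<Longrightarrow> b \<in> K \<Longrightarrow> a + b \<in> ideal_plus J K"
  and ideal_plusE: "x \<in> ideal_plus J K \<Longrightarrow> (\<And>a b. x = a + b \<Longrightarrow> a \<in> J \<Longrightarrow> b \<in> K \<Longrightarrow> thesis) \<Longrightarrow> thesis"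
  by (auto simp: ideal_plus_def)

text \<open>This is \<open>N + (f\<^sub>0, \<dots>, f\<^bsub>k-1\<^esub>) M\<close>. The recursion splits off the last generator because a regular sequence
  puts its condition on the last element modulo the earlier ones.\<close>

primrec seq_span :: "(nat \<Rightarrow> 'a::comm_ring_1) \<Rightarrow> 'a set \<Rightarrow> 'a set \<Rightarrow> nat \<Rightarrow> 'a set" where
  "seq_span f N M 0 = N"
| "seq_span f N M (Suc k) = {z + f k * y | z y. z \<in> seq_span f N M k \<and> y \<in> M}"

lemma seq_span_Suc_I: "z \<in> seq_span f N M k \<Longrightarrow> y \<in> M \<Longrightarrow> z + f k * y \<in> seq_span f N M (Suc k)"
  by auto

lemma ideal_set_seq_span:
  assumes "ideal_set N" "ideal_set M"
  shows "ideal_set (seq_span f N M k)"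
proof (induction k)
  case (Suc k)
  show ?case
  proof (rule ideal_setI)
    show "0 \<in> seq_span f N M (Suc k)"
      using seq_span_Suc_I[OF ideal_set_zero[OF Suc] ideal_set_zero[OF assms(2)]] by simp
  next
    fix x y assume "x \<in> seq_span f N M (Suc k)" "y \<in> seq_span f N M (Suc k)"
    then obtain z u z' u' where *: "x = z + f k * u" "y = z' + f k * u'"
      "z \<in> seq_span f N M k" "z' \<in> seq_span f N M k" "u \<in> M" "u' \<in> M" by auto
    have "x + y = (z + z') + f k * (u + u')" by (simp add: * algebra_simps)
    then show "x + y \<in> seq_span f N M (Suc k)"
      using seq_span_Suc_I ideal_set_add[OF Suc *(3,4)] ideal_set_add[OF assms(2) *(5,6)] by metis
  next
    fix c x assume "x \<in> seq_span f N M (Suc k)"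
    then obtain z u where *: "x = z + f k * u" "z \<in> seq_span f N M k" "u \<in> M" by auto
    have "c * x = c * z + f k * (c * u)" by (simp add: * algebra_simps)
    then show "c * x \<in> seq_span f N M (Suc k)"
      using seq_span_Suc_I ideal_set_mult[OF Suc *(2)] ideal_set_mult[OF assms(2) *(3)] by metis
  qed
qed (use assms in simp)

lemma seq_span_mono: "N \<subseteq> N' \<Longrightarrow> M \<subseteq> M' \<Longrightarrow> seq_span f N M k \<subseteq> seq_span f N' M' k"
  by (induction k) (simp, fastforce)

lemma seq_span_le_Suc: "ideal_set M \<Longrightarrow> seq_span f N M k \<subseteq> seq_span f N M (Suc k)"
  using seq_span_Suc_I[of _ f N M k 0] ideal_set_zero[of M] by fastforce

lemma seq_span_base: "ideal_set M \<Longrightarrow> N \<subseteq> seq_span f N M k"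
proof (induction k)
  case (Suc k) then show ?case using seq_span_le_Suc[of M f N k] by blast
qed simp

lemma seq_span_gen: "ideal_set N \<Longrightarrow> ideal_set M \<Longrightarrow> y \<in> M \<Longrightarrow> f k * y \<in> seq_span f N M (Suc k)"
  using seq_span_Suc_I[of 0 f N M k y] ideal_set_zero[OF ideal_set_seq_span] by fastforce

lemma seq_span_subset: "ideal_set M \<Longrightarrow> N \<subseteq> M \<Longrightarrow> seq_span f N M k \<subseteq> M"
  by (induction k) (auto intro!: ideal_set_add ideal_set_mult)

text \<open>The pair \<open>M\<close>, \<open>N\<close> stands for the module \<open>M / N\<close>. Working with submodules of one ring replaces the
  chain of quotient modules that a regular sequence produces. The condition that the
  last quotient is nonzero is treated separately, in \<open>irrelevant_smult_proper\<close>.\<close>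

definition regular_on :: "(nat \<Rightarrow> 'a::comm_ring_1) \<Rightarrow> nat \<Rightarrow> 'a set \<Rightarrow> 'a set \<Rightarrow> bool" where
  "regular_on f r M N \<longleftrightarrow>
    (\<forall>i<r. \<forall>x\<in>M. f i * x \<in> seq_span f N M i \<longrightarrow> x \<in> seq_span f N M i)"

lemma regular_onD:
  "regular_on f r M N \<Longrightarrow> i < r \<Longrightarrow> x \<in> M \<Longrightarrow> f i * x \<in> seq_span f N M i \<Longrightarrow> x \<in> seq_span f N M i"
  by (auto simp: regular_on_def)

text \<open>The exact sequence is \<open>0 \<rightarrow> P \<rightarrow> S \<rightarrow> S / P \<rightarrow> 0\<close>. Regularity on \<open>S / P\<close> gives
  \<open>P \<inter> (f\<^sub>0, \<dots>, f\<^bsub>i-1\<^esub>) S = (f\<^sub>0, \<dots>, f\<^bsub>i-1\<^esub>) P\<close> for \<open>i \<le> k\<close>: in \<open>x = z + f\<^sub>i y\<close> with \<open>x \<in> P\<close> the factor \<open>y\<close> is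
  a combination of earlier terms modulo \<open>P\<close>, hence may be replaced by an element of \<open>P\<close>.
  So regularity on \<open>S\<close> passes to \<open>P\<close>, and \<open>P\<close> allows one term more than \<open>S / P\<close>.\<close>

lemma regular_on_submodule:
  assumes P: "ideal_set P" and q: "regular_on f k UNIV P" and S: "regular_on f (Suc k) UNIV {0}"
  shows "regular_on f (Suc k) P {0}"
proof -
  have *: "x \<in> seq_span f {0} P i" if "i \<le> k" "x \<in> P" "x \<in> seq_span f {0} UNIV i" for i x
    using that
  proof (induction i arbitrary: x)
    case (Suc i)
    then obtain z y where x: "x = z + f i * y" "z \<in> seq_span f {0} UNIV i" by auto
    have "f i * y = x - z" by (simp add: x)
    moreover have "x \<in> seq_span f P UNIV i" using Suc.prems(2) seq_span_base[OF ideal_set_UNIV] by blast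
    moreover have "z \<in> seq_span f P UNIV i"
      using x(2) seq_span_mono[of "{0}" P UNIV UNIV f i] ideal_set_zero[OF P] by auto
    ultimately have "f i * y \<in> seq_span f P UNIV i"
      using ideal_set_diff[OF ideal_set_seq_span[OF P ideal_set_UNIV]] by simp
    then have "y \<in> seq_span f P UNIV i"
      using regular_onD[OF q, of i y] Suc.prems(1) by simp
    moreover have "seq_span f P UNIV i = ideal_plus P (seq_span f {0} UNIV i)" for i
    proof (induction i)
      case 0 then show ?case by (auto simp: ideal_plus_def)
    next
      case (Suc i)
      have "x \<in> ideal_plus P (seq_span f {0} UNIV (Suc i))" if x: "x \<in> seq_span f P UNIV (Suc i)" for x
      proof -
        obtain w y where "x = w + f i * y" "w \<in> ideal_plus P (seq_span f {0} UNIV i)" using x Suc by auto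
        then obtain p z where "x = p + z + f i * y" "p \<in> P" "z \<in> seq_span f {0} UNIV i"
          by (auto elim: ideal_plusE)
        then show ?thesis unfolding ideal_plus_def using seq_span_Suc_I[of z f "{0}" UNIV i y] add.assoc by blast
      qed
      moreover have "x \<in> seq_span f P UNIV (Suc i)" if xi: "x \<in> ideal_plus P (seq_span f {0} UNIV (Suc i))" for x
      proof -
        obtain p z y where x: "x = p + (z + f i * y)" "p \<in> P" "z \<in> seq_span f {0} UNIV i"
          using xi by (auto elim!: ideal_plusE)
        then have "p + z \<in> seq_span f P UNIV i" using Suc by (auto simp: ideal_plus_def)
        then show ?thesis using seq_span_Suc_I[of "p + z" f P UNIV i y] x by (simp add: add.assoc)
      qed
      ultimately show ?case by blast
    qed
    ultimately obtain p w where y: "y = p + w" "p \<in> P" "w \<in> seq_span f {0} UNIV i"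
      by (auto simp: ideal_plus_def)
    have eq: "x - f i * p = z + f i * w" by (simp add: x y algebra_simps)
    have "x - f i * p \<in> seq_span f {0} UNIV i" unfolding eq
      using x y ideal_set_seq_span[OF ideal_set_0 ideal_set_UNIV] ideal_set_add ideal_set_mult by metis
    moreover have "x - f i * p \<in> P" using Suc.prems y P by (simp add: ideal_set_diff ideal_set_mult)
    ultimately have "x - f i * p \<in> seq_span f {0} P i" using Suc by simp
    then show ?case using seq_span_Suc_I[OF _ y(2), of "x - f i * p" f "{0}" i] by simp
  qed simp
  show ?thesis unfolding regular_on_def
  proof (intro allI impI ballI)
    fix i x assume i: "i < Suc k" and x: "x \<in> P" "f i * x \<in> seq_span f {0} P i"
    then have "f i * x \<in> seq_span f {0} UNIV i" using seq_span_mono[of "{0}" "{0}" P UNIV f i] by auto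
    then have "x \<in> seq_span f {0} UNIV i" using regular_onD[OF S i] by simp
    then show "x \<in> seq_span f {0} P i" using * i x by simp
  qed
qed

lemma ideal_set_ideal_plus: assumes "ideal_set J" "ideal_set K" shows "ideal_set (ideal_plus J K)"
proof (rule ideal_setI)
  show "0 \<in> ideal_plus J K" using assms[THEN ideal_set_zero] by (force simp: ideal_plus_def)
next
  fix x y assume "x \<in> ideal_plus J K" "y \<in> ideal_plus J K"
  then obtain a b c d where *: "x = a + b" "y = c + d" "a \<in> J" "c \<in> J" "b \<in> K" "d \<in> K"
    by (auto simp: ideal_plus_def)
  have "x + y = (a + c) + (b + d)" by (simp add: * algebra_simps)
  then show "x + y \<in> ideal_plus J K" using * assms unfolding ideal_plus_def by (blast intro: ideal_set_add)
next
  fix c x assume "x \<in> ideal_plus J K"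
  then obtain a b where *: "x = a + b" "a \<in> J" "b \<in> K" by (auto simp: ideal_plus_def)
  have "c * x = c * a + c * b" by (simp add: * algebra_simps)
  then show "c * x \<in> ideal_plus J K" using * assms unfolding ideal_plus_def by (blast intro: ideal_set_mult)
qed

text \<open>The exact sequence is the Mayer-Vietoris sequence \<open>0 \<rightarrow> J \<inter> K \<rightarrow> J \<oplus> K \<rightarrow> J + K \<rightarrow> 0\<close>. Suppose an element
  has an expression with coefficients in \<open>J\<close> and one with coefficients in \<open>K\<close>. The difference of
  the two last coefficients is annihilated modulo the earlier terms on \<open>J + K\<close>, so both can be
  corrected to one common coefficient in \<open>J \<inter> K\<close>.\<close>

lemma regular_on_Int:
  assumes J: "ideal_set J" and K: "ideal_set K"
    and rJ: "regular_on f (Suc k) J {0}" and rK: "regular_on f (Suc k) K {0}"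
    and rs: "regular_on f k (ideal_plus J K) {0}"
  shows "regular_on f (Suc k) (J \<inter> K) {0}"
proof -
  have split: "seq_span f {0} (ideal_plus J K) i \<subseteq> ideal_plus (seq_span f {0} J i) (seq_span f {0} K i)" for i
  proof (induction i)
    case 0 then show ?case by (auto simp: ideal_plus_def)
  next
    case (Suc i)
    show ?case
    proof
      fix x assume "x \<in> seq_span f {0} (ideal_plus J K) (Suc i)"
      then obtain z a b where x: "x = z + f i * (a + b)" "z \<in> seq_span f {0} (ideal_plus J K) i" "a \<in> J" "b \<in> K"
        by (auto simp: ideal_plus_def)
      then obtain u v where uv: "z = u + v" "u \<in> seq_span f {0} J i" "v \<in> seq_span f {0} K i"
        using Suc by (auto simp: ideal_plus_def)
      have "x = (u + f i * a) + (v + f i * b)" by (simp add: x uv algebra_simps)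
      then show "x \<in> ideal_plus (seq_span f {0} J (Suc i)) (seq_span f {0} K (Suc i))"
        unfolding ideal_plus_def using x uv seq_span_Suc_I by blast
    qed
  qed
  have *: "x \<in> seq_span f {0} (J \<inter> K) i"
    if "i \<le> k" "x \<in> seq_span f {0} J i" "x \<in> seq_span f {0} K i" for i x
    using that
  proof (induction i arbitrary: x)
    case (Suc i)
    obtain z a where xa: "x = z + f i * a" "z \<in> seq_span f {0} J i" "a \<in> J" using Suc.prems by auto
    obtain w b where xb: "x = w + f i * b" "w \<in> seq_span f {0} K i" "b \<in> K" using Suc.prems by auto
    note id = ideal_set_seq_span[OF ideal_set_0 J, of f i] ideal_set_seq_span[OF ideal_set_0 K, of f i]
      ideal_set_seq_span[OF ideal_set_0 ideal_set_ideal_plus[OF J K], of f i]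
    have JK: "J \<subseteq> ideal_plus J K" "K \<subseteq> ideal_plus J K"
      using J K by (force simp: ideal_plus_def dest: ideal_set_zero)+
    have "f i * (a - b) = w - z" using xa(1) xb(1) by (simp add: algebra_simps)
    also have "\<dots> \<in> seq_span f {0} (ideal_plus J K) i"
      using xa(2) xb(2) JK seq_span_mono[of "{0}" "{0}"] ideal_set_diff[OF id(3)]
      by (meson order_refl subset_eq)
    finally have "a - b \<in> seq_span f {0} (ideal_plus J K) i"
      using regular_onD[OF rs, of i "a - b"] Suc.prems(1) xa(3) xb(3) JK
        ideal_set_diff[OF ideal_set_ideal_plus[OF J K]] by (auto simp: subset_eq)
    then obtain c d where cd: "a - b = c + d" "c \<in> seq_span f {0} J i" "d \<in> seq_span f {0} K i"
      using split by (blast elim: ideal_plusE)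
    define y where "y = a - c"
    have yb: "y = b + d" using cd(1) by (simp add: y_def algebra_simps)
    have "y \<in> J" unfolding y_def
      using ideal_set_diff[OF J xa(3)] cd(2) seq_span_subset[OF J, of "{0}"] J
      by (auto dest: ideal_set_zero)
    moreover have "y \<in> K" unfolding yb
      using ideal_set_add[OF K xb(3)] cd(3) seq_span_subset[OF K, of "{0}"] K
      by (auto dest: ideal_set_zero)
    ultimately have y: "y \<in> J \<inter> K" by simp
    have e1: "x - f i * y = z + f i * c" by (simp add: xa y_def algebra_simps)
    have e2: "x - f i * y = w - f i * d" by (simp add: xb(1) yb algebra_simps)
    have "x - f i * y \<in> seq_span f {0} J i" unfolding e1
      using xa cd id by (simp add: ideal_set_add ideal_set_mult)
    moreover have "x - f i * y \<in> seq_span f {0} K i" unfolding e2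
      using xb cd id by (simp add: ideal_set_diff ideal_set_mult)
    ultimately have "x - f i * y \<in> seq_span f {0} (J \<inter> K) i" using Suc by simp
    then show ?case using seq_span_Suc_I[OF _ y, of "x - f i * y" f "{0}" i] by simp
  qed simp
  show ?thesis unfolding regular_on_def
  proof (intro allI impI ballI)
    fix i x assume i: "i < Suc k" and x: "x \<in> J \<inter> K" "f i * x \<in> seq_span f {0} (J \<inter> K) i"
    have "f i * x \<in> seq_span f {0} J i" "f i * x \<in> seq_span f {0} K i"
      using x(2) seq_span_mono[of "{0}" "{0}" "J \<inter> K"] by blast+
    then have "x \<in> seq_span f {0} J i" "x \<in> seq_span f {0} K i"
      using regular_onD[OF rJ i] regular_onD[OF rK i] x(1) by auto
    then show "x \<in> seq_span f {0} (J \<inter> K) i" using * i by simp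
  qed
qed

section \<open>Koszul cochains\<close>

text \<open>The usual sign of \<open>a\<close> in \<open>A\<close>, by its position in an arbitrary fixed numbering of the variables.\<close>

definition koszul_sign :: "'n::finite \<Rightarrow> 'n set \<Rightarrow> 'a::comm_ring_1" where
  "koszul_sign a A = (- 1) ^ card {b \<in> A. to_nat b < to_nat a}"

text \<open>A cochain of degree \<open>i\<close> is a function on sets of \<open>i\<close> variables; it stands for the sum of its values
  times the corresponding basis vectors of the exterior algebra, and \<open>koszul_d x\<close> is the exterior
  product with the vector \<open>x\<close>. Keeping all degrees in one function type avoids degree bookkeeping.\<close>

definition koszul_d :: "('n::finite \<Rightarrow> 'a::comm_ring_1) \<Rightarrow> ('n set \<Rightarrow> 'a) \<Rightarrow> 'n set \<Rightarrow> 'a" where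
  "koszul_d x c A = (\<Sum>a\<in>A. koszul_sign a A * x a * c (A - {a}))"

text \<open>Contraction with the covector \<open>g\<close>.\<close>

definition koszul_h :: "('n::finite \<Rightarrow> 'a::comm_ring_1) \<Rightarrow> ('n set \<Rightarrow> 'a) \<Rightarrow> 'n set \<Rightarrow> 'a" where
  "koszul_h g c A = (\<Sum>a\<in>- A. koszul_sign a (insert a A) * g a * c (insert a A))"

lemma koszul_sign_square: "koszul_sign a A * koszul_sign a A = 1"
  by (simp add: koszul_sign_def flip: power_add mult_2)

lemma koszul_sign_insert:
  assumes "b \<notin> A" "a \<noteq> b"
  shows "koszul_sign a (insert b A) = (if to_nat b < to_nat a then - koszul_sign a A else koszul_sign a A)"
proof -
  have "{c \<in> insert b A. to_nat c < to_nat a} =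
    (if to_nat b < to_nat a then insert b {c \<in> A. to_nat c < to_nat a} else {c \<in> A. to_nat c < to_nat a})"
    by auto
  then show ?thesis using assms by (simp add: koszul_sign_def)
qed

lemma koszul_sign_insert_self: "koszul_sign a (insert a A) = koszul_sign a A"
proof -
  have "{c \<in> insert a A. to_nat c < to_nat a} = {c \<in> A. to_nat c < to_nat a}" by auto
  then show ?thesis by (simp add: koszul_sign_def)
qed

lemma to_nat_less_antisym: "a \<noteq> b \<Longrightarrow> (to_nat (b::'n::finite) < to_nat a) \<longleftrightarrow> \<not> (to_nat a < to_nat b)"
  by (meson injD inj_to_nat linorder_neqE_nat not_less_iff_gr_or_eq)

lemma koszul_sign_swap:
  assumes "a \<noteq> b" "a \<notin> A" "b \<notin> A"
  shows "koszul_sign a (insert a (insert b A)) * koszul_sign b (insert b A) =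
    - (koszul_sign b (insert a (insert b A)) * koszul_sign a (insert a A) :: 'a::comm_ring_1)"
  using assms to_nat_less_antisym[of a b]
  by (simp add: insert_commute[of a b] koszul_sign_insert_self)
     (simp add: insert_commute[of b a] koszul_sign_insert_self koszul_sign_insert mult.commute)

lemma koszul_sign_swap_mixed:
  assumes "a \<in> A" "b \<notin> A"
  shows "koszul_sign a A * koszul_sign b (insert b (A - {a})) =
    - (koszul_sign b (insert b A) * koszul_sign a (insert b A) :: 'a::comm_ring_1)"
proof -
  define B where "B = A - {a}"
  have A: "A = insert a B" "a \<notin> B" "b \<notin> B" "a \<noteq> b" using assms by (auto simp: B_def)
  show ?thesis using A to_nat_less_antisym[of a b]
    by (simp add: koszul_sign_insert_self koszul_sign_insert insert_commute[of b a])
qed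

text \<open>In the two double sums the terms that remove \<open>a\<close> and add \<open>b \<noteq> a\<close> cancel by opposite signs; what
  remains removes and adds the same variable. Hence every element of the ideal generated by the
  \<open>x a\<close> acts as zero on Koszul cohomology.\<close>

lemma koszul_homotopy:
  "koszul_d x (koszul_h g c) A + koszul_h g (koszul_d x c) A = (\<Sum>a\<in>UNIV. g a * x a) * c A"
proof -
  let ?T = "\<lambda>a b. koszul_sign b (insert b A) * koszul_sign a (insert b A) * x a * g b * c (insert b (A - {a}))"
  have 1: "koszul_sign a A * x a * koszul_h g c (A - {a}) = g a * x a * c A - (\<Sum>b\<in>-A. ?T a b)"
    if "a \<in> A" for a
  proof -
    have co: "- (A - {a}) = insert a (- A)" using that by auto
    have "koszul_sign a A * x a * koszul_h g c (A - {a}) =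
      koszul_sign a A * x a * (koszul_sign a A * g a * c A +
       (\<Sum>b\<in>-A. koszul_sign b (insert b (A - {a})) * g b * c (insert b (A - {a}))))"
      using that by (simp add: koszul_h_def co insert_absorb)
    also have "\<dots> = (koszul_sign a A * koszul_sign a A) * (g a * x a * c A) +
       (\<Sum>b\<in>-A. koszul_sign a A * x a * (koszul_sign b (insert b (A - {a})) * g b * c (insert b (A - {a}))))"
      by (simp add: algebra_simps sum_distrib_left)
    also have "(\<Sum>b\<in>-A. koszul_sign a A * x a * (koszul_sign b (insert b (A - {a})) * g b * c (insert b (A - {a}))))
      = (\<Sum>b\<in>-A. - ?T a b)"
    proof (rule sum.cong[OF refl])
      fix b assume b: "b \<in> - A"
      have "koszul_sign a A * x a * (koszul_sign b (insert b (A - {a})) * g b * c (insert b (A - {a}))) =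
        (koszul_sign a A * koszul_sign b (insert b (A - {a}))) * (x a * g b * c (insert b (A - {a})))"
        by (simp add: algebra_simps)
      also have "\<dots> = - ?T a b" using that b by (simp add: koszul_sign_swap_mixed mult.assoc)
      finally show "koszul_sign a A * x a * (koszul_sign b (insert b (A - {a})) * g b * c (insert b (A - {a}))) = - ?T a b" .
    qed
    finally show ?thesis by (simp add: koszul_sign_square sum_negf)
  qed
  have 2: "koszul_sign b (insert b A) * g b * koszul_d x c (insert b A) = g b * x b * c A + (\<Sum>a\<in>A. ?T a b)"
    if "b \<in> - A" for b
  proof -
    have "koszul_sign b (insert b A) * g b * koszul_d x c (insert b A) =
      koszul_sign b (insert b A) * g b * (koszul_sign b (insert b A) * x b * c A +
      (\<Sum>a\<in>A. koszul_sign a (insert b A) * x a * c (insert b A - {a})))"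
      using that by (simp add: koszul_d_def)
    also have "\<dots> = (koszul_sign b (insert b A) * koszul_sign b (insert b A)) * (g b * x b * c A) +
      (\<Sum>a\<in>A. koszul_sign b (insert b A) * g b * (koszul_sign a (insert b A) * x a * c (insert b A - {a})))"
      by (simp add: algebra_simps sum_distrib_left)
    also have "(\<Sum>a\<in>A. koszul_sign b (insert b A) * g b * (koszul_sign a (insert b A) * x a * c (insert b A - {a})))
      = (\<Sum>a\<in>A. ?T a b)"
    proof (rule sum.cong[OF refl])
      fix a assume "a \<in> A"
      then have "insert b A - {a} = insert b (A - {a})" using that by auto
      then show "koszul_sign b (insert b A) * g b * (koszul_sign a (insert b A) * x a * c (insert b A - {a})) = ?T a b"
        by (simp add: algebra_simps)
    qed
    finally show ?thesis by (simp add: koszul_sign_square)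
  qed
  have "koszul_d x (koszul_h g c) A = (\<Sum>a\<in>A. g a * x a * c A) - (\<Sum>a\<in>A. \<Sum>b\<in>-A. ?T a b)"
    unfolding koszul_d_def[of x "koszul_h g c"] by (simp add: 1 sum_subtractf cong: sum.cong)
  moreover have "koszul_h g (koszul_d x c) A = (\<Sum>b\<in>-A. g b * x b * c A) + (\<Sum>b\<in>-A. \<Sum>a\<in>A. ?T a b)"
  proof -
    have "koszul_h g (koszul_d x c) A = (\<Sum>b\<in>-A. g b * x b * c A + (\<Sum>a\<in>A. ?T a b))"
      unfolding koszul_h_def[of g "koszul_d x c"] by (rule sum.cong[OF refl 2])
    then show ?thesis by (simp add: sum.distrib)
  qed
  moreover have "(\<Sum>b\<in>-A. \<Sum>a\<in>A. ?T a b) = (\<Sum>a\<in>A. \<Sum>b\<in>-A. ?T a b)" by (rule sum.swap)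
  moreover have "(\<Sum>a\<in>A. g a * x a * c A) + (\<Sum>b\<in>-A. g b * x b * c A) = (\<Sum>a\<in>UNIV. g a * x a * c A)"
    by (simp flip: sum.union_disjoint)
  ultimately show ?thesis by (simp add: sum_distrib_right)
qed

text \<open>The terms for \<open>(a, b)\<close> and \<open>(b, a)\<close> are opposite. The sum is cut along the numbering of the
  variables, as being its own negative would not force it to vanish in characteristic two.\<close>

lemma koszul_d_d:
  fixes x :: "'n::finite \<Rightarrow> 'a::comm_ring_1"
  shows "koszul_d x (koszul_d x c) A = 0"
proof -
  let ?T = "\<lambda>a b. koszul_sign a A * koszul_sign b (A - {a}) * x a * x b * c (A - {a} - {b})"
  have anti: "?T a b = - ?T b a" if "a \<in> A" "b \<in> A" "a \<noteq> b" for a b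
  proof -
    define B where "B = A - {a} - {b}"
    have A: "A = insert a (insert b B)" "a \<notin> B" "b \<notin> B" using that by (auto simp: B_def)
    have "A - {a} = insert b B" "A - {b} = insert a B" "A - {b} - {a} = B" "A - {a} - {b} = B"
      using A that by auto
    then have "?T a b = (koszul_sign a A * koszul_sign b (insert b B)) * (x a * x b * c B)"
      "?T b a = (koszul_sign b A * koszul_sign a (insert a B)) * (x a * x b * c B)"
      by (simp_all add: algebra_simps)
    moreover have "koszul_sign a A * koszul_sign b (insert b B) = - (koszul_sign b A * koszul_sign a (insert a B) :: 'a)"
      using koszul_sign_swap[of a b B] that A by simp
    ultimately show ?thesis by (simp only: mult_minus_left)
  qed
  have "koszul_d x (koszul_d x c) A = (\<Sum>a\<in>A. \<Sum>b\<in>A - {a}. ?T a b)"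
    by (simp add: koszul_d_def sum_distrib_left mult.assoc mult.left_commute)
  also have "\<dots> = (\<Sum>(a,b)\<in>(SIGMA a:A. A - {a}). ?T a b)"
    by (rule sum.Sigma) auto
  also have "(SIGMA a:A. A - {a}) = {(a,b)\<in>A\<times>A. to_nat a < to_nat b} \<union> {(a,b)\<in>A\<times>A. to_nat b < to_nat a}"
    using to_nat_less_antisym by fastforce
  also have "(\<Sum>(a,b)\<in>\<dots>. ?T a b) = (\<Sum>(a,b)\<in>{(a,b)\<in>A\<times>A. to_nat a < to_nat b}. ?T a b) +
     (\<Sum>(a,b)\<in>{(a,b)\<in>A\<times>A. to_nat b < to_nat a}. ?T a b)"
    by (rule sum.union_disjoint) auto
  also have "(\<Sum>(a,b)\<in>{(a,b)\<in>A\<times>A. to_nat b < to_nat a}. ?T a b) =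
    (\<Sum>(a,b)\<in>{(a,b)\<in>A\<times>A. to_nat a < to_nat b}. ?T b a)"
    by (rule sum.reindex_bij_witness[of _ prod.swap prod.swap]) auto
  also have "\<dots> = (\<Sum>(a,b)\<in>{(a,b)\<in>A\<times>A. to_nat a < to_nat b}. - ?T a b)"
    by (rule sum.cong[OF refl]) (auto intro!: anti)
  finally show ?thesis by (simp add: sum_negf case_prod_unfold)
qed

lemma koszul_d_add: "koszul_d x (\<lambda>A. c A + c' A) A = koszul_d x c A + koszul_d x c' A"
  by (simp add: koszul_d_def algebra_simps sum.distrib)

lemma koszul_d_diff: "koszul_d x (\<lambda>A. c A - c' A) A = koszul_d x c A - koszul_d x c' A"
  by (simp add: koszul_d_def algebra_simps sum_subtractf)

lemma koszul_d_mult: "koszul_d x (\<lambda>A. f * c A) A = f * koszul_d x c A"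
  by (simp add: koszul_d_def algebra_simps sum_distrib_left)

text \<open>A regular sequence of length \<open>r\<close> in the ideal of the \<open>x a\<close> kills Koszul cohomology below degree \<open>r\<close>.
  Write \<open>f = f\<^sub>k\<close> and let \<open>c\<close> be a cocycle modulo \<open>(f\<^sub>0, \<dots>, f\<^bsub>k-1\<^esub>) M\<close>. By the homotopy \<open>f c\<close> is the
  coboundary of some \<open>b\<close>, which is therefore a cocycle modulo \<open>f\<close> in one degree less. By induction
  \<open>b = d a + f e\<close>, so \<open>f c = f d e\<close>, and \<open>f\<close> may be cancelled.\<close>

lemma koszul_cohomology_vanishes:
  fixes x :: "'n::finite \<Rightarrow> 'a::comm_ring_1"
  assumes M: "ideal_set M" and N: "ideal_set N" "N \<subseteq> M" and reg: "regular_on f r M N"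
    and f: "\<And>i. i < r \<Longrightarrow> \<exists>g. f i = (\<Sum>a\<in>UNIV. g a * x a)"
    and "k + i < r"
    and "\<And>A. card A = i \<Longrightarrow> c A \<in> M" and "\<And>A. card A = Suc i \<Longrightarrow> koszul_d x c A \<in> seq_span f N M k"
  shows "\<exists>e. (\<forall>A. Suc (card A) = i \<longrightarrow> e A \<in> M) \<and> (\<forall>A. card A = i \<longrightarrow> c A - koszul_d x e A \<in> seq_span f N M k)"
  using assms(6-)
proof (induction i arbitrary: k c)
  case 0
  obtain g where g: "f k = (\<Sum>a\<in>UNIV. g a * x a)" using f 0 by auto
  note id = ideal_set_seq_span[OF N(1) M, of f k]
  have "f k * c {} = koszul_h g (koszul_d x c) {}"
    using koszul_homotopy[of x g c "{}"] by (simp add: koszul_d_def[of x "koszul_h g c"] g)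
  also have "\<dots> \<in> seq_span f N M k" unfolding koszul_h_def
    using id 0(3) by (intro ideal_set_sum ideal_set_mult) auto
  finally have "c {} \<in> seq_span f N M k" using regular_onD[OF reg] 0 by simp
  then show ?case by (intro exI[of _ "\<lambda>_. 0"]) (auto simp: koszul_d_def)
next
  case (Suc i)
  obtain g where g: "f k = (\<Sum>a\<in>UNIV. g a * x a)" using f[of k] Suc.prems(1) by auto
  note id = ideal_set_seq_span[OF N(1) M, of f k] and id' = ideal_set_seq_span[OF N(1) M, of f "Suc k"]
  define b where "b = koszul_h g c"
  have hom: "f k * c A = koszul_d x b A + koszul_h g (koszul_d x c) A" for A
    using koszul_homotopy[of x g c A] by (simp add: b_def g)
  have h: "koszul_h g (koszul_d x c) A \<in> seq_span f N M k" if "card A = Suc i" for A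
    unfolding koszul_h_def using id Suc.prems(3) that by (intro ideal_set_sum ideal_set_mult) auto
  have bM: "b A \<in> M" if "card A = i" for A
    unfolding b_def koszul_h_def using M Suc.prems(2) that by (intro ideal_set_sum ideal_set_mult) auto
  have db: "koszul_d x b A \<in> seq_span f N M (Suc k)" if "card A = Suc i" for A
  proof -
    have "koszul_d x b A = f k * c A - koszul_h g (koszul_d x c) A" using hom[of A] by simp
    also have "\<dots> \<in> seq_span f N M (Suc k)"
      using id' h[OF that] seq_span_le_Suc[OF M, of f N k] seq_span_gen[OF N(1) M, of "c A" f k] Suc.prems(2)[OF that]
      by (intro ideal_set_diff) auto
    finally show ?thesis .
  qed
  obtain a where a: "\<And>A. card A = i \<Longrightarrow> b A - koszul_d x a A \<in> seq_span f N M (Suc k)"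
    using Suc.IH[of "Suc k" b] Suc.prems(1) bM db by auto
  have "\<exists>z y. card A = i \<longrightarrow> z \<in> seq_span f N M k \<and> y \<in> M \<and> b A - koszul_d x a A = z + f k * y" for A
    using a[of A] by auto
  then obtain z e where ze: "\<And>A. card A = i \<Longrightarrow> z A \<in> seq_span f N M k"
    "\<And>A. card A = i \<Longrightarrow> e A \<in> M" "\<And>A. card A = i \<Longrightarrow> b A - koszul_d x a A = z A + f k * e A"
    by metis
  have "c A - koszul_d x e A \<in> seq_span f N M k" if A: "card A = Suc i" for A
  proof -
    have sub: "card (A - {u}) = i" if "u \<in> A" for u using A that by simp
    have "koszul_d x b A = koszul_d x (\<lambda>A. koszul_d x a A + (z A + f k * e A)) A"
      unfolding koszul_d_def[of x b] koszul_d_def[of x "\<lambda>A. koszul_d x a A + (z A + f k * e A)"]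
      using ze(3) sub by (intro sum.cong) (simp_all flip: ze(3))
    also have "\<dots> = koszul_d x z A + f k * koszul_d x e A"
      by (simp add: koszul_d_add koszul_d_mult koszul_d_d)
    finally have "f k * (c A - koszul_d x e A) = koszul_d x z A + koszul_h g (koszul_d x c) A"
      using hom[of A] by (simp add: algebra_simps)
    also have "\<dots> \<in> seq_span f N M k"
      using h[OF A] id ze(1) sub unfolding koszul_d_def by (intro ideal_set_add ideal_set_sum ideal_set_mult) auto
    finally have "f k * (c A - koszul_d x e A) \<in> seq_span f N M k" .
    moreover have "c A - koszul_d x e A \<in> M"
      using Suc.prems(2)[OF A] ze(2) sub M unfolding koszul_d_def
      by (intro ideal_set_diff ideal_set_sum ideal_set_mult) auto
    ultimately show ?thesis using regular_onD[OF reg, of k] Suc.prems(1) by simp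
  qed
  then show ?case using ze(2) by (intro exI[of _ e]) auto
qed

section \<open>Polynomials and their monomials\<close>

abbreviation coef :: "('n::finite, 'k::field) mpoly \<Rightarrow> ('n \<Rightarrow>\<^sub>0 nat) \<Rightarrow> 'k" where
  "coef \<equiv> Poly_Mapping.lookup"

abbreviation monomials :: "('n::finite, 'k::field) mpoly \<Rightarrow> ('n \<Rightarrow>\<^sub>0 nat) set" where
  "monomials \<equiv> Poly_Mapping.keys"

lemma mpoly_eq_sum_terms:
  "(p :: ('n::finite, 'k::field) mpoly) = (\<Sum>u\<in>monomials p. Poly_Mapping.single u (coef p u))"
proof (rule poly_mapping_eqI)
  fix e
  have "(\<Sum>u\<in>monomials p. coef (Poly_Mapping.single u (coef p u)) e)
    = (\<Sum>u\<in>monomials p. if u = e then coef p u else 0)"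
    by (rule sum.cong) (auto simp: lookup_single when_def)
  also have "\<dots> = coef p e" by (simp add: sum.delta in_keys_iff)
  finally show "coef p e = coef (\<Sum>u\<in>monomials p. Poly_Mapping.single u (coef p u)) e"
    by (simp add: lookup_sum)
qed

lemma coef_mult:
  fixes p q :: "('n::finite, 'k::field) mpoly"
  shows "coef (p * q) e = (\<Sum>u\<in>monomials p. \<Sum>v\<in>monomials q. if u + v = e then coef p u * coef q v else 0)"
proof -
  have "p * q = (\<Sum>u\<in>monomials p. \<Sum>v\<in>monomials q. Poly_Mapping.single (u + v) (coef p u * coef q v))"
    by (subst (1) mpoly_eq_sum_terms[of p], subst (1) mpoly_eq_sum_terms[of q])
       (simp add: sum_product mult_single)
  then show ?thesis by (simp add: lookup_sum lookup_single when_def)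
qed

lemma monomials_mult_subset:
  fixes p q :: "('n::finite, 'k::field) mpoly"
  shows "monomials (p * q) \<subseteq> {u + v | u v. u \<in> monomials p \<and> v \<in> monomials q}"
  using keys_mult by blast

lemma coef_single_mult:
  fixes p :: "('n::finite, 'k::field) mpoly"
  shows "coef (Poly_Mapping.single u c * p) (u + e) = c * coef p e"
proof (cases "c = 0")
  case False
  have "coef (Poly_Mapping.single u c * p) (u + e) = (\<Sum>v\<in>monomials p. if v = e then c * coef p v else 0)"
    using False by (simp add: coef_mult cong: if_cong)
  also have "\<dots> = c * coef p e" by (simp add: sum.delta in_keys_iff)
  finally show ?thesis .
qed simp

lemma coef_single_mult_zero:
  fixes p :: "('n::finite, 'k::field) mpoly"
  assumes "\<And>v. e \<noteq> u + v"
  shows "coef (Poly_Mapping.single u c * p) e = 0"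
proof -
  have "e \<notin> monomials (Poly_Mapping.single u c * p)"
    using monomials_mult_subset[of "Poly_Mapping.single u c" p] assms by (auto split: if_splits)
  then show ?thesis by (simp add: in_keys_iff)
qed

lemma keys_add_nat: "Poly_Mapping.keys (u + v) = Poly_Mapping.keys u \<union> Poly_Mapping.keys (v :: 'n \<Rightarrow>\<^sub>0 nat)"
  by (auto simp: in_keys_iff lookup_add)

definition restrict_monomials :: "(('n \<Rightarrow>\<^sub>0 nat) \<Rightarrow> bool) \<Rightarrow> ('n::finite, 'k::field) mpoly \<Rightarrow> ('n, 'k) mpoly" where
  "restrict_monomials Q p = Poly_Mapping.mapp (\<lambda>e c. if Q e then c else 0) p"

lemma coef_restrict_monomials: "coef (restrict_monomials Q p) e = (if Q e then coef p e else 0)"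
  by (auto simp: restrict_monomials_def lookup_mapp when_def in_keys_iff)

lemma monomials_restrict_monomials: "monomials (restrict_monomials Q p) = {e \<in> monomials p. Q e}"
  by (auto simp: in_keys_iff coef_restrict_monomials split: if_splits)

lemma restrict_monomials_add: "restrict_monomials Q (p + q) = restrict_monomials Q p + restrict_monomials Q q"
  by (rule poly_mapping_eqI) (simp add: coef_restrict_monomials lookup_add)

lemma restrict_monomials_split: "p = restrict_monomials Q p + restrict_monomials (\<lambda>e. \<not> Q e) p"
  by (rule poly_mapping_eqI) (simp add: coef_restrict_monomials lookup_add)

lemma restrict_monomials_id: "(\<And>e. e \<in> monomials p \<Longrightarrow> Q e) \<Longrightarrow> restrict_monomials Q p = p"
  by (rule poly_mapping_eqI) (auto simp: coef_restrict_monomials in_keys_iff)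

lemma restrict_monomials_none: "(\<And>e. e \<in> monomials p \<Longrightarrow> \<not> Q e) \<Longrightarrow> restrict_monomials Q p = 0"
  by (rule poly_mapping_eqI) (auto simp: coef_restrict_monomials in_keys_iff)

section \<open>Stanley-Reisner ideals\<close>

text \<open>The Stanley-Reisner ideal of the simplicial complex generated by the faces in \<open>\<F>\<close>. In particular
  \<open>sr_ideal {F}\<close> is the prime ideal generated by the variables outside \<open>F\<close>, and \<open>sr_ideal {{}}\<close> is
  the ideal of all variables.\<close>

definition sr_ideal :: "'n set set \<Rightarrow> ('n::finite, 'k::field) mpoly set" where
  "sr_ideal \<F> = {p. \<forall>e\<in>monomials p. \<forall>F\<in>\<F>. \<not> Poly_Mapping.keys e \<subseteq> F}"

lemma sr_idealD: "p \<in> sr_ideal \<F> \<Longrightarrow> e \<in> monomials p \<Longrightarrow> F \<in> \<F> \<Longrightarrow> \<not> Poly_Mapping.keys e \<subseteq> F"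
  unfolding sr_ideal_def by blast

lemma ideal_set_sr_ideal: "ideal_set (sr_ideal \<F> :: ('n::finite, 'k::field) mpoly set)"
proof (rule ideal_setI)
  fix p q :: "('n, 'k) mpoly" assume "p \<in> sr_ideal \<F>" "q \<in> sr_ideal \<F>"
  then show "p + q \<in> sr_ideal \<F>" using keys_add[of p q] by (auto simp: sr_ideal_def)
next
  fix c p :: "('n, 'k) mpoly" assume p: "p \<in> sr_ideal \<F>"
  show "c * p \<in> sr_ideal \<F>" unfolding sr_ideal_def
  proof safe
    fix e F assume "e \<in> monomials (c * p)" "F \<in> \<F>" and e: "Poly_Mapping.keys e \<subseteq> F"
    then obtain u v where "e = u + v" "v \<in> monomials p"
      using monomials_mult_subset[of c p] by auto
    then show False using p \<open>F \<in> \<F>\<close> e by (auto simp: sr_ideal_def keys_add_nat)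
  qed
qed (simp add: sr_ideal_def)

lemma sr_ideal_insert: "sr_ideal (insert F \<F>) = sr_ideal \<F> \<inter> sr_ideal {F}"
  by (auto simp: sr_ideal_def)

lemma sr_ideal_UNIV: "sr_ideal {UNIV} = {0}"
  by (auto simp: sr_ideal_def)

text \<open>Only the faces below members of the generating family matter.\<close>

lemma sr_ideal_cong:
  assumes "\<And>F. F \<in> \<F> \<Longrightarrow> \<exists>G\<in>\<G>. F \<subseteq> G" "\<And>G. G \<in> \<G> \<Longrightarrow> \<exists>F\<in>\<F>. G \<subseteq> F"
  shows "sr_ideal \<F> = sr_ideal \<G>"
  using assms unfolding sr_ideal_def by (metis (no_types, lifting) subset_trans)

text \<open>A term that survives in neither summand has its support in some \<open>F\<close> and in some \<open>G\<close>, hence in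
  \<open>F \<inter> G\<close>. This is why sums of Stanley-Reisner ideals stay within the class.\<close>

lemma ideal_plus_sr_ideal:
  "ideal_plus (sr_ideal \<F>) (sr_ideal \<G>) = (sr_ideal {F \<inter> G | F G. F \<in> \<F> \<and> G \<in> \<G>} :: ('n::finite, 'k::field) mpoly set)"
proof
  show "ideal_plus (sr_ideal \<F>) (sr_ideal \<G>) \<subseteq> (sr_ideal {F \<inter> G | F G. F \<in> \<F> \<and> G \<in> \<G>} :: ('n, 'k) mpoly set)"
  proof
    fix p :: "('n, 'k) mpoly" assume "p \<in> ideal_plus (sr_ideal \<F>) (sr_ideal \<G>)"
    then obtain a b where p: "p = a + b" and ab: "a \<in> sr_ideal \<F>" "b \<in> sr_ideal \<G>" by (auto elim: ideal_plusE)
    have "a \<in> sr_ideal {F \<inter> G | F G. F \<in> \<F> \<and> G \<in> \<G>}" "b \<in> sr_ideal {F \<inter> G | F G. F \<in> \<F> \<and> G \<in> \<G>}"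
      using ab unfolding sr_ideal_def by blast+
    then show "p \<in> sr_ideal {F \<inter> G | F G. F \<in> \<F> \<and> G \<in> \<G>}"
      unfolding p by (rule ideal_set_add[OF ideal_set_sr_ideal])
  qed
next
  show "(sr_ideal {F \<inter> G | F G. F \<in> \<F> \<and> G \<in> \<G>} :: ('n, 'k) mpoly set) \<subseteq> ideal_plus (sr_ideal \<F>) (sr_ideal \<G>)"
  proof
    fix p :: "('n, 'k) mpoly" assume p: "p \<in> sr_ideal {F \<inter> G | F G. F \<in> \<F> \<and> G \<in> \<G>}"
    let ?Q = "\<lambda>e. \<forall>F\<in>\<F>. \<not> Poly_Mapping.keys e \<subseteq> F"
    have "restrict_monomials ?Q p \<in> sr_ideal \<F>" by (auto simp: sr_ideal_def monomials_restrict_monomials)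
    moreover have "restrict_monomials (\<lambda>e. \<not> ?Q e) p \<in> sr_ideal \<G>"
      unfolding sr_ideal_def
    proof (intro CollectI ballI notI)
      fix e G assume e: "e \<in> monomials (restrict_monomials (\<lambda>e. \<not> ?Q e) p)" and G: "G \<in> \<G>" "Poly_Mapping.keys e \<subseteq> G"
      then obtain F where F: "e \<in> monomials p" "F \<in> \<F>" "Poly_Mapping.keys e \<subseteq> F"
        by (auto simp: monomials_restrict_monomials)
      then have "F \<inter> G \<in> {F \<inter> G | F G. F \<in> \<F> \<and> G \<in> \<G>}" using G(1) by blast
      from sr_idealD[OF p F(1) this] show False using F(3) G(2) by simp
    qed
    ultimately show "p \<in> ideal_plus (sr_ideal \<F>) (sr_ideal \<G>)"
      by (subst restrict_monomials_split[of p ?Q]) (rule ideal_plusI)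
  qed
qed

definition indicator_exp :: "'n set \<Rightarrow> 'n::finite \<Rightarrow>\<^sub>0 nat" where
  "indicator_exp A = (\<Sum>a\<in>A. Poly_Mapping.single a 1)"

lemma lookup_indicator_exp: "Poly_Mapping.lookup (indicator_exp A) a = (if a \<in> A then 1 else 0)"
proof -
  have "Poly_Mapping.lookup (indicator_exp A) a = (\<Sum>b\<in>A. if b = a then 1 else 0)"
    by (simp add: indicator_exp_def lookup_sum lookup_single when_def)
  then show ?thesis by simp
qed

lemma keys_indicator_exp: "Poly_Mapping.keys (indicator_exp A) = A"
  by (auto simp: in_keys_iff lookup_indicator_exp split: if_splits)

lemma indicator_exp_insert: "a \<notin> A \<Longrightarrow> indicator_exp (insert a A) = Poly_Mapping.single a 1 + indicator_exp A"
  by (simp add: indicator_exp_def)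

definition sqfree :: "'n set \<Rightarrow> ('n::finite, 'k::field) mpoly" where
  "sqfree A = Poly_Mapping.single (indicator_exp A) 1"

lemma variable_eq: "variable a = Poly_Mapping.single (Poly_Mapping.single a 1) 1"
  by (simp add: variable_def power_product_def)

lemma sqfree_empty: "sqfree {} = 1"
  by (simp add: sqfree_def indicator_exp_def)

lemma sqfree_insert: "a \<notin> A \<Longrightarrow> sqfree (insert a A) = variable a * sqfree A"
  by (simp add: sqfree_def variable_eq indicator_exp_insert mult_single)

lemma monomials_sqfree: "monomials (sqfree A :: ('n::finite, 'k::field) mpoly) = {indicator_exp A}"
  by (simp add: sqfree_def)

lemma sqfree_in_sr_ideal: "sqfree A \<in> sr_ideal \<F> \<longleftrightarrow> (\<forall>F\<in>\<F>. \<not> A \<subseteq> F)"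
  by (simp add: sr_ideal_def monomials_sqfree keys_indicator_exp)

lemma variable_in_sr_ideal: "variable a \<in> sr_ideal \<F> \<longleftrightarrow> (\<forall>F\<in>\<F>. a \<notin> F)"
  by (simp add: sr_ideal_def variable_eq)

lemma sr_ideal_face_subset_iff:
  "sr_ideal {F} \<subseteq> (sr_ideal {G} :: ('n::finite, 'k::field) mpoly set) \<longleftrightarrow> G \<subseteq> F"
proof
  assume "sr_ideal {F} \<subseteq> (sr_ideal {G} :: ('n, 'k) mpoly set)"
  moreover have "(sqfree G :: ('n, 'k) mpoly) \<notin> sr_ideal {G}" by (simp add: sqfree_in_sr_ideal)
  ultimately have "(sqfree G :: ('n, 'k) mpoly) \<notin> sr_ideal {F}" by blast
  then show "G \<subseteq> F" by (simp add: sqfree_in_sr_ideal)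
qed (auto simp: sr_ideal_def)

lemma sr_ideal_face_inject:
  "sr_ideal {F} = (sr_ideal {G} :: ('n::finite, 'k::field) mpoly set) \<longleftrightarrow> F = G"
  using sr_ideal_face_subset_iff[of F G] sr_ideal_face_subset_iff[of G F] by blast

lemma exponent_minus:
  assumes "Poly_Mapping.lookup e a \<noteq> 0"
  shows "\<exists>v. (e :: 'n \<Rightarrow>\<^sub>0 nat) = Poly_Mapping.single a 1 + v"
proof
  show "e = Poly_Mapping.single a 1 + (e - Poly_Mapping.single a 1)"
    using assms by (intro poly_mapping_eqI) (auto simp: lookup_add lookup_minus lookup_single when_def)
qed

lemma single_eq_variable_mult:
  assumes "a \<in> Poly_Mapping.keys e"
  shows "\<exists>q. Poly_Mapping.single e c = q * (variable a :: ('n::finite, 'k::field) mpoly)"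
proof -
  obtain v where "e = Poly_Mapping.single a 1 + v" using exponent_minus[of e a] assms by (auto simp: in_keys_iff)
  then have "Poly_Mapping.single e c = Poly_Mapping.single v c * (variable a :: ('n, 'k) mpoly)"
    by (simp add: variable_eq mult_single add.commute)
  then show ?thesis by blast
qed

lemma sr_ideal_variables:
  fixes p :: "('n::finite, 'k::field) mpoly"
  assumes "p \<in> sr_ideal {F}"
  shows "\<exists>g. p = (\<Sum>a\<in>- F. g a * variable a)"
proof -
  have "\<exists>g. Poly_Mapping.single e c = (\<Sum>a\<in>- F. g a * (variable a :: ('n, 'k) mpoly))" if "e \<in> monomials p" for e c
  proof -
    have "\<not> Poly_Mapping.keys e \<subseteq> F" using assms that by (simp add: sr_ideal_def)
    then obtain a where a: "a \<in> Poly_Mapping.keys e" "a \<in> - F" by blast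
    then obtain q :: "('n, 'k) mpoly" where "Poly_Mapping.single e c = q * variable a"
      using single_eq_variable_mult by blast
    then have "Poly_Mapping.single e c = (\<Sum>b\<in>- F. (if b = a then q else 0) * variable b)"
      using a by (simp add: if_distrib[of "\<lambda>q. q * _"] cong: if_cong)
    then show ?thesis by (rule exI[of _ "\<lambda>b. if b = a then q else 0"])
  qed
  then have "\<forall>e. \<exists>g. e \<in> monomials p \<longrightarrow> Poly_Mapping.single e (coef p e) = (\<Sum>a\<in>- F. g a * (variable a :: ('n, 'k) mpoly))"
    by blast
  then obtain g where g: "\<And>e. e \<in> monomials p \<Longrightarrow>
      Poly_Mapping.single e (coef p e) = (\<Sum>a\<in>- F. g e a * (variable a :: ('n, 'k) mpoly))" by metis
  have "p = (\<Sum>e\<in>monomials p. \<Sum>a\<in>- F. g e a * variable a)"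
    by (subst (1) mpoly_eq_sum_terms[of p]) (simp add: g)
  also have "\<dots> = (\<Sum>a\<in>- F. (\<Sum>e\<in>monomials p. g e a) * variable a)"
    by (subst sum.swap) (simp add: sum_distrib_right)
  finally show ?thesis by (rule exI[of _ "\<lambda>a. \<Sum>e\<in>monomials p. g e a"])
qed

lemma sr_ideal_coatom:
  "sr_ideal {- {a}} = range ((*) (variable a))" (is "?L = ?R")
proof
  show "?L \<subseteq> ?R"
  proof
    fix p assume "p \<in> ?L"
    then obtain g where "p = (\<Sum>b\<in>- (- {a}). g b * variable b)" using sr_ideal_variables by blast
    then have "p = variable a * g a" by (simp add: mult.commute)
    then show "p \<in> ?R" by simp
  qed
  show "?R \<subseteq> ?L" using ideal_set_mult_right[OF ideal_set_sr_ideal, of "variable a" "{- {a}}"]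
    by (auto simp: variable_in_sr_ideal)
qed

section \<open>The grading by degree\<close>

definition deg :: "('n::finite \<Rightarrow>\<^sub>0 nat) \<Rightarrow> nat" where
  "deg e = (\<Sum>a\<in>UNIV. Poly_Mapping.lookup e a)"

lemma deg_add: "deg (u + v) = deg u + deg v"
  by (simp add: deg_def lookup_add sum.distrib)

lemma deg_indicator_exp: "deg (indicator_exp A) = card A"
  by (simp add: deg_def lookup_indicator_exp sum.If_cases)

abbreviation hom_part :: "nat \<Rightarrow> ('n::finite, 'k::field) mpoly \<Rightarrow> ('n, 'k) mpoly" where
  "hom_part d \<equiv> restrict_monomials (\<lambda>e. deg e = d)"

definition homogeneous :: "nat \<Rightarrow> ('n::finite, 'k::field) mpoly \<Rightarrow> bool" where
  "homogeneous d p \<longleftrightarrow> (\<forall>e\<in>monomials p. deg e = d)"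

lemma homogeneous_hom_part: "homogeneous d (hom_part d p)"
  by (auto simp: homogeneous_def monomials_restrict_monomials)

lemma hom_part_homogeneous: "homogeneous d p \<Longrightarrow> hom_part d p = p"
  by (rule restrict_monomials_id) (auto simp: homogeneous_def)

lemma homogeneous_variable: "homogeneous 1 (variable a)"
  using deg_indicator_exp[of "{a}"] by (simp add: homogeneous_def variable_eq indicator_exp_def)

lemma hom_part_mult:
  assumes "homogeneous k f"
  shows "hom_part (k + d) (f * p) = f * hom_part d p"
proof -
  have "hom_part (k + d) (f * p) = hom_part (k + d) (f * hom_part d p) + hom_part (k + d) (f * restrict_monomials (\<lambda>e. deg e \<noteq> d) p)"
    using restrict_monomials_split[of p "\<lambda>e. deg e = d"] by (metis distrib_left restrict_monomials_add)
  also have "hom_part (k + d) (f * hom_part d p) = f * hom_part d p"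
    using monomials_mult_subset[of f "hom_part d p"] assms
    by (intro restrict_monomials_id) (fastforce simp: monomials_restrict_monomials homogeneous_def deg_add)
  also have "hom_part (k + d) (f * restrict_monomials (\<lambda>e. deg e \<noteq> d) p) = 0"
    using monomials_mult_subset[of f "restrict_monomials (\<lambda>e. deg e \<noteq> d) p"] assms
    by (intro restrict_monomials_none) (fastforce simp: monomials_restrict_monomials homogeneous_def deg_add)
  finally show ?thesis by simp
qed

lemma hom_part_mult_small:
  assumes "homogeneous k f" "d < k"
  shows "hom_part d (f * p) = 0"
  using monomials_mult_subset[of f p] assms
  by (intro restrict_monomials_none) (fastforce simp: homogeneous_def deg_add)

lemma sum_hom_parts: "\<exists>D. p = (\<Sum>d<D. hom_part d p)"
proof -
  have "finite (deg ` monomials p)" by simp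
  then obtain D where D: "\<And>e. e \<in> monomials p \<Longrightarrow> deg e < D"
    unfolding finite_nat_set_iff_bounded by blast
  have "p = (\<Sum>d<D. hom_part d p)"
    by (rule poly_mapping_eqI) (use D in \<open>auto simp: lookup_sum coef_restrict_monomials in_keys_iff\<close>)
  then show ?thesis by blast
qed

definition graded_ideal :: "('n::finite, 'k::field) mpoly set \<Rightarrow> bool" where
  "graded_ideal Q \<longleftrightarrow> ideal_set Q \<and> (\<forall>p\<in>Q. \<forall>d. hom_part d p \<in> Q)"

lemma graded_sr_ideal: "graded_ideal (sr_ideal \<F>)"
  by (auto simp: graded_ideal_def ideal_set_sr_ideal) (auto simp: sr_ideal_def monomials_restrict_monomials)

lemma graded_seq_span:
  assumes N: "graded_ideal N" and f: "\<And>i. \<exists>d. homogeneous d (f i)"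
  shows "graded_ideal (seq_span f N UNIV k)"
proof -
  have id: "ideal_set (seq_span f N UNIV k)" for k
    using N ideal_set_seq_span ideal_set_UNIV by (auto simp: graded_ideal_def)
  have "hom_part d p \<in> seq_span f N UNIV k" if "p \<in> seq_span f N UNIV k" for p d
    using that
  proof (induction k arbitrary: p)
    case 0 then show ?case using N by (auto simp: graded_ideal_def)
  next
    case (Suc k)
    then obtain z y where p: "p = z + f k * y" "z \<in> seq_span f N UNIV k" by auto
    obtain j where j: "homogeneous j (f k)" using f by blast
    have "\<exists>w. hom_part d (f k * y) = f k * w"
    proof (cases "d < j")
      case True then show ?thesis using hom_part_mult_small[OF j True] by (metis mult_zero_right)
    next
      case False then show ?thesis using hom_part_mult[OF j, of "d - j" y] by auto
    qed
    then obtain w where "hom_part d (f k * y) = f k * w" by blast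
    then have "hom_part d p = hom_part d z + f k * w" by (simp add: p restrict_monomials_add)
    then show ?case using Suc.IH[OF p(2)] seq_span_Suc_I by auto
  qed
  then show ?thesis using id by (auto simp: graded_ideal_def)
qed

text \<open>A graded form of Nakayama's lemma. For homogeneous \<open>p\<close> with \<open>f p \<in> Q\<close> the hypothesis on \<open>Q + (x)\<close>
  gives \<open>p = x z\<close> modulo \<open>Q\<close>; cancelling \<open>x\<close> shows \<open>f z \<in> Q\<close>, and \<open>z\<close> has smaller degree.\<close>

lemma nonzerodivisor_lift:
  assumes Q: "graded_ideal Q" and f: "homogeneous k f" and x: "homogeneous 1 x"
    and xQ: "\<And>p. x * p \<in> Q \<Longrightarrow> p \<in> Q"
    and fx: "\<And>p. f * p \<in> ideal_plus Q (range ((*) x)) \<Longrightarrow> p \<in> ideal_plus Q (range ((*) x))"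
    and fp: "f * p \<in> Q"
  shows "p \<in> Q"
proof -
  have id: "ideal_set Q" and gr: "\<And>p d. p \<in> Q \<Longrightarrow> hom_part d p \<in> Q" using Q by (auto simp: graded_ideal_def)
  have in_ideal_plus: "z \<in> ideal_plus Q (range ((*) x))" if "z \<in> Q" for z
    using ideal_plusI[OF that rangeI[of "(*) x" 0]] by simp
  have *: "y \<in> Q" if "homogeneous d y" "f * y \<in> Q" for y d
    using that
  proof (induction d arbitrary: y)
    case 0
    have "f * y \<in> ideal_plus Q (range ((*) x))" by (rule in_ideal_plus[OF 0(2)])
    then obtain q z where y: "y = q + x * z" "q \<in> Q" by (blast dest: fx elim: ideal_plusE)
    have "y = hom_part 0 q + hom_part 0 (x * z)"
      using hom_part_homogeneous[OF 0(1)] y(1) by (metis restrict_monomials_add)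
    then show ?case using hom_part_mult_small[OF x, of 0 z] gr[OF y(2), of 0] by simp
  next
    case (Suc d)
    have "f * y \<in> ideal_plus Q (range ((*) x))" by (rule in_ideal_plus[OF Suc(3)])
    then obtain q z where y: "y = q + x * z" "q \<in> Q" by (blast dest: fx elim: ideal_plusE)
    have y': "y = hom_part (Suc d) q + x * hom_part d z"
      using hom_part_homogeneous[OF Suc(2)] y(1) hom_part_mult[OF x, of d z] by (metis restrict_monomials_add plus_1_eq_Suc)
    have "x * (f * hom_part d z) = f * y - f * hom_part (Suc d) q" by (subst y') (simp add: algebra_simps)
    also have "\<dots> \<in> Q" by (rule ideal_set_diff[OF id Suc(3) ideal_set_mult[OF id gr[OF y(2)]]])
    finally have "hom_part d z \<in> Q" using Suc.IH[OF homogeneous_hom_part] xQ by blast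
    then show ?case using y' id gr[OF y(2)] by (metis ideal_set_add ideal_set_mult)
  qed
  have "hom_part d p \<in> Q" for d
    using *[OF homogeneous_hom_part] gr[OF fp, of "k + d"] hom_part_mult[OF f, of d p] by simp
  then show ?thesis using sum_hom_parts[of p] ideal_set_sum[OF id] by metis
qed

text \<open>In other words, \<open>x\<close> is a nonzerodivisor modulo \<open>Q + (f)\<close>: since \<open>f y\<close> lies in \<open>Q + (x)\<close>, so does \<open>y\<close>, say
  \<open>y = q + x w\<close>, and then \<open>x\<close> can be cancelled from \<open>x (p - f w)\<close>.\<close>

lemma nonzerodivisor_swap:
  fixes f :: "'a::comm_ring_1"
  assumes Q: "ideal_set Q" and xQ: "\<And>p. x * p \<in> Q \<Longrightarrow> p \<in> Q"
    and fx: "\<And>p. f * p \<in> ideal_plus Q (range ((*) x)) \<Longrightarrow> p \<in> ideal_plus Q (range ((*) x))"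
    and xp: "x * p = z + f * y" "z \<in> Q"
  shows "\<exists>w. p - f * w \<in> Q"
proof -
  have "f * y = (- z) + x * p" using xp by simp
  then have "f * y \<in> ideal_plus Q (range ((*) x))" using ideal_plusI[OF ideal_set_uminus[OF Q xp(2)] rangeI[of "(*) x" p]] by simp
  then obtain q w where y: "y = q + x * w" "q \<in> Q" by (blast dest: fx elim: ideal_plusE)
  have "x * (p - f * w) = z + f * q" using xp y by (simp add: algebra_simps)
  then have "p - f * w \<in> Q" using xQ Q xp(2) y(2) by (metis ideal_set_add ideal_set_mult)
  then show ?thesis by blast
qed

section \<open>Elementary symmetric polynomials on face rings\<close>

text \<open>Elementary symmetric polynomials give one sequence for all complexes: modulo the variables
  outside \<open>F\<close> they become the elementary symmetric polynomials in the variables of \<open>F\<close>.\<close>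

definition esym :: "nat \<Rightarrow> ('n::finite, 'k::field) mpoly" where
  "esym k = (\<Sum>A | card A = k. sqfree A)"

lemma homogeneous_esym: "homogeneous k (esym k :: ('n::finite, 'k::field) mpoly)"
proof -
  have "deg e = k" if "e \<in> monomials (esym k :: ('n, 'k) mpoly)" for e
  proof -
    have "(\<Sum>A | card A = k. coef (sqfree A :: ('n, 'k) mpoly) e) \<noteq> 0"
      using that by (simp add: in_keys_iff esym_def lookup_sum)
    then obtain A where "card A = k" "coef (sqfree A :: ('n, 'k) mpoly) e \<noteq> 0"
      by (auto elim: sum.not_neutral_contains_not_neutral)
    then have "card A = k" "e \<in> monomials (sqfree A :: ('n, 'k) mpoly)" by (simp_all add: in_keys_iff)
    then show ?thesis by (simp add: monomials_sqfree deg_indicator_exp)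
  qed
  then show ?thesis by (simp add: homogeneous_def)
qed

lemma esym_in_sr_ideal: "0 < k \<Longrightarrow> esym k \<in> sr_ideal {{}}"
  unfolding esym_def by (intro ideal_set_sum[OF ideal_set_sr_ideal]) (auto simp: sqfree_in_sr_ideal)

text \<open>On a face with \<open>k\<close> vertices the \<open>k\<close>-th elementary symmetric polynomial is the product of all its
  variables, since every other set of \<open>k\<close> variables leaves the face.\<close>

lemma esym_card: "esym (card F) - sqfree F \<in> sr_ideal {F}"
proof -
  have "esym (card F) - sqfree F = (\<Sum>A\<in>{A. card A = card F} - {F}. sqfree A)"
    unfolding esym_def by (simp add: sum_diff1)
  also have "\<dots> \<in> sr_ideal {F}"
    by (intro ideal_set_sum[OF ideal_set_sr_ideal]) (auto simp: sqfree_in_sr_ideal dest: card_subset_eq[OF finite])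
  finally show ?thesis .
qed

lemma variable_regular_face:
  assumes "a \<in> F" "variable a * p \<in> sr_ideal {F}" shows "p \<in> sr_ideal {F}"
  unfolding sr_ideal_def
proof safe
  fix e assume e: "e \<in> monomials p" "Poly_Mapping.keys e \<subseteq> F"
  have "coef (variable a * p) (Poly_Mapping.single a 1 + e) = coef p e"
    by (simp add: variable_eq coef_single_mult del: single_one)
  then have "Poly_Mapping.single a 1 + e \<in> monomials (variable a * p)" using e by (simp add: in_keys_iff)
  moreover have "Poly_Mapping.keys (Poly_Mapping.single a 1 + e) \<subseteq> F" using assms(1) e by (simp add: keys_add_nat)
  ultimately show False using assms(2) unfolding sr_ideal_def by blast
qed

lemma seq_span_ideal_plus:
  "seq_span f (ideal_plus N L) UNIV k = ideal_plus (seq_span f N UNIV k) L"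
proof (induction k)
  case (Suc k)
  show ?case
  proof (rule Set.set_eqI, rule iffI)
    fix x assume "x \<in> seq_span f (ideal_plus N L) UNIV (Suc k)"
    then obtain z y where x: "x = z + f k * y" "z \<in> ideal_plus (seq_span f N UNIV k) L" using Suc by auto
    then obtain u l where "z = u + l" "u \<in> seq_span f N UNIV k" "l \<in> L" by (auto elim: ideal_plusE)
    then have "x = (u + f k * y) + l" "u + f k * y \<in> seq_span f N UNIV (Suc k)" "l \<in> L"
      using x by (auto simp: algebra_simps)
    then show "x \<in> ideal_plus (seq_span f N UNIV (Suc k)) L" using ideal_plusI by metis
  next
    fix x assume "x \<in> ideal_plus (seq_span f N UNIV (Suc k)) L"
    then obtain u y l where x: "x = (u + f k * y) + l" "u \<in> seq_span f N UNIV k" "l \<in> L" by (auto elim!: ideal_plusE)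
    have "x = (u + l) + f k * y" using x(1) by (simp add: algebra_simps)
    moreover have "u + l \<in> seq_span f (ideal_plus N L) UNIV k" unfolding Suc using x(2,3) by (rule ideal_plusI)
    ultimately show "x \<in> seq_span f (ideal_plus N L) UNIV (Suc k)" using seq_span_Suc_I by blast
  qed
qed simp

text \<open>By induction on the size of the face. Let \<open>Q\<^sub>i\<close> be \<open>sr_ideal {F}\<close> plus the first \<open>i\<close> polynomials. For
  a vertex \<open>a\<close> of \<open>F\<close> the ideal \<open>Q\<^sub>i + (x\<^sub>a)\<close> belongs to the smaller face \<open>F - {a}\<close>, where the next
  polynomial is a nonzerodivisor as long as \<open>i + 1 < card F\<close>. Exchanging the order of \<open>x\<^sub>a\<close> and the
  polynomials shows that \<open>x\<^sub>a\<close> is a nonzerodivisor modulo \<open>Q\<^sub>i\<close> for \<open>i < card F\<close>, and then the graded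
  lifting removes \<open>x\<^sub>a\<close> again. The last polynomial is the product of the \<open>x\<^sub>a\<close> modulo \<open>Q\<^sub>0\<close>, so it is a
  nonzerodivisor as each \<open>x\<^sub>a\<close> is one.\<close>

lemma esym_regular_face:
  "k \<le> card F \<Longrightarrow> regular_on (\<lambda>i. esym (Suc i)) k UNIV (sr_ideal {F} :: ('n::finite, 'k::field) mpoly set)"
proof (induction "card F" arbitrary: F k rule: less_induct)
  case less
  let ?f = "\<lambda>i. esym (Suc i) :: ('n, 'k) mpoly"
  let ?Q = "\<lambda>F. seq_span ?f (sr_ideal {F}) UNIV"
  have gr: "graded_ideal (?Q F i)" for i
    by (intro graded_seq_span graded_sr_ideal) (use homogeneous_esym in blast)
  then have id: "ideal_set (?Q F i)" for i by (simp add: graded_ideal_def)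
  have QF: "?Q (F - {a}) i = ideal_plus (?Q F i) (range ((*) (variable a)))" if "a \<in> F" for a i
  proof -
    have "{G \<inter> H | G H. G \<in> {F} \<and> H \<in> {- {a}}} = {F - {a}}" by auto
    then have "sr_ideal {F - {a}} = ideal_plus (sr_ideal {F}) (sr_ideal {- {a}} :: ('n, 'k) mpoly set)"
      by (simp only: ideal_plus_sr_ideal)
    then show ?thesis by (simp only: seq_span_ideal_plus sr_ideal_coatom)
  qed
  have fx: "p \<in> ideal_plus (?Q F i) (range ((*) (variable a)))"
    if "a \<in> F" "Suc i < card F" "?f i * p \<in> ideal_plus (?Q F i) (range ((*) (variable a)))" for a i p
  proof -
    have c: "card (F - {a}) < card F" "Suc i \<le> card (F - {a})" using that by simp_all
    from regular_onD[OF less.hyps[OF c], of i p] that(3) show ?thesis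
      by (simp only: QF[OF that(1), symmetric]) simp
  qed
  have X: "p \<in> ?Q F i" if "a \<in> F" "i < card F" "variable a * p \<in> ?Q F i" for a i p
    using that(2,3)
  proof (induction i arbitrary: p)
    case 0 then show ?case using variable_regular_face[OF that(1)] by simp
  next
    case (Suc i)
    then obtain z y where zy: "variable a * p = z + ?f i * y" "z \<in> ?Q F i" by auto
    have "\<exists>w. p - ?f i * w \<in> ?Q F i"
    proof (rule nonzerodivisor_swap[OF id _ _ zy])
      fix q assume "variable a * q \<in> ?Q F i"
      then show "q \<in> ?Q F i" using Suc.IH Suc.prems(1) by simp
    next
      fix q assume "?f i * q \<in> ideal_plus (?Q F i) (range ((*) (variable a)))"
      then show "q \<in> ideal_plus (?Q F i) (range ((*) (variable a)))" using fx[OF that(1)] Suc.prems(1) by simp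
    qed
    then obtain w where "p - ?f i * w \<in> ?Q F i" by blast
    then show ?case using seq_span_Suc_I[of "p - ?f i * w" ?f "sr_ideal {F}" UNIV i w] by simp
  qed
  show ?case unfolding regular_on_def
  proof (intro allI impI ballI)
    fix i p assume i: "i < k" and p: "?f i * p \<in> ?Q F i"
    show "p \<in> ?Q F i"
    proof (cases "Suc i < card F")
      case True
      then have "F \<noteq> {}" by auto
      then obtain a where a: "a \<in> F" by blast
      show ?thesis
        using nonzerodivisor_lift[OF gr homogeneous_esym homogeneous_variable[of a] _ _ p] X[OF a] fx[OF a] True
        by (meson Suc_lessD)
    next
      case False
      then have eq: "Suc i = card F" using i less.prems by simp
      have prod: "q \<in> ?Q F i" if "A \<subseteq> F" "sqfree A * q \<in> ?Q F i" for A q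
        using finite[of A] that
      proof (induction A arbitrary: q)
        case empty then show ?case by (simp add: sqfree_empty)
      next
        case (insert a A)
        have "variable a * (sqfree A * q) \<in> ?Q F i"
          using insert.prems(2) by (simp only: sqfree_insert[OF insert.hyps(2)] mult.assoc)
        moreover have "a \<in> F" "i < card F" using insert.prems(1) eq by simp_all
        ultimately have "sqfree A * q \<in> ?Q F i" using X by blast
        then show ?case using insert.IH insert.prems(1) by blast
      qed
      have "(?f i - sqfree F) * p \<in> ?Q F i"
        using esym_card[of F] seq_span_base[OF ideal_set_UNIV, of "sr_ideal {F}" ?f i] id
        unfolding eq by (blast intro: ideal_set_mult_right)
      then have "?f i * p - (?f i - sqfree F) * p \<in> ?Q F i" using p id by (blast intro: ideal_set_diff)
      then have "sqfree F * p \<in> ?Q F i" by (simp add: algebra_simps)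
      then show ?thesis using prod by blast
    qed
  qed
qed

lemma esym_regular_prime:
  assumes "k \<le> card F" "k < card (UNIV :: 'n set)"
  shows "regular_on (\<lambda>i. esym (Suc i)) (Suc k) (sr_ideal {F} :: ('n::finite, 'k::field) mpoly set) {0}"
proof (rule regular_on_submodule[OF ideal_set_sr_ideal esym_regular_face[OF assms(1)]])
  have "regular_on (\<lambda>i. esym (Suc i)) (Suc k) UNIV (sr_ideal {UNIV} :: ('n, 'k) mpoly set)"
    using assms(2) by (intro esym_regular_face) simp
  then show "regular_on (\<lambda>i. esym (Suc i)) (Suc k) UNIV {0 :: ('n, 'k) mpoly}"
    by (simp only: sr_ideal_UNIV)
qed

section \<open>Upper bounds from nonzero Koszul classes\<close>

lemma coef_sign_mult:
  "coef (koszul_sign a A * p) e = koszul_sign a A * coef (p :: ('n::finite, 'k::field) mpoly) e"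
proof -
  have "coef ((- 1) ^ m * p) e = (- 1) ^ m * coef p e" for m
    by (cases "even m") simp_all
  then show ?thesis by (simp add: koszul_sign_def)
qed

text \<open>The complex in squarefree multidegrees: the coefficient of the product of \<open>A - B\<close> in the value at \<open>A\<close> only
  involves the coefficients of the same kind at the subsets \<open>A - {a}\<close>, and these form the cochain
  complex of a simplex over the field.\<close>

lemma coef_koszul_d:
  fixes z :: "'n::finite set \<Rightarrow> ('n, 'k::field) mpoly"
  assumes "B \<subseteq> A"
  shows "coef (koszul_d variable z A) (indicator_exp (A - B)) =
    koszul_d (\<lambda>_. 1) (\<lambda>A. if B \<subseteq> A then coef (z A) (indicator_exp (A - B)) else 0) A"
proof -
  have "coef (koszul_sign a A * variable a * z (A - {a})) (indicator_exp (A - B)) =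
    koszul_sign a A * 1 * (if B \<subseteq> A - {a} then coef (z (A - {a})) (indicator_exp (A - {a} - B)) else 0)"
    if a: "a \<in> A" for a
  proof (cases "a \<in> B")
    case True
    have "indicator_exp (A - B) \<noteq> Poly_Mapping.single a 1 + v" for v
    proof
      assume "indicator_exp (A - B) = Poly_Mapping.single a 1 + v"
      then have "Poly_Mapping.lookup (indicator_exp (A - B)) a \<noteq> 0" by (simp add: lookup_add)
      then show False using True by (simp add: lookup_indicator_exp)
    qed
    then have "coef (variable a * z (A - {a})) (indicator_exp (A - B)) = 0"
      unfolding variable_eq by (rule coef_single_mult_zero)
    moreover have "\<not> B \<subseteq> A - {a}" using True by auto
    ultimately show ?thesis by (simp add: coef_sign_mult mult.assoc)
  next
    case False
    then have "A - B = insert a (A - {a} - B)" "a \<notin> A - {a} - B" using a by auto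
    then have "indicator_exp (A - B) = Poly_Mapping.single a 1 + indicator_exp (A - {a} - B)" using indicator_exp_insert by metis
    then have "coef (variable a * z (A - {a})) (indicator_exp (A - B)) = coef (z (A - {a})) (indicator_exp (A - {a} - B))"
      using coef_single_mult[of "Poly_Mapping.single a 1" 1 "z (A - {a})" "indicator_exp (A - {a} - B)"]
      by (simp add: variable_eq del: single_one)
    moreover have "B \<subseteq> A - {a}" using False assms by auto
    ultimately show ?thesis by (simp add: coef_sign_mult mult.assoc)
  qed
  then show ?thesis unfolding koszul_d_def lookup_sum by (intro sum.cong) auto
qed

text \<open>The test for nontrivial classes. The coboundary of an \<open>S\<close>-valued cochain \<open>b\<close> may happen to have values
  in the ideal \<open>I\<close>; it is then a cocycle over \<open>I\<close>. If Koszul cohomology of \<open>I\<close> vanishes in that degree,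
  then \<open>b\<close> differs from an \<open>I\<close>-valued cochain by a cocycle. Its coefficients in the multidegrees
  of \<open>coef_koszul_d\<close> form a cocycle of a full simplex, which is the coboundary of some \<open>\<mu>\<close>; the cone
  construction over the vertex \<open>p\<close> makes \<open>\<mu>\<close> explicit and keeps it supported on sets containing \<open>B\<close>. On
  faces the \<open>I\<close>-valued part contributes nothing, so there \<open>b\<close> itself has to agree with the
  coboundary of \<open>\<mu>\<close>.\<close>

lemma koszul_obstruction:
  fixes b :: "'n::finite set \<Rightarrow> ('n, 'k::field) mpoly" and f :: "nat \<Rightarrow> ('n, 'k) mpoly"
  assumes reg: "regular_on f r (sr_ideal \<F>) {0}" and f: "\<And>i. i < r \<Longrightarrow> f i \<in> sr_ideal {{}}"
    and r: "Suc j < r" and p: "p \<notin> B"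
    and b: "\<And>A. card A = Suc j \<Longrightarrow> koszul_d variable b A \<in> sr_ideal \<F>"
  shows "\<exists>\<mu>. (\<forall>A. \<not> B \<subseteq> A \<longrightarrow> \<mu> A = 0) \<and>
    (\<forall>A. card A = j \<longrightarrow> B \<subseteq> A \<longrightarrow> (\<exists>F\<in>\<F>. A - B \<subseteq> F) \<longrightarrow>
      coef (b A) (indicator_exp (A - B)) = koszul_d (\<lambda>_. 1) \<mu> A)"
proof -
  have fg: "\<exists>g. f i = (\<Sum>a\<in>UNIV. g a * variable a)" if "i < r" for i
    using sr_ideal_variables[OF f[OF that]] by simp
  have "\<exists>e. (\<forall>A. Suc (card A) = Suc j \<longrightarrow> e A \<in> sr_ideal \<F>) \<and>
      (\<forall>A. card A = Suc j \<longrightarrow> koszul_d variable b A - koszul_d variable e A \<in> seq_span f {0} (sr_ideal \<F>) 0)"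
    using r b ideal_set_zero[OF ideal_set_sr_ideal]
    by (intro koszul_cohomology_vanishes[OF ideal_set_sr_ideal ideal_set_0 _ reg fg])
       (auto simp: koszul_d_d)
  then obtain e where e: "\<And>A. card A = j \<Longrightarrow> e A \<in> sr_ideal \<F>"
    "\<And>A. card A = Suc j \<Longrightarrow> koszul_d variable b A = koszul_d variable e A"
    by auto
  define z where "z = (\<lambda>A. b A - e A)"
  define l where "l = (\<lambda>A. if B \<subseteq> A then coef (z A) (indicator_exp (A - B)) else 0)"
  have dl: "koszul_d (\<lambda>_. 1) l A = 0" if A: "card A = Suc j" for A
  proof (cases "B \<subseteq> A")
    case True
    have "koszul_d variable z A = 0" by (simp add: z_def koszul_d_diff e(2)[OF A])
    then show ?thesis using coef_koszul_d[OF True, of z] by (simp add: l_def)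
  next
    case False
    then have "l (A - {a}) = 0" for a by (auto simp: l_def)
    then show ?thesis by (simp add: koszul_d_def)
  qed
  \<comment> \<open>The homotopy for the covector dual to \<open>p\<close> is the cone construction over \<open>p\<close>.\<close>
  define \<mu> where "\<mu> = koszul_h (\<lambda>a. if a = p then 1 else 0) l"
  have "\<mu> A = 0" if "\<not> B \<subseteq> A" for A
  proof -
    have "\<not> B \<subseteq> insert p A" using that p by auto
    then show ?thesis unfolding \<mu>_def koszul_h_def by (intro sum.neutral) (auto simp: l_def)
  qed
  moreover have "coef (b A) (indicator_exp (A - B)) = koszul_d (\<lambda>_. 1) \<mu> A"
    if A: "card A = j" "B \<subseteq> A" "F \<in> \<F>" "A - B \<subseteq> F" for A F
  proof -
    have "koszul_h (\<lambda>a. if a = p then 1 else 0) (koszul_d (\<lambda>_. 1) l) A = 0"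
      unfolding koszul_h_def using A by (intro sum.neutral) (simp add: dl)
    then have "koszul_d (\<lambda>_. 1) \<mu> A = l A"
      using koszul_homotopy[of "\<lambda>_. 1" "\<lambda>a. if a = p then 1 else 0" l A] by (simp add: \<mu>_def)
    moreover have "coef (e A) (indicator_exp (A - B)) = 0"
      using e(1)[OF A(1)] A(3,4) sr_idealD[of "e A" \<F> "indicator_exp (A - B)" F] by (auto simp: in_keys_iff keys_indicator_exp)
    ultimately show ?thesis using A(2) by (simp add: l_def z_def lookup_minus)
  qed
  ultimately show ?thesis by blast
qed

text \<open>If removing the vertices \<open>B\<close> disconnects the complex into \<open>S\<close> and \<open>T\<close>, there is a nonzero class in
  degree \<open>card B + 2\<close>: the class in reduced degree zero of the disconnected part. The cochain \<open>b\<close> is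
  the coboundary of the indicator \<open>\<beta>\<close> of \<open>B\<close>, cut off on sets that meet \<open>T\<close>. Its coboundary only
  involves products \<open>x\<^sub>a x\<^sub>w\<close> with \<open>a \<in> T\<close> and \<open>w \<in> S\<close>, which lie in the ideal. Were it trivial, the number
  \<open>\<mu> B\<close> would be one because of the vertex \<open>u\<close> and zero because of \<open>v\<close>.\<close>

lemma regular_length_separated:
  fixes \<F> :: "'n::finite set set" and f :: "nat \<Rightarrow> ('n, 'k::field) mpoly"
  assumes reg: "regular_on f r (sr_ideal \<F>) {0}" and f: "\<And>i. i < r \<Longrightarrow> f i \<in> sr_ideal {{}}"
    and part: "S \<inter> B = {}" "T \<inter> B = {}" "S \<inter> T = {}" "S \<union> T \<union> B = UNIV"
    and sep: "\<And>F. F \<in> \<F> \<Longrightarrow> F \<inter> S = {} \<or> F \<inter> T = {}"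
    and u: "u \<in> S" "u \<in> F" "F \<in> \<F>" and v: "v \<in> T" "v \<in> G" "G \<in> \<F>"
  shows "r \<le> card B + 2"
proof (rule ccontr)
  assume "\<not> r \<le> card B + 2"
  then have r: "Suc (Suc (card B)) < r" by simp
  define \<beta> where "\<beta> = (\<lambda>A. if A = B then 1 else 0 :: ('n, 'k) mpoly)"
  define b where "b = (\<lambda>A. if A \<inter> T = {} then koszul_d variable \<beta> A else 0)"
  have \<beta>0: "koszul_d variable \<beta> A = 0" if "\<not> B \<subseteq> A" for A
    using that unfolding koszul_d_def \<beta>_def by (intro sum.neutral) auto
  have d\<beta>: "koszul_d variable \<beta> (insert w B) = koszul_sign w (insert w B) * variable w" if "w \<notin> B" for w
  proof -
    have "koszul_d variable \<beta> (insert w B) = (\<Sum>a\<in>insert w B. if a = w then koszul_sign w (insert w B) * variable w else 0)"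
      unfolding koszul_d_def \<beta>_def using that by (intro sum.cong) auto
    then show ?thesis by simp
  qed
  have c: "koszul_d variable b A \<in> sr_ideal \<F>" if A: "card A = Suc (Suc (card B))" for A
  proof (cases "B \<subseteq> A")
    case False
    then have "b (A - {a}) = 0" for a using \<beta>0[of "A - {a}"] by (auto simp: b_def)
    then show ?thesis using ideal_set_zero[OF ideal_set_sr_ideal] by (simp add: koszul_d_def)
  next
    case True
    then have "card (A - B) = 2" using A by (simp add: card_Diff_subset)
    then obtain s t where st: "A - B = {s, t}" "s \<noteq> t" by (auto simp: card_2_iff)
    have AB: "A = insert s (insert t B)" "s \<notin> B" "t \<notin> B" using st True by auto
    show ?thesis
    proof (cases "A \<inter> T = {}")
      case True
      then have "koszul_d variable b A = koszul_d variable (koszul_d variable \<beta>) A"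
        unfolding koszul_d_def[of variable b] koszul_d_def[of variable "koszul_d variable \<beta>"]
        by (intro sum.cong) (auto simp: b_def)
      then show ?thesis using ideal_set_zero[OF ideal_set_sr_ideal] by (simp add: koszul_d_d)
    next
      case False
      have "koszul_sign a A * variable a * b (A - {a}) \<in> sr_ideal \<F>" if a: "a \<in> A" for a
      proof (cases "(A - {a}) \<inter> T = {} \<and> B \<subseteq> A - {a}")
        case True
        then have aT: "a \<in> T" using False a by auto
        then have "a \<in> {s, t}" using a AB part by auto
        then obtain w where w: "A - {a} = insert w B" "w \<notin> B"
          using AB st(2) by (cases "a = s") (auto simp: insert_Diff_if)
        then have wS: "w \<in> S" using True part by auto
        have "w \<noteq> a" using w a by auto
        have "koszul_sign a A * variable a * b (A - {a}) =
          (koszul_sign a A * koszul_sign w (insert w B)) * (variable a * variable w)"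
          using True w by (simp add: b_def d\<beta> algebra_simps)
        moreover have "variable a * variable w = sqfree {a, w}"
          using \<open>w \<noteq> a\<close> by (simp add: sqfree_insert sqfree_empty)
        moreover have "sqfree {a, w} \<in> sr_ideal \<F>" using aT wS sep by (auto simp: sqfree_in_sr_ideal)
        ultimately show ?thesis using ideal_set_mult[OF ideal_set_sr_ideal] by metis
      next
        case False
        then have "b (A - {a}) = 0" using \<beta>0 by (auto simp: b_def)
        then show ?thesis using ideal_set_zero[OF ideal_set_sr_ideal] by simp
      qed
      then show ?thesis
        unfolding koszul_d_def[of variable b A] by (rule ideal_set_sum[OF ideal_set_sr_ideal])
    qed
  qed
  have uB: "u \<notin> B" and vB: "v \<notin> B" using u v part by auto
  obtain \<mu> where \<mu>: "\<And>A. \<not> B \<subseteq> A \<Longrightarrow> \<mu> A = 0"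
    "\<And>A H. card A = Suc (card B) \<Longrightarrow> B \<subseteq> A \<Longrightarrow> H \<in> \<F> \<Longrightarrow> A - B \<subseteq> H \<Longrightarrow>
      coef (b A) (indicator_exp (A - B)) = koszul_d (\<lambda>_. 1) \<mu> A"
    using koszul_obstruction[OF reg f r uB c] by metis
  have d\<mu>: "koszul_d (\<lambda>_. 1) \<mu> (insert w B) = koszul_sign w (insert w B) * \<mu> B" if "w \<notin> B" for w
  proof -
    have "koszul_d (\<lambda>_. 1) \<mu> (insert w B) = (\<Sum>a\<in>insert w B. if a = w then koszul_sign w (insert w B) * \<mu> B else 0)"
      unfolding koszul_d_def using that by (intro sum.cong) (auto intro!: \<mu>(1))
    then show ?thesis by simp
  qed
  have "coef (b (insert u B)) (indicator_exp {u}) = koszul_sign u (insert u B) * \<mu> B"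
    using \<mu>(2)[of "insert u B" F] u uB subset_insertI[of B u] by (simp add: d\<mu> insert_Diff_if subset_insertI)
  moreover have "insert u B \<inter> T = {}" using u part by auto
  moreover have "coef (koszul_sign u (insert u B) * variable u) (indicator_exp {u}) = (koszul_sign u (insert u B) :: 'k)"
    by (simp add: coef_sign_mult variable_eq indicator_exp_def)
  ultimately have "koszul_sign u (insert u B) * \<mu> B = koszul_sign u (insert u B)"
    using uB by (simp add: b_def d\<beta>)
  then have "koszul_sign u (insert u B) * koszul_sign u (insert u B) * \<mu> B =
      koszul_sign u (insert u B) * koszul_sign u (insert u B)"
    by (simp only: mult.assoc)
  then have "\<mu> B = 1" by (simp only: koszul_sign_square mult_1)
  moreover have "coef (b (insert v B)) (indicator_exp {v}) = koszul_sign v (insert v B) * \<mu> B"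
    using \<mu>(2)[of "insert v B" G] v vB subset_insertI[of B v] by (simp add: d\<mu> insert_Diff_if subset_insertI)
  moreover have "b (insert v B) = 0" using v by (simp add: b_def)
  ultimately have "koszul_sign v (insert v B) = (0 :: 'k)" by simp
  then have "koszul_sign v (insert v B) * koszul_sign v (insert v B) = (0 :: 'k)" by simp
  then show False by (simp only: koszul_sign_square) simp
qed

lemma koszul_sign_singleton: "koszul_sign a {a} = 1"
proof -
  have "{b \<in> {a}. to_nat b < to_nat a} = {}" by auto
  then show ?thesis by (simp only: koszul_sign_def card.empty power_0)
qed

text \<open>The coboundary of a cochain of degree one is, up to sign, a difference; this is how the field-valued
  cochains below are read as functions on the vertices.\<close>

lemma koszul_d_pair:
  fixes x :: "'n::finite \<Rightarrow> 'a::comm_ring_1"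
  assumes "u \<noteq> v"
  shows "koszul_d x c {u, v} = koszul_sign v {u, v} * (x v * c {u} - x u * c {v})"
proof -
  have "{u, v} - {v} = {u}" "{u, v} - {u} = {v}" using assms by auto
  moreover have "koszul_sign u {u, v} = - (koszul_sign v {u, v} :: 'a)"
    using koszul_sign_swap[of u v "{}", where 'a = 'a] assms by (simp add: koszul_sign_singleton)
  ultimately show ?thesis using assms by (simp add: koszul_d_def algebra_simps)
qed

text \<open>A loop through \<open>G\<close> gives a nonzero class in degree three. The indicator of \<open>W\<close> jumps inside \<open>G\<close> but is
  constant on the intersection of \<open>G\<close> with any other face of \<open>\<F>\<close>. So its differences along pairs
  inside \<open>G\<close>, extended by zero to the other pairs, form a cochain that is closed on every face. If it
  were the coboundary of a function \<open>\<mu>\<close> on vertices, \<open>\<mu>\<close> would be constant along the path from \<open>u\<close> to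
  \<open>v\<close> outside \<open>G\<close> and would jump between \<open>u\<close> and \<open>v\<close> inside \<open>G\<close>.\<close>

lemma regular_length_cycle:
  fixes \<F> :: "'n::finite set set" and f :: "nat \<Rightarrow> ('n, 'k::field) mpoly"
  assumes reg: "regular_on f r (sr_ideal \<F>) {0}" and f: "\<And>i. i < r \<Longrightarrow> f i \<in> sr_ideal {{}}"
    and G: "G \<in> \<F>"
    and W: "\<And>F. F \<in> \<F> \<Longrightarrow> F \<noteq> G \<Longrightarrow> F \<inter> G \<subseteq> W \<or> F \<inter> G \<inter> W = {}"
    and uv: "u \<in> G" "u \<in> W" "v \<in> G" "v \<notin> W"
    and path: "(u, v) \<in> {(a, b). \<exists>F\<in>\<F> - {G}. a \<in> F \<and> b \<in> F}\<^sup>*"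
  shows "r \<le> 3"
proof (rule ccontr)
  assume "\<not> r \<le> 3"
  then have r: "Suc 2 < r" by simp
  define b0 where "b0 = (\<lambda>A. if A \<subseteq> W then sqfree A else 0 :: ('n, 'k) mpoly)"
  define b where "b = (\<lambda>A. if A \<subseteq> G then koszul_d variable b0 A else 0)"
  have d0: "koszul_d variable b0 {s, t} = koszul_sign t {s, t} *
      ((if s \<in> W then 1 else 0) - (if t \<in> W then 1 else 0)) * sqfree {s, t}" if "s \<noteq> t" for s t
    using that by (simp add: koszul_d_pair b0_def sqfree_insert sqfree_empty algebra_simps)
  have b_face: "b A = 0" if "card A = 2" "A \<subseteq> F" "F \<in> \<F>" "F \<noteq> G" for A F
  proof (cases "A \<subseteq> G")
    case True
    obtain s t where "A = {s, t}" "s \<noteq> t" using \<open>card A = 2\<close> by (auto simp: card_2_iff)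
    then have "s \<in> W \<longleftrightarrow> t \<in> W" using W[OF that(3,4)] True that(2) by auto
    then show ?thesis using \<open>A = {s, t}\<close> \<open>s \<noteq> t\<close> by (simp add: b_def d0)
  qed (simp add: b_def)
  have c: "koszul_d variable b A \<in> sr_ideal \<F>" if A: "card A = Suc 2" for A
  proof -
    note z = ideal_set_zero[OF ideal_set_sr_ideal, of \<F>]
    have cA: "card (A - {a}) = 2" if "a \<in> A" for a using A that by simp
    consider "A \<subseteq> G" | F where "A \<subseteq> F" "F \<in> \<F>" "F \<noteq> G" | "\<And>F. F \<in> \<F> \<Longrightarrow> \<not> A \<subseteq> F" by blast
    then show ?thesis
    proof cases
      case 1
      then have "koszul_d variable b A = koszul_d variable (koszul_d variable b0) A"
        unfolding koszul_d_def[of variable b] koszul_d_def[of variable "koszul_d variable b0"]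
        by (intro sum.cong) (auto simp: b_def)
      then show ?thesis using z by (simp add: koszul_d_d)
    next
      case 2
      then have "b (A - {a}) = 0" if "a \<in> A" for a using b_face[OF cA[OF that]] by blast
      then show ?thesis using z by (simp add: koszul_d_def)
    next
      case 3
      have "koszul_sign a A * variable a * b (A - {a}) \<in> sr_ideal \<F>" if a: "a \<in> A" for a
      proof -
        obtain s t where st: "A - {a} = {s, t}" "s \<noteq> t" using cA[OF a] by (auto simp: card_2_iff)
        have "\<exists>q. b {s, t} = q * sqfree {s, t}"
        proof (cases "{s, t} \<subseteq> G")
          case True
          then have "b {s, t} = koszul_d variable b0 {s, t}" by (simp only: b_def if_True)
          then show ?thesis unfolding d0[OF st(2)] by (rule exI)
        next
          case False then show ?thesis by (auto simp: b_def intro!: exI[of _ 0])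
        qed
        then obtain q where "b (A - {a}) = q * sqfree (A - {a})" using st(1) by auto
        then have "koszul_sign a A * variable a * b (A - {a}) = (koszul_sign a A * q) * (variable a * sqfree (A - {a}))"
          by (simp add: algebra_simps)
        also have "variable a * sqfree (A - {a}) = sqfree A"
          using sqfree_insert[of a "A - {a}", symmetric] a by (simp add: insert_absorb)
        finally have "koszul_sign a A * variable a * b (A - {a}) = (koszul_sign a A * q) * sqfree A" .
        moreover have "sqfree A \<in> sr_ideal \<F>" using 3 by (auto simp: sqfree_in_sr_ideal)
        ultimately show ?thesis using ideal_set_mult[OF ideal_set_sr_ideal] by metis
      qed
      then show ?thesis
        unfolding koszul_d_def[of variable b A] by (rule ideal_set_sum[OF ideal_set_sr_ideal])
    qed
  qed
  obtain \<mu> where \<mu>: "\<And>A F. card A = 2 \<Longrightarrow> F \<in> \<F> \<Longrightarrow> A \<subseteq> F \<Longrightarrow> coef (b A) (indicator_exp A) = koszul_d (\<lambda>_. 1) \<mu> A"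
    using koszul_obstruction[OF reg f r, of u "{}" b] c by (simp only: empty_iff empty_subsetI not_False_eq_True simp_thms Diff_empty) metis
  have sgn: "koszul_sign a A * y = 0 \<Longrightarrow> y = 0" for a :: 'n and A and y :: 'k
  proof -
    assume "koszul_sign a A * y = 0"
    then have "koszul_sign a A * koszul_sign a A * y = 0" by (simp only: mult.assoc mult_zero_right)
    then show "y = 0" by (simp only: koszul_sign_square mult_1)
  qed
  have const: "\<mu> {s} = \<mu> {t}" if "s \<in> F" "t \<in> F" "F \<in> \<F>" "F \<noteq> G" for s t F
  proof (cases "s = t")
    case False
    have "koszul_d (\<lambda>_. 1) \<mu> {s, t} = 0"
      using \<mu>[of "{s, t}" F] b_face[of "{s, t}" F] that False by simp
    then have "koszul_sign t {s, t} * (\<mu> {s} - \<mu> {t}) = 0" using False by (simp add: koszul_d_pair)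
    from sgn[OF this] show ?thesis by simp
  qed simp
  have "\<mu> {u} = \<mu> {v}" using path by (induction rule: rtrancl_induct) (auto dest: const)
  moreover have "u \<noteq> v" using uv by auto
  moreover have "coef (b {u, v}) (indicator_exp {u, v}) = koszul_d (\<lambda>_. 1) \<mu> {u, v}"
    using \<mu>[of "{u, v}" G] G uv \<open>u \<noteq> v\<close> by simp
  moreover have "coef (b {u, v}) (indicator_exp {u, v}) = koszul_sign v {u, v} * 1"
    using uv \<open>u \<noteq> v\<close> by (simp add: b_def d0 coef_sign_mult) (simp add: sqfree_def)
  ultimately show False using sgn[of v "{u, v}" 1] by (simp add: koszul_d_pair)
qed

section \<open>Lower bounds by gluing facets\<close>

lemma regular_on_length_1:
  "0 < card (UNIV :: 'n set) \<Longrightarrow>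
    regular_on (\<lambda>i. esym (Suc i)) 1 (M :: ('n::finite, 'k::field) mpoly set) {0}"
  using esym_regular_face[of 1 "UNIV :: 'n set"] by (auto simp: regular_on_def sr_ideal_UNIV)

lemma card_less_card_UNIV: "(F :: 'n::finite set) \<noteq> UNIV \<Longrightarrow> card F < card (UNIV :: 'n set)"
  by (rule psubset_card_mono) auto

lemma ideal_plus_sr_ideal_single:
  "ideal_plus (sr_ideal \<F>) (sr_ideal {G}) = sr_ideal ((\<lambda>F. F \<inter> G) ` \<F>)"
proof -
  have "{F \<inter> H | F H. F \<in> \<F> \<and> H \<in> {G}} = (\<lambda>F. F \<inter> G) ` \<F>" by auto
  then show ?thesis by (simp only: ideal_plus_sr_ideal)
qed

text \<open>Adding one facet \<open>G\<close> by Mayer-Vietoris; the sum ideal belongs to the complex in which \<open>G\<close> is glued to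
  the others.\<close>

lemma esym_regular_insert:
  fixes \<F> :: "'n::finite set set"
  assumes "regular_on (\<lambda>i. esym (Suc i)) (Suc k) (sr_ideal \<F> :: ('n, 'k::field) mpoly set) {0}"
    and "k \<le> card G" "G \<noteq> UNIV"
    and "regular_on (\<lambda>i. esym (Suc i)) k (sr_ideal ((\<lambda>F. F \<inter> G) ` \<F>) :: ('n, 'k) mpoly set) {0}"
  shows "regular_on (\<lambda>i. esym (Suc i)) (Suc k) (sr_ideal (insert G \<F>) :: ('n, 'k) mpoly set) {0}"
  unfolding sr_ideal_insert[of G \<F>] using assms card_less_card_UNIV[of G]
  by (intro regular_on_Int ideal_set_sr_ideal esym_regular_prime) (auto simp: ideal_plus_sr_ideal_single)

text \<open>By induction on the facets. The ideal of the gluing complex only has to carry a regular sequence of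
  length one, and the first polynomial is a nonzerodivisor on every ideal.\<close>

lemma esym_regular_2:
  fixes \<F> :: "'n::finite set set"
  assumes "\<F> \<noteq> {}" "\<And>F. F \<in> \<F> \<Longrightarrow> F \<noteq> {} \<and> F \<noteq> UNIV"
  shows "regular_on (\<lambda>i. esym (Suc i)) 2 (sr_ideal \<F> :: ('n, 'k::field) mpoly set) {0}"
  using finite[of \<F>] assms
proof (induction \<F> rule: finite_ne_induct)
  case (singleton F)
  then have "1 \<le> card F" "1 < card (UNIV :: 'n set)" using card_less_card_UNIV[of F]
    by (auto simp: Suc_le_eq card_gt_0_iff intro: le_less_trans[of _ "card F"])
  then show ?case using esym_regular_prime[of 1 F] by (simp add: numeral_2_eq_2)
next
  case (insert F \<F>)
  then have "1 \<le> card F" by (auto simp: Suc_le_eq card_gt_0_iff)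
  moreover have "regular_on (\<lambda>i. esym (Suc i)) 2 (sr_ideal \<F> :: ('n, 'k) mpoly set) {0}" using insert by simp
  moreover have "regular_on (\<lambda>i. esym (Suc i)) (Suc 0) M {0}" for M :: "('n, 'k) mpoly set"
    using regular_on_length_1[of M] by (simp add: card_gt_0_iff)
  moreover have "F \<noteq> UNIV" using insert.prems by simp
  ultimately show ?case unfolding numeral_2_eq_2 One_nat_def by (intro esym_regular_insert)
qed

text \<open>Since \<open>G\<close> meets some facet, the gluing complex has a facet with a vertex; its empty facets can be dropped
  and two terms are regular on its ideal.\<close>

lemma esym_regular_3_insert:
  fixes \<F> :: "'n::finite set set"
  assumes "regular_on (\<lambda>i. esym (Suc i)) 3 (sr_ideal \<F> :: ('n, 'k::field) mpoly set) {0}"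
    and "2 \<le> card G" "G \<noteq> UNIV" and H: "H \<in> \<F>" "H \<inter> G \<noteq> {}"
  shows "regular_on (\<lambda>i. esym (Suc i)) 3 (sr_ideal (insert G \<F>) :: ('n, 'k) mpoly set) {0}"
proof -
  let ?\<G> = "(\<lambda>F. F \<inter> G) ` \<F>"
  have "sr_ideal ?\<G> = (sr_ideal (?\<G> - {{}}) :: ('n, 'k) mpoly set)"
  proof (rule sr_ideal_cong)
    fix F assume "F \<in> ?\<G>"
    then show "\<exists>F'\<in>?\<G> - {{}}. F \<subseteq> F'" using H by (cases "F = {}") blast+
  qed auto
  moreover have "regular_on (\<lambda>i. esym (Suc i)) 2 (sr_ideal (?\<G> - {{}}) :: ('n, 'k) mpoly set) {0}"
    using H \<open>G \<noteq> UNIV\<close> by (intro esym_regular_2) auto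
  ultimately show ?thesis
    using assms(1-3) unfolding numeral_3_eq_3 numeral_2_eq_2 by (intro esym_regular_insert) simp_all
qed

text \<open>If \<open>G\<close> is attached along the single face \<open>H \<inter> G\<close>, the gluing complex is a simplex with at least \<open>q\<close>
  vertices, whose ideal allows \<open>q + 1\<close> terms.\<close>

lemma esym_regular_tree_insert:
  fixes \<F> :: "'n::finite set set"
  assumes "regular_on (\<lambda>i. esym (Suc i)) (q + 2) (sr_ideal \<F> :: ('n, 'k::field) mpoly set) {0}"
    and "q < card G" "G \<noteq> UNIV" and H: "H \<in> \<F>" "q \<le> card (H \<inter> G)"
    and leaf: "\<And>F. F \<in> \<F> \<Longrightarrow> F \<inter> G \<subseteq> H \<inter> G"
  shows "regular_on (\<lambda>i. esym (Suc i)) (q + 2) (sr_ideal (insert G \<F>) :: ('n, 'k) mpoly set) {0}"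
proof -
  have "sr_ideal ((\<lambda>F. F \<inter> G) ` \<F>) = (sr_ideal {H \<inter> G} :: ('n, 'k) mpoly set)"
    using H leaf by (intro sr_ideal_cong) auto
  moreover have "regular_on (\<lambda>i. esym (Suc i)) (Suc q) (sr_ideal {H \<inter> G} :: ('n, 'k) mpoly set) {0}"
    using H card_less_card_UNIV[of G] assms(2,3) by (intro esym_regular_prime) auto
  ultimately show ?thesis
    using assms(1-3) unfolding add_2_eq_Suc' by (intro esym_regular_insert) simp_all
qed

section \<open>The grade in terms of the graph\<close>

definition has_grade :: "('n::finite, 'k::field) mpoly set \<Rightarrow> nat \<Rightarrow> bool" where
  "has_grade I d \<longleftrightarrow> (\<exists>f. (\<forall>i. f i \<in> sr_ideal {{}}) \<and> regular_on f d I {0}) \<and>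
    (\<forall>f r. (\<forall>i<r. f i \<in> sr_ideal {{}}) \<longrightarrow> regular_on f r I {0} \<longrightarrow> r \<le> d)"

lemma has_gradeI:
  assumes "\<And>i. f i \<in> sr_ideal {{}}" "regular_on f d I {0}"
    and "\<And>f r. \<forall>i<r. f i \<in> sr_ideal {{}} \<Longrightarrow> regular_on f r I {0} \<Longrightarrow> r \<le> d"
  shows "has_grade I d"
  unfolding has_grade_def using assms by blast

text \<open>This supplies the order in which facets are added: a path from \<open>v0\<close> to a vertex outside \<open>T\<close> leaves
  \<open>T\<close> along some edge.\<close>

lemma connected_growth:
  assumes "finite V" "v0 \<in> V" "Q {v0}" and conn: "\<And>v. v \<in> V \<Longrightarrow> (v0, v) \<in> R\<^sup>*"
    and R: "R \<subseteq> V \<times> V"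
    and grow: "\<And>T t v. T \<subseteq> V \<Longrightarrow> v0 \<in> T \<Longrightarrow> Q T \<Longrightarrow> t \<in> T \<Longrightarrow> v \<in> V - T \<Longrightarrow> (t, v) \<in> R \<Longrightarrow> Q (insert v T)"
  shows "Q V"
proof -
  have "Q V" if "T \<subseteq> V" "v0 \<in> T" "Q T" for T
    using that
  proof (induction "card (V - T)" arbitrary: T rule: less_induct)
    case less
    show ?case
    proof (cases "T = V")
      case False
      then obtain w where w: "w \<in> V - T" using less.prems by blast
      have "\<exists>t v. t \<in> T \<and> v \<in> V - T \<and> (t, v) \<in> R"
      proof (rule ccontr)
        assume no: "\<not> ?thesis"
        have "(v0, w) \<in> R\<^sup>*" using conn w by blast
        then have "w \<in> T" by (induction rule: rtrancl_induct) (use no R less.prems in blast)+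
        then show False using w by blast
      qed
      then obtain t v where tv: "t \<in> T" "v \<in> V - T" "(t, v) \<in> R" by blast
      have "V - insert v T \<subset> V - T" using tv by blast
      then have "card (V - insert v T) < card (V - T)" using assms(1) by (intro psubset_card_mono) auto
      then show ?thesis using less.hyps grow[OF less.prems tv] tv less.prems by blast
    qed (use less.prems in simp)
  qed
  then show ?thesis using assms(2,3) by blast
qed

text \<open>A symmetric relation contains a cycle through \<open>v\<close> if and only if two distinct neighbours of \<open>v\<close> are joined
  by a path that avoids \<open>v\<close>.\<close>

definition has_cycle :: "('v \<times> 'v) set \<Rightarrow> bool" where
  "has_cycle R \<longleftrightarrow> (\<exists>v a b. (v, a) \<in> R \<and> (v, b) \<in> R \<and> a \<noteq> b \<and> (a, b) \<in> (R \<inter> (- {v}) \<times> (- {v}))\<^sup>*)"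

definition meet_graph :: "'v set \<Rightarrow> ('v \<Rightarrow> 'n set) \<Rightarrow> ('v \<times> 'v) set" where
  "meet_graph V F = {(i, j). i \<in> V \<and> j \<in> V \<and> i \<noteq> j \<and> F i \<inter> F j \<noteq> {}}"

text \<open>The three cases match the lowest nonvanishing reduced cohomology of the complex or of its links.
  \<^item> Disconnected graph: the complex is disconnected, and \<open>B = {}\<close> separates it.
  \<^item> Connected graph with a cycle \<open>v, a, \<dots>, b, v\<close>: the cycle is a loop through the facet \<open>F v\<close> that enters
    in \<open>W = F v \<inter> F a\<close> and leaves in \<open>F v \<inter> F b\<close>; both are disjoint because triple intersections are
    empty. Three terms are regular since facets can be added along edges of the graph.
  \<^item> Tree: a smallest intersection \<open>F i0 \<inter> F j0\<close> separates the two sides of the edge \<open>i0 j0\<close>, which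
    gives the bound \<open>q + 2\<close>. When the facets are added along edges, each new facet meets exactly one
    earlier facet, as a second one would close a cycle.\<close>

theorem grade_of_graph:
  fixes F :: "'v \<Rightarrow> 'n::finite set"
  assumes V: "finite V"
    and anti: "\<And>i j. i \<in> V \<Longrightarrow> j \<in> V \<Longrightarrow> i \<noteq> j \<Longrightarrow> \<not> F i \<subseteq> F j"
    and triple: "\<And>i j k. i \<in> V \<Longrightarrow> j \<in> V \<Longrightarrow> k \<in> V \<Longrightarrow> i \<noteq> j \<Longrightarrow> j \<noteq> k \<Longrightarrow> i \<noteq> k \<Longrightarrow> F i \<inter> F j \<inter> F k = {}"
    and q: "(i0, j0) \<in> meet_graph V F" "card (F i0 \<inter> F j0) = q"
      "\<And>i j. (i, j) \<in> meet_graph V F \<Longrightarrow> q \<le> card (F i \<inter> F j)"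
  shows "has_grade (sr_ideal (F ` V) :: ('n, 'k::field) mpoly set)
    (if \<exists>i\<in>V. \<exists>j\<in>V. (i, j) \<notin> (meet_graph V F)\<^sup>* then 2
     else if has_cycle (meet_graph V F) then 3 else q + 2)"
proof -
  define R where "R = meet_graph V F"
  have R: "(i, j) \<in> R \<longleftrightarrow> i \<in> V \<and> j \<in> V \<and> i \<noteq> j \<and> F i \<inter> F j \<noteq> {}" for i j
    by (auto simp: R_def meet_graph_def)
  have symR: "(i, j) \<in> R \<Longrightarrow> (j, i) \<in> R" for i j by (auto simp: R)
  note q = q[folded R_def]
  have ij0: "i0 \<in> V" "j0 \<in> V" "i0 \<noteq> j0" "F i0 \<inter> F j0 \<noteq> {}" using q(1) by (auto simp: R)
  then have "q \<ge> 1" using q(2) by (auto simp: Suc_le_eq card_gt_0_iff)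
  have other: "\<exists>j\<in>V. j \<noteq> i" for i using ij0 by metis
  have ne: "F i \<noteq> {}" "F i \<noteq> UNIV" if "i \<in> V" for i
    using other[of i] anti[OF that] anti[OF _ that] by (metis empty_subsetI, metis top_greatest)
  let ?e = "\<lambda>i. esym (Suc i) :: ('n, 'k) mpoly"
  have em: "?e i \<in> sr_ideal {{}}" for i by (simp add: esym_in_sr_ideal)
  have card_gt: "q < card (F i)" if "(i, j) \<in> R" for i j
  proof -
    have "F i \<inter> F j \<subset> F i" using that anti by (auto simp: R)
    then have "card (F i \<inter> F j) < card (F i)" by (intro psubset_card_mono) auto
    then show ?thesis using q(3)[OF that] by simp
  qed
  consider (disc) "\<exists>i\<in>V. \<exists>j\<in>V. (i, j) \<notin> R\<^sup>*"
    | (cyc) "\<forall>i\<in>V. \<forall>j\<in>V. (i, j) \<in> R\<^sup>*" "has_cycle R"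
    | (tree) "\<forall>i\<in>V. \<forall>j\<in>V. (i, j) \<in> R\<^sup>*" "\<not> has_cycle R" by blast
  then have "has_grade (sr_ideal (F ` V) :: ('n, 'k) mpoly set)
    (if \<exists>i\<in>V. \<exists>j\<in>V. (i, j) \<notin> R\<^sup>* then 2 else if has_cycle R then 3 else q + 2)"
  proof cases
    case disc
    then obtain i j where ij: "i \<in> V" "j \<in> V" "(i, j) \<notin> R\<^sup>*" by blast
    define C where "C = {k \<in> V. (i, k) \<in> R\<^sup>*}"
    define S where "S = \<Union> (F ` C)"
    have S: "F l \<subseteq> S" "l \<in> C" if l: "l \<in> V" "F l \<inter> S \<noteq> {}" for l
    proof -
      obtain k where k: "k \<in> C" "F k \<inter> F l \<noteq> {}" using l by (auto simp: S_def)
      then have "k = l \<or> (k, l) \<in> R" using l by (auto simp: R C_def)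
      then show "l \<in> C" using k that by (auto simp: C_def intro: rtrancl_into_rtrancl)
      then show "F l \<subseteq> S" by (auto simp: S_def)
    qed
    have "i \<in> C" "j \<notin> C" using ij by (auto simp: C_def)
    obtain u v where uv: "u \<in> F i" "v \<in> F j" using ne(1)[OF ij(1)] ne(1)[OF ij(2)] by blast
    have "u \<in> S" using uv \<open>i \<in> C\<close> by (auto simp: S_def)
    have "v \<notin> S" using S(2)[of j] uv ij \<open>j \<notin> C\<close> by auto
    have "r \<le> 2" if f: "\<forall>i<r. f i \<in> sr_ideal {{}}" and reg: "regular_on f r (sr_ideal (F ` V) :: ('n, 'k) mpoly set) {0}" for f r
    proof -
      have "r \<le> card ({} :: 'n set) + 2"
      proof (rule regular_length_separated[OF reg, of S "{}" "- S" u "F i" v "F j"])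
        fix G assume "G \<in> F ` V"
        then show "G \<inter> S = {} \<or> G \<inter> - S = {}" using S(1) by blast
      qed (use f uv ij \<open>u \<in> S\<close> \<open>v \<notin> S\<close> in auto)
      then show ?thesis by simp
    qed
    moreover have "regular_on ?e 2 (sr_ideal (F ` V)) {0}" using ne ij0 by (intro esym_regular_2) auto
    ultimately have "has_grade (sr_ideal (F ` V) :: ('n, 'k) mpoly set) 2"
      by (intro has_gradeI[OF em])
    then show ?thesis using disc by simp
  next
    case cyc
    then obtain v a b where vab: "(v, a) \<in> R" "(v, b) \<in> R" "a \<noteq> b" "(a, b) \<in> (R \<inter> (- {v}) \<times> (- {v}))\<^sup>*"
      by (auto simp: has_cycle_def)
    then have in_V: "v \<in> V" "a \<in> V" "b \<in> V" "v \<noteq> a" "v \<noteq> b" by (auto simp: R)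
    obtain w where w: "w \<in> F v" "w \<in> F a" using vab by (auto simp: R)
    obtain z where z: "z \<in> F v" "z \<in> F b" using vab by (auto simp: R)
    let ?S = "{(s, t). \<exists>G\<in>F ` V - {F v}. s \<in> G \<and> t \<in> G}"
    have notv: "F k \<noteq> F v" if "k \<in> V" "k \<noteq> v" for k using anti[OF that(1) in_V(1) that(2)] by auto
    have "k \<in> V \<and> k \<noteq> v \<and> (\<forall>y\<in>F k. (w, y) \<in> ?S\<^sup>*)" if "(a, k) \<in> (R \<inter> (- {v}) \<times> (- {v}))\<^sup>*" for k
      using that
    proof (induction rule: rtrancl_induct)
      case base
      have "(w, y) \<in> ?S" if "y \<in> F a" for y using w that notv[of a] in_V by blast
      then show ?case using in_V by blast
    next
      case (step k l)
      then have l: "l \<in> V" "l \<noteq> v" by (auto simp: R)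
      obtain y where y: "y \<in> F k" "y \<in> F l" using step by (auto simp: R)
      have "(w, y') \<in> ?S\<^sup>*" if "y' \<in> F l" for y'
      proof -
        have "(y, y') \<in> ?S" using y that notv[OF l] l by blast
        moreover have "(w, y) \<in> ?S\<^sup>*" using step y by blast
        ultimately show ?thesis by (rule rtrancl_into_rtrancl[rotated])
      qed
      then show ?case using l by blast
    qed
    then have path: "(w, z) \<in> ?S\<^sup>*" using vab(4) z by blast
    have W: "G \<inter> F v \<subseteq> F v \<inter> F a \<or> G \<inter> F v \<inter> (F v \<inter> F a) = {}" if "G \<in> F ` V" "G \<noteq> F v" for G
    proof -
      obtain k where "G = F k" "k \<in> V" "k \<noteq> v" using \<open>G \<in> F ` V\<close> \<open>G \<noteq> F v\<close> by auto
      then show ?thesis using triple[of k v a] in_V by (cases "k = a") auto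
    qed
    have "z \<notin> F v \<inter> F a" using triple[of v a b] in_V vab(3) z by auto
    then have "r \<le> 3" if f: "\<forall>i<r. f i \<in> sr_ideal {{}}" and reg: "regular_on f r (sr_ideal (F ` V) :: ('n, 'k) mpoly set) {0}" for f r
      using regular_length_cycle[OF reg _ _ W _ _ _ _ path] f w z in_V by blast
    moreover have "regular_on ?e 3 (sr_ideal (F ` V)) {0}"
    proof (rule connected_growth[OF V in_V(1), where R = R])
      have c2: "2 \<le> card (F i)" if "(i, j) \<in> R" for i j using card_gt[OF that] \<open>q \<ge> 1\<close> by simp
      have "2 \<le> card (F v)" using c2 vab by blast
      then show "regular_on ?e 3 (sr_ideal (F ` {v})) {0}"
        using esym_regular_prime[of 2 "F v"] card_less_card_UNIV[OF ne(2)[OF in_V(1)]]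
        by (simp add: numeral_3_eq_3 numeral_2_eq_2)
      show "(v, k) \<in> R\<^sup>*" if "k \<in> V" for k using cyc in_V that by blast
      show "R \<subseteq> V \<times> V" by (auto simp: R)
      fix T t k assume "regular_on ?e 3 (sr_ideal (F ` T)) {0}" "t \<in> T" "k \<in> V - T" "(t, k) \<in> R"
      then show "regular_on ?e 3 (sr_ideal (F ` insert k T)) {0}"
        using esym_regular_3_insert[of "F ` T" "F k" "F t"] c2[OF symR] ne[of k] by (auto simp: R)
    qed
    ultimately have "has_grade (sr_ideal (F ` V) :: ('n, 'k) mpoly set) 3"
      by (intro has_gradeI[OF em])
    moreover have "\<not> (\<exists>i\<in>V. \<exists>j\<in>V. (i, j) \<notin> R\<^sup>*)" using cyc by blast
    ultimately show ?thesis using cyc(2) by (simp only: if_False if_True)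
  next
    case tree
    \<comment> \<open>The side of \<open>j0\<close> after removing the vertex \<open>i0\<close>; no other neighbour of \<open>i0\<close> lies in it, as there
      are no cycles.\<close>
    define C where "C = {k. (j0, k) \<in> (R \<inter> (- {i0}) \<times> (- {i0}))\<^sup>*}"
    have C: "k \<in> V \<and> k \<noteq> i0" if "k \<in> C" for k
      using that unfolding C_def mem_Collect_eq
      by (induction rule: rtrancl_induct) (use ij0 in \<open>auto simp: R\<close>)
    define B where "B = F i0 \<inter> F j0"
    define S where "S = \<Union> (F ` C) - B"
    have i0S: "F i0 \<inter> S = {}"
    proof (rule ccontr)
      assume "F i0 \<inter> S \<noteq> {}"
      then obtain y k where y: "y \<in> F i0" "y \<in> F k" "k \<in> C" "y \<notin> B" by (auto simp: S_def)
      then have "k \<noteq> j0" by (auto simp: B_def)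
      moreover have "(i0, k) \<in> R" using C[OF y(3)] y ij0 by (auto simp: R)
      ultimately have "has_cycle R" using q(1) y(3) unfolding has_cycle_def C_def by blast
      then show False using tree by blast
    qed
    have sep: "F l \<inter> S = {} \<or> F l \<inter> (- B - S) = {}" if "l \<in> V" for l
    proof (cases "F l \<inter> S = {}")
      case False
      then have "l \<noteq> i0" using i0S by auto
      obtain y where "y \<in> F l" "y \<in> S" using False by blast
      then obtain k where k: "k \<in> C" "F k \<inter> F l \<noteq> {}" unfolding S_def by blast
      then have "k = l \<or> (k, l) \<in> R \<inter> (- {i0}) \<times> (- {i0})" using C[OF k(1)] that \<open>l \<noteq> i0\<close> by (auto simp: R)
      then have "l \<in> C" using k(1) by (auto simp: C_def intro: rtrancl_into_rtrancl)
      then show ?thesis by (auto simp: S_def)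
    qed simp
    obtain u where u: "u \<in> F j0" "u \<notin> F i0" using anti[of j0 i0] ij0 by blast
    obtain v where v: "v \<in> F i0" "v \<notin> F j0" using anti[of i0 j0] ij0 by blast
    have "j0 \<in> C" by (simp add: C_def)
    then have uS: "u \<in> S" using u by (auto simp: S_def B_def)
    have vS: "v \<in> - B - S" using v i0S by (auto simp: B_def)
    have up: "r \<le> q + 2" if f: "\<forall>i<r. f i \<in> sr_ideal {{}}" and reg: "regular_on f r (sr_ideal (F ` V) :: ('n, 'k) mpoly set) {0}" for f r
    proof -
      have "r \<le> card B + 2"
        by (rule regular_length_separated[OF reg, of S B "- B - S" u "F j0" v "F i0"])
           (use f sep u v uS vS ij0 in \<open>auto simp: S_def\<close>)
      then show ?thesis using q(2) by (simp add: B_def)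
    qed
    \<comment> \<open>Connectedness within \<open>T\<close> is carried along: it produces the cycle when a new facet meets two
      facets of \<open>T\<close>.\<close>
    define Q where "Q = (\<lambda>T. regular_on ?e (q + 2) (sr_ideal (F ` T)) {0} \<and> (\<forall>a\<in>T. \<forall>b\<in>T. (a, b) \<in> (R \<inter> T \<times> T)\<^sup>*))"
    have "Q V"
    proof (rule connected_growth[OF V ij0(1), where R = R])
      show "Q {i0}" unfolding Q_def
        using esym_regular_prime[of "Suc q" "F i0"] card_less_card_UNIV[OF ne(2)[OF ij0(1)]] card_gt[OF q(1)]
        by simp
      show "(i0, k) \<in> R\<^sup>*" if "k \<in> V" for k using tree ij0 that by blast
      show "R \<subseteq> V \<times> V" by (auto simp: R)
      fix T t k assume T: "T \<subseteq> V" "Q T" "t \<in> T" "k \<in> V - T" "(t, k) \<in> R"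
      have leaf: "F t' \<inter> F k \<subseteq> F t \<inter> F k" if "t' \<in> T" for t'
      proof (cases "t' = t \<or> F t' \<inter> F k = {}")
        case False
        then have "(k, t') \<in> R" "t \<noteq> t'" using that T(1,4) by (auto simp: R)
        moreover have "(k, t) \<in> R" using symR[OF T(5)] .
        moreover have "(t, t') \<in> (R \<inter> (- {k}) \<times> (- {k}))\<^sup>*"
        proof -
          have "R \<inter> T \<times> T \<subseteq> R \<inter> (- {k}) \<times> (- {k})" using T by auto
          then have "(R \<inter> T \<times> T)\<^sup>* \<subseteq> (R \<inter> (- {k}) \<times> (- {k}))\<^sup>*" by (rule rtrancl_mono)
          then show ?thesis using T(2,3) that unfolding Q_def by auto
        qed
        ultimately have "has_cycle R" unfolding has_cycle_def by fast
        then show ?thesis using tree by blast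
      qed auto
      have "regular_on ?e (q + 2) (sr_ideal (insert (F k) (F ` T))) {0}"
        using T leaf card_gt[OF symR] q(3) ne[of k]
        by (intro esym_regular_tree_insert[where H = "F t"]) (auto simp: Q_def R)
      moreover have "(a, b) \<in> (R \<inter> insert k T \<times> insert k T)\<^sup>*" if "a \<in> insert k T" "b \<in> insert k T" for a b
      proof -
        let ?R = "R \<inter> insert k T \<times> insert k T"
        have "R \<inter> T \<times> T \<subseteq> ?R" by auto
        then have sub: "(R \<inter> T \<times> T)\<^sup>* \<subseteq> ?R\<^sup>*" by (rule rtrancl_mono)
        have inT: "(a, b) \<in> ?R\<^sup>*" if "a \<in> T" "b \<in> T" for a b
          using T(2) that sub unfolding Q_def by auto
        have tk: "(t, k) \<in> ?R" "(k, t) \<in> ?R" using T(3,5) symR[OF T(5)] by auto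
        have "(a, t) \<in> ?R\<^sup>*" using inT[OF _ T(3), of a] tk(2) that(1) by (cases "a = k") auto
        moreover have "(t, b) \<in> ?R\<^sup>*" using inT[OF T(3), of b] tk(1) that(2) by (cases "b = k") auto
        ultimately show ?thesis by (rule rtrancl_trans)
      qed
      ultimately show "Q (insert k T)" unfolding Q_def by simp
    qed
    then have "regular_on ?e (q + 2) (sr_ideal (F ` V)) {0}" by (simp only: Q_def)
    from has_gradeI[OF em this up] have "has_grade (sr_ideal (F ` V) :: ('n, 'k) mpoly set) (q + 2)" .
    moreover have "\<not> (\<exists>i\<in>V. \<exists>j\<in>V. (i, j) \<notin> R\<^sup>*)" using tree by blast
    ultimately show ?thesis using tree(2) by (simp only: if_False)
  qed
  then show ?thesis by (simp only: R_def)
qed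

section \<open>Ideals, submodules and depth in the polynomial ring\<close>

lemma mpoly_ring_simps [simp]:
  "carrier mpoly_ring = UNIV" "monoid.mult mpoly_ring = (*)" "one mpoly_ring = 1"
  "ring.zero mpoly_ring = 0" "add mpoly_ring = (+)"
  by (simp_all add: mpoly_ring_def ring_of_type_algebra_def fun_eq_iff)

lemma ideal_module_simps [simp]:
  "carrier (ideal_module mpoly_ring I) = I" "module.smult (ideal_module mpoly_ring I) = (*)"
  by (simp_all add: ideal_module_def)

lemma cring_mpoly_ring: "cring (mpoly_ring :: ('n::finite, 'k::field) mpoly ring)"
  unfolding mpoly_ring_def by (rule cring_from_type_algebra)

lemma ring_mpoly_ring: "ring (mpoly_ring :: ('n::finite, 'k::field) mpoly ring)"
  using cring_mpoly_ring cring.axioms(1) by blast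

lemma additive_inverse:
  assumes "ideal_set I" "x \<in> I" "carrier G = I" "monoid.mult G = (+)" "one G = 0"
  shows "inv\<^bsub>G\<^esub> x = - x"
  unfolding m_inv_def
proof (rule the_equality)
  show "- x \<in> carrier G \<and> x \<otimes>\<^bsub>G\<^esub> - x = \<one>\<^bsub>G\<^esub> \<and> - x \<otimes>\<^bsub>G\<^esub> x = \<one>\<^bsub>G\<^esub>"
    using assms by (simp add: ideal_set_uminus)
  show "y = - x" if "y \<in> carrier G \<and> x \<otimes>\<^bsub>G\<^esub> y = \<one>\<^bsub>G\<^esub> \<and> y \<otimes>\<^bsub>G\<^esub> x = \<one>\<^bsub>G\<^esub>" for y
    using that assms by (simp add: eq_neg_iff_add_eq_0)
qed

lemma ideal_mpoly_ring_iff: "ideal I (mpoly_ring :: ('n::finite, 'k::field) mpoly ring) \<longleftrightarrow> ideal_set I"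
proof
  assume "ideal I (mpoly_ring :: ('n, 'k) mpoly ring)"
  then interpret ideal I "mpoly_ring :: ('n, 'k) mpoly ring" .
  show "ideal_set I"
    using additive_subgroup.zero_closed[OF is_additive_subgroup] additive_subgroup.a_closed[OF is_additive_subgroup]
      I_l_closed by (intro ideal_setI) auto
next
  assume I: "ideal_set I"
  show "ideal I (mpoly_ring :: ('n, 'k) mpoly ring)"
  proof (rule idealI[OF ring_mpoly_ring])
    show "subgroup I (add_monoid (mpoly_ring :: ('n, 'k) mpoly ring))"
      using I additive_inverse[OF ideal_set_UNIV, of _ "add_monoid (mpoly_ring :: ('n, 'k) mpoly ring)"]
      by (intro subgroup.intro) (auto simp: ideal_set_add ideal_set_zero ideal_set_uminus)
  qed (use I in \<open>auto simp: ideal_set_mult ideal_set_mult_right\<close>)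
qed

lemma primeideal_mpoly_ring_iff:
  "primeideal P (mpoly_ring :: ('n::finite, 'k::field) mpoly ring) \<longleftrightarrow>
    ideal_set P \<and> P \<noteq> UNIV \<and> (\<forall>a b. a * b \<in> P \<longrightarrow> a \<in> P \<or> b \<in> P)"
  unfolding primeideal_def primeideal_axioms_def using cring_mpoly_ring
  by (auto simp: ideal_mpoly_ring_iff)

lemma genideal_mpoly_ring:
  "genideal (mpoly_ring :: ('n::finite, 'k::field) mpoly ring) S = \<Inter>{I. ideal_set I \<and> S \<subseteq> I}"
  by (simp add: genideal_def ideal_mpoly_ring_iff)

lemma genideal_subset: "ideal_set I \<Longrightarrow> S \<subseteq> I \<Longrightarrow> genideal mpoly_ring S \<subseteq> I"
  unfolding genideal_mpoly_ring by (rule Inter_lower) simp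

lemma genideal_superset: "S \<subseteq> genideal mpoly_ring S"
  unfolding genideal_mpoly_ring by (rule Inter_greatest) simp

lemma ideal_set_genideal: "ideal_set (genideal mpoly_ring S)"
  unfolding genideal_mpoly_ring
  by (rule ideal_setI) (simp_all add: ideal_set_zero ideal_set_add ideal_set_mult)

lemma irrelevant_ideal_eq: "irrelevant_ideal = (sr_ideal {{}} :: ('n::finite, 'k::field) mpoly set)"
proof
  show "irrelevant_ideal \<subseteq> (sr_ideal {{}} :: ('n, 'k) mpoly set)"
    unfolding irrelevant_ideal_def
    by (rule genideal_subset[OF ideal_set_sr_ideal]) (auto simp: variable_in_sr_ideal)
  show "(sr_ideal {{}} :: ('n, 'k) mpoly set) \<subseteq> irrelevant_ideal"
  proof
    fix p :: "('n, 'k) mpoly" assume "p \<in> sr_ideal {{}}"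
    then obtain g where "p = (\<Sum>a\<in>- {}. g a * variable a)" using sr_ideal_variables by blast
    also have "\<dots> \<in> irrelevant_ideal" unfolding irrelevant_ideal_def
      by (intro ideal_set_sum ideal_set_mult ideal_set_genideal subsetD[OF genideal_superset] rangeI)
    finally show "p \<in> irrelevant_ideal" .
  qed
qed

lemma set_add_mpoly_ring: "P <+>\<^bsub>mpoly_ring\<^esub> Q = ideal_plus P Q"
  by (auto simp: set_add_def set_mult_def ideal_plus_def)

lemma submodule_ideal_module_iff:
  assumes I: "ideal_set (I :: ('n::finite, 'k::field) mpoly set)"
  shows "submodule N mpoly_ring (ideal_module mpoly_ring I) \<longleftrightarrow> ideal_set N \<and> N \<subseteq> I"
proof
  assume "submodule N mpoly_ring (ideal_module mpoly_ring I)"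
  then interpret N: submodule N mpoly_ring "ideal_module mpoly_ring I" .
  show "ideal_set N \<and> N \<subseteq> I"
    using N.subset N.m_closed N.one_closed N.smult_closed
    by (auto simp: ideal_set_def ideal_module_def)
next
  assume N: "ideal_set N \<and> N \<subseteq> I"
  then show "submodule N mpoly_ring (ideal_module mpoly_ring I)"
    using additive_inverse[OF I, of _ "add_monoid (ideal_module mpoly_ring I)"]
    by (intro submodule.intro subgroup.intro submodule_axioms.intro)
       (auto simp: ideal_module_def ideal_set_add ideal_set_zero ideal_set_uminus ideal_set_mult)
qed

text \<open>Both sides are the smallest submodule of \<open>I\<close> that contains the products of the \<open>f\<^sub>j\<close> with elements
  of \<open>I\<close>.\<close>

lemma ideal_smult_eq_seq_span:
  fixes I :: "('n::finite, 'k::field) mpoly set"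
  assumes I: "ideal_set I" and i: "i \<le> length fs"
  shows "ideal_smult mpoly_ring (genideal mpoly_ring (set (take i fs))) (ideal_module mpoly_ring I) =
    seq_span (\<lambda>j. fs ! j) {0} I i" (is "?L = ?S i")
proof
  have id: "ideal_set (?S k)" for k by (rule ideal_set_seq_span[OF ideal_set_0 I])
  have "?S i \<subseteq> I" using seq_span_subset[OF I] ideal_set_zero[OF I] by blast
  have mono: "?S j \<subseteq> ?S k" if "j \<le> k" for j k
    using that seq_span_le_Suc[OF I] by (rule lift_Suc_mono_le[rotated])
  have "genideal mpoly_ring (set (take i fs)) \<subseteq> {a. \<forall>x\<in>I. a * x \<in> ?S i}"
  proof (rule genideal_subset)
    show "ideal_set {a. \<forall>x\<in>I. a * x \<in> ?S i}"
      using id[of i] by (intro ideal_setI) (auto simp: ideal_set_zero ideal_set_add ideal_set_mult distrib_right mult.assoc)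
    show "set (take i fs) \<subseteq> {a. \<forall>x\<in>I. a * x \<in> ?S i}"
    proof
      fix a assume "a \<in> set (take i fs)"
      then obtain j where "j < i" "a = fs ! j" by (auto simp: in_set_conv_nth)
      then show "a \<in> {a. \<forall>x\<in>I. a * x \<in> ?S i}"
        using seq_span_gen[OF ideal_set_0 I, of _ "\<lambda>j. fs ! j" j] mono[of "Suc j" i] by auto
    qed
  qed
  then show "?L \<subseteq> ?S i" unfolding ideal_smult_def
    using id[of i] \<open>?S i \<subseteq> I\<close> by (intro Inter_lower) (simp add: submodule_ideal_module_iff[OF I] subset_iff)
next
  show "?S i \<subseteq> ?L" unfolding ideal_smult_def
  proof (intro Inter_greatest)
    fix N assume "N \<in> {N. submodule N mpoly_ring (ideal_module mpoly_ring I) \<and>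
      (\<forall>a\<in>genideal mpoly_ring (set (take i fs)). \<forall>x\<in>carrier (ideal_module mpoly_ring I). a \<odot>\<^bsub>ideal_module mpoly_ring I\<^esub> x \<in> N)}"
    then have N: "ideal_set N" and sm: "\<And>a x. a \<in> genideal mpoly_ring (set (take i fs)) \<Longrightarrow> x \<in> I \<Longrightarrow> a * x \<in> N"
      by (auto simp: submodule_ideal_module_iff[OF I])
    have "?S k \<subseteq> N" if "k \<le> i" for k
      using that
    proof (induction k)
      case 0 then show ?case using ideal_set_zero[OF N] by simp
    next
      case (Suc k)
      then have "fs ! k \<in> set (take i fs)" using i by (auto simp: in_set_conv_nth intro!: exI[of _ k])
      then have "fs ! k \<in> genideal mpoly_ring (set (take i fs))" using genideal_superset by blast
      then show ?case using Suc sm N by (auto intro!: ideal_set_add)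
    qed
    then show "?S i \<subseteq> N" by simp
  qed
qed

lemma coef_zero_irrelevant: "p \<in> sr_ideal {{}} \<Longrightarrow> coef p 0 = 0"
  using sr_idealD[of p "{{}}" 0 "{}"] by (auto simp: in_keys_iff)

text \<open>A proper divisor of the monomial of a minimal nonface is supported on a face and hence does not occur in \<open>p\<close>;
  in the product only the constant term of \<open>c\<close> can contribute.\<close>

lemma coef_mult_minimal_nonface:
  assumes p: "p \<in> sr_ideal \<F>" and A: "\<And>B. B \<subset> A \<Longrightarrow> \<exists>F\<in>\<F>. B \<subseteq> F"
  shows "coef (c * p) (indicator_exp A) = coef c 0 * coef p (indicator_exp A)"
proof -
  have *: "u = 0 \<and> v = indicator_exp A" if "v \<in> monomials p" "u + v = indicator_exp A" for u v
  proof -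
    have e: "Poly_Mapping.lookup u a + Poly_Mapping.lookup v a = (if a \<in> A then 1 else 0)" for a
    proof -
      have "Poly_Mapping.lookup (u + v) a = Poly_Mapping.lookup (indicator_exp A) a" by (simp only: that(2))
      then show ?thesis by (simp add: lookup_add lookup_indicator_exp)
    qed
    have "Poly_Mapping.keys v \<subseteq> A" using that(2) keys_add_nat[of u v] keys_indicator_exp[of A] by auto
    moreover have "\<not> Poly_Mapping.keys v \<subset> A" using A sr_idealD[OF p that(1)] by blast
    ultimately have k: "Poly_Mapping.keys v = A" by blast
    have "Poly_Mapping.lookup u a = 0" for a
    proof (cases "a \<in> A")
      case True
      then have "Poly_Mapping.lookup v a \<noteq> 0" using k in_keys_iff[of a v] by simp
      then show ?thesis using e[of a] True by simp
    qed (use e[of a] in simp)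
    then have "u = 0" by (intro poly_mapping_eqI) simp
    then show ?thesis using that by simp
  qed
  have "coef (c * p) (indicator_exp A) = (\<Sum>u\<in>monomials c. \<Sum>v\<in>monomials p. if v = indicator_exp A then (if u = 0 then coef c u * coef p v else 0) else 0)"
    unfolding coef_mult using * by (intro sum.cong refl) auto
  also have "\<dots> = (\<Sum>u\<in>monomials c. if u = 0 then coef c 0 * coef p (indicator_exp A) else 0)"
    by (intro sum.cong refl) (auto simp: sum.delta in_keys_iff)
  also have "\<dots> = coef c 0 * coef p (indicator_exp A)" by (auto simp: sum.delta in_keys_iff)
  finally show ?thesis .
qed

text \<open>The monomial of a minimal nonface lies in the ideal, but its coefficient vanishes on every product
  with an element without constant term.\<close>

lemma irrelevant_smult_proper:
  fixes \<F> :: "'n::finite set set"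
  assumes "UNIV \<notin> \<F>" and J: "J \<subseteq> sr_ideal {{}}"
  shows "ideal_smult mpoly_ring J (ideal_module mpoly_ring (sr_ideal \<F> :: ('n, 'k::field) mpoly set)) \<noteq> sr_ideal \<F>"
proof -
  let ?P = "\<lambda>A. \<forall>F\<in>\<F>. \<not> A \<subseteq> F"
  have "?P UNIV" using assms(1) by (metis top.extremum_uniqueI)
  then obtain A where A: "?P A" "\<And>B. card B < card A \<Longrightarrow> \<not> ?P B"
    using arg_min_nat_lemma[of ?P UNIV card] by (metis (no_types, lifting) linorder_not_less)
  have face: "\<exists>F\<in>\<F>. B \<subseteq> F" if "B \<subset> A" for B
    using A(2)[of B] that psubset_card_mono[OF finite that] by blast
  define N where "N = {p \<in> (sr_ideal \<F> :: ('n, 'k) mpoly set). coef p (indicator_exp A) = 0}"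
  have cm: "coef (c * p) (indicator_exp A) = coef c 0 * coef p (indicator_exp A)" if "p \<in> sr_ideal \<F>" for c p :: "('n, 'k) mpoly"
    by (rule coef_mult_minimal_nonface[OF that face])
  have "ideal_set N" unfolding N_def using ideal_set_sr_ideal[of \<F>, where 'k = 'k]
    by (intro ideal_setI) (auto simp: ideal_set_zero ideal_set_add ideal_set_mult lookup_add cm)
  moreover have "a * x \<in> N" if "a \<in> J" "x \<in> sr_ideal \<F>" for a x
    using that J cm[OF that(2), of a] coef_zero_irrelevant[of a] ideal_set_mult[OF ideal_set_sr_ideal that(2)]
    by (auto simp: N_def)
  ultimately have "ideal_smult mpoly_ring J (ideal_module mpoly_ring (sr_ideal \<F>)) \<subseteq> N"
    unfolding ideal_smult_def
    by (intro Inter_lower) (auto simp: submodule_ideal_module_iff[OF ideal_set_sr_ideal] N_def)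
  moreover have "sqfree A \<in> sr_ideal \<F>" "sqfree A \<notin> N"
    using A(1) by (auto simp: sqfree_in_sr_ideal N_def) (simp add: sqfree_def)
  ultimately show ?thesis by blast
qed

lemma regular_sequence_iff:
  fixes \<F> :: "'n::finite set set"
  assumes "UNIV \<notin> \<F>" "set fs \<subseteq> sr_ideal {{}}"
  shows "regular_sequence mpoly_ring (ideal_module mpoly_ring (sr_ideal \<F> :: ('n, 'k::field) mpoly set)) fs \<longleftrightarrow>
    regular_on (\<lambda>j. fs ! j) (length fs) (sr_ideal \<F>) {0}"
proof -
  have "ideal_smult mpoly_ring (genideal mpoly_ring (set fs)) (ideal_module mpoly_ring (sr_ideal \<F> :: ('n, 'k) mpoly set)) \<noteq> sr_ideal \<F>"
    using assms by (intro irrelevant_smult_proper genideal_subset ideal_set_sr_ideal)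
  then show ?thesis
    unfolding regular_sequence_def regular_on_def
    by (simp add: ideal_smult_eq_seq_span[OF ideal_set_sr_ideal])
qed

lemma depth_eq_grade:
  fixes \<F> :: "'n::finite set set"
  assumes U: "UNIV \<notin> \<F>" and d: "has_grade (sr_ideal \<F> :: ('n, 'k::field) mpoly set) d"
  shows "depth mpoly_ring irrelevant_ideal (ideal_module mpoly_ring (sr_ideal \<F> :: ('n, 'k) mpoly set)) = enat d"
proof -
  let ?M = "ideal_module mpoly_ring (sr_ideal \<F> :: ('n, 'k) mpoly set)"
  have c: "carrier ?M = sr_ideal \<F>" by (simp add: ideal_module_def)
  let ?S = "{enat (length fs) | fs. set fs \<subseteq> irrelevant_ideal \<and> regular_sequence mpoly_ring ?M fs}"
  obtain f where f: "\<And>i. f i \<in> sr_ideal {{}}" "regular_on f d (sr_ideal \<F> :: ('n, 'k) mpoly set) {0}"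
    using d unfolding has_grade_def by blast
  have cong: "regular_on g r (sr_ideal \<F>) {0} \<longleftrightarrow> regular_on f r (sr_ideal \<F>) {0}"
    if "\<And>i. i < r \<Longrightarrow> g i = f i" for f g :: "nat \<Rightarrow> ('n, 'k) mpoly" and r
  proof -
    have "seq_span g {0} (sr_ideal \<F>) i = seq_span f {0} (sr_ideal \<F>) i" if "i \<le> r" for i
      using that \<open>\<And>i. i < r \<Longrightarrow> g i = f i\<close> by (induction i) auto
    then show ?thesis using that unfolding regular_on_def by simp
  qed
  have "Sup ?S = enat d"
  proof (rule antisym)
    show "Sup ?S \<le> enat d"
    proof (rule Sup_least)
      fix x assume "x \<in> ?S"
      then obtain fs where fs: "x = enat (length fs)" "set fs \<subseteq> sr_ideal {{}}" "regular_sequence mpoly_ring ?M fs"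
        by (auto simp: irrelevant_ideal_eq)
      then have "regular_on (\<lambda>j. fs ! j) (length fs) (sr_ideal \<F>) {0}" using regular_sequence_iff[OF U] by blast
      moreover have "\<forall>i<length fs. fs ! i \<in> sr_ideal {{}}" using fs(2) by auto
      ultimately have "length fs \<le> d" using d unfolding has_grade_def by blast
      then show "x \<le> enat d" using fs by simp
    qed
    define fs where "fs = map f [0..<d]"
    have "set fs \<subseteq> sr_ideal {{}}" using f by (auto simp: fs_def)
    moreover have "regular_on (\<lambda>j. fs ! j) (length fs) (sr_ideal \<F>) {0}"
      using f(2) cong[of d "\<lambda>j. fs ! j" f] by (simp add: fs_def)
    ultimately have "enat (length fs) \<in> ?S" using regular_sequence_iff[OF U] by (auto simp: irrelevant_ideal_eq)
    then show "enat d \<le> Sup ?S" by (intro Sup_upper) (simp add: fs_def)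
  qed
  then show ?thesis using irrelevant_smult_proper[OF U order_refl]
    unfolding depth_def c irrelevant_ideal_eq by simp
qed

section \<open>Monomial prime ideals\<close>

text \<open>Restrict both sets to their maximal values, one coordinate after the other; a sum of two exponents
  that survive is attained only once.\<close>

lemma unique_product:
  fixes A B :: "('n::finite \<Rightarrow>\<^sub>0 nat) set"
  assumes "finite A" "A \<noteq> {}" "finite B" "B \<noteq> {}"
  shows "\<exists>u\<in>A. \<exists>v\<in>B. \<forall>u'\<in>A. \<forall>v'\<in>B. u' + v' = u + v \<longrightarrow> u' = u \<and> v' = v"
proof -
  have "\<exists>u v. u \<in> A \<and> v \<in> B \<and> (\<forall>u' v'. u' \<in> A \<longrightarrow> v' \<in> B \<longrightarrow> u' + v' = u + v \<longrightarrow>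
      (\<forall>t\<in>T. Poly_Mapping.lookup u' t = Poly_Mapping.lookup u t))" for T :: "'n set"
    using finite[of T] assms
  proof (induction T arbitrary: A B rule: finite_induct)
    case empty then show ?case by blast
  next
    case (insert t T)
    define mA where "mA = Max ((\<lambda>u. Poly_Mapping.lookup u t) ` A)"
    define mB where "mB = Max ((\<lambda>u. Poly_Mapping.lookup u t) ` B)"
    define A' where "A' = {u \<in> A. Poly_Mapping.lookup u t = mA}"
    define B' where "B' = {u \<in> B. Poly_Mapping.lookup u t = mB}"
    have leA: "Poly_Mapping.lookup u t \<le> mA" if "u \<in> A" for u using that insert.prems by (simp add: mA_def)
    have leB: "Poly_Mapping.lookup u t \<le> mB" if "u \<in> B" for u using that insert.prems by (simp add: mB_def)
    have "mA \<in> (\<lambda>u. Poly_Mapping.lookup u t) ` A" "mB \<in> (\<lambda>u. Poly_Mapping.lookup u t) ` B"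
      using insert.prems unfolding mA_def mB_def by (intro Max_in; simp)+
    then have ne: "A' \<noteq> {}" "B' \<noteq> {}" by (auto simp: A'_def B'_def)
    have fin: "finite A'" "finite B'" using insert.prems by (auto simp: A'_def B'_def)
    obtain u v where uv: "u \<in> A'" "v \<in> B'"
      and uq: "\<forall>u' v'. u' \<in> A' \<longrightarrow> v' \<in> B' \<longrightarrow> u' + v' = u + v \<longrightarrow> (\<forall>t\<in>T. Poly_Mapping.lookup u' t = Poly_Mapping.lookup u t)"
      using insert.IH[OF fin(1) ne(1) fin(2) ne(2)] by metis
    have "Poly_Mapping.lookup u' s = Poly_Mapping.lookup u s"
      if *: "u' \<in> A" "v' \<in> B" "u' + v' = u + v" "s \<in> insert t T" for u' v' s
    proof -
      have "Poly_Mapping.lookup (u' + v') t = Poly_Mapping.lookup (u + v) t" by (simp only: *(3))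
      then have "Poly_Mapping.lookup u' t + Poly_Mapping.lookup v' t = mA + mB"
        using uv by (simp add: A'_def B'_def lookup_add)
      then have "Poly_Mapping.lookup u' t = mA" "Poly_Mapping.lookup v' t = mB"
        using leA[OF *(1)] leB[OF *(2)] by simp_all
      moreover then have "u' \<in> A'" "v' \<in> B'" using *(1,2) by (auto simp: A'_def B'_def)
      moreover have "Poly_Mapping.lookup u t = mA" using uv by (simp add: A'_def)
      ultimately show ?thesis using uq *(3,4) by auto
    qed
    moreover have "u \<in> A" "v \<in> B" using uv by (auto simp: A'_def B'_def)
    ultimately show ?case by metis
  qed
  then obtain u v where uv: "u \<in> A" "v \<in> B" and uq: "\<forall>u' v'. u' \<in> A \<longrightarrow> v' \<in> B \<longrightarrow> u' + v' = u + v \<longrightarrow>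
      (\<forall>t\<in>UNIV. Poly_Mapping.lookup u' t = Poly_Mapping.lookup u t)" by metis
  have "u' = u \<and> v' = v" if "u' \<in> A" "v' \<in> B" "u' + v' = u + v" for u' v'
  proof -
    have "u' = u" using uq that by (intro poly_mapping_eqI) simp
    then show ?thesis using that by simp
  qed
  then show ?thesis using uv by blast
qed

text \<open>If neither factor lies in the ideal, the terms supported on \<open>F\<close> have a product monomial attained
  only once, and its coefficient does not cancel.\<close>

lemma face_ideal_prime:
  fixes a b :: "('n::finite, 'k::field) mpoly"
  assumes "a * b \<in> sr_ideal {F}" shows "a \<in> sr_ideal {F} \<or> b \<in> sr_ideal {F}"
proof (rule ccontr)
  assume no: "\<not> ?thesis"
  let ?A = "{e \<in> monomials a. Poly_Mapping.keys e \<subseteq> F}" and ?B = "{e \<in> monomials b. Poly_Mapping.keys e \<subseteq> F}"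
  have "?A \<noteq> {}" "?B \<noteq> {}" using no by (auto simp: sr_ideal_def)
  then obtain u v where uv: "u \<in> ?A" "v \<in> ?B"
    "\<And>u' v'. u' \<in> ?A \<Longrightarrow> v' \<in> ?B \<Longrightarrow> u' + v' = u + v \<Longrightarrow> u' = u \<and> v' = v"
    using unique_product[of ?A ?B] by auto
  have F: "Poly_Mapping.keys (u + v) \<subseteq> F" using uv by (auto simp: keys_add_nat)
  have *: "u' = u \<and> v' = v" if "u' \<in> monomials a" "v' \<in> monomials b" "u' + v' = u + v" for u' v'
  proof -
    have "Poly_Mapping.keys u' \<union> Poly_Mapping.keys v' \<subseteq> F"
      using F unfolding that(3)[symmetric] keys_add_nat .
    then show ?thesis using that by (intro uv(3)) simp_all
  qed
  have "coef (a * b) (u + v) = (\<Sum>u'\<in>monomials a. \<Sum>v'\<in>monomials b. if v' = v then (if u' = u then coef a u * coef b v else 0) else 0)"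
    unfolding coef_mult using * by (intro sum.cong refl) auto
  also have "\<dots> = coef a u * coef b v" using uv by (simp add: sum.delta)
  also have "\<dots> \<noteq> 0" using uv by (simp add: in_keys_iff)
  finally have "u + v \<in> monomials (a * b)" by (simp add: in_keys_iff)
  then show False using sr_idealD[OF assms, of "u + v" F] F by simp
qed

lemma primeideal_face: "primeideal (sr_ideal {F}) (mpoly_ring :: ('n::finite, 'k::field) mpoly ring)"
proof -
  have "(1 :: ('n, 'k) mpoly) \<notin> sr_ideal {F}" by (auto simp: sr_ideal_def)
  then show ?thesis unfolding primeideal_mpoly_ring_iff
    using ideal_set_sr_ideal face_ideal_prime by blast
qed

lemma monomial_ideal_terms:
  fixes I :: "('n::finite, 'k::field) mpoly set"
  assumes "monomial_ideal I" "p \<in> I" "e \<in> monomials p"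
  shows "power_product e \<in> I"
proof -
  obtain E where I: "I = genideal mpoly_ring (power_product ` E)" using assms by (auto simp: monomial_ideal_def)
  let ?D = "{p :: ('n, 'k) mpoly. \<forall>e\<in>monomials p. \<exists>g\<in>E. \<exists>v. e = v + g}"
  have "I \<subseteq> ?D" unfolding I
  proof (rule genideal_subset)
    show "ideal_set ?D"
    proof (rule ideal_setI)
      fix p q assume "p \<in> ?D" "q \<in> ?D"
      then have "\<forall>e\<in>monomials p \<union> monomials q. \<exists>g\<in>E. \<exists>v. e = v + g" by auto
      then show "p + q \<in> ?D" using keys_add[of p q] by (simp add: subset_iff)
    next
      fix c p :: "('n, 'k) mpoly" assume p: "p \<in> ?D"
      show "c * p \<in> ?D"
      proof (intro CollectI ballI)
        fix e assume "e \<in> monomials (c * p)"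
        then obtain u v where uv: "e = u + v" "v \<in> monomials p" using monomials_mult_subset[of c p] by auto
        obtain g w where gw: "g \<in> E" "v = w + g" using p uv(2) by auto
        have "e = (u + w) + g" by (simp add: uv(1) gw(2) add.assoc)
        then show "\<exists>g\<in>E. \<exists>v. e = v + g" using gw(1) by blast
      qed
    qed simp
    have "\<exists>v. g = v + g" for g :: "'n \<Rightarrow>\<^sub>0 nat" by (rule exI[of _ 0]) simp
    then have "\<exists>g\<in>E. \<exists>v. e = v + g" if "e \<in> E" for e using that by blast
    then show "power_product ` E \<subseteq> ?D" by (auto simp: power_product_def)
  qed
  then have "p \<in> ?D" using assms(2) by (rule subsetD)
  then obtain g v where "g \<in> E" "e = v + g" using assms(3) by auto
  then have "power_product e = Poly_Mapping.single v 1 * (power_product g :: ('n, 'k) mpoly)"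
    by (simp add: power_product_def mult_single)
  moreover have "power_product g \<in> I" unfolding I using genideal_superset \<open>g \<in> E\<close> by blast
  moreover have "ideal_set I" unfolding I by (rule ideal_set_genideal)
  ultimately show ?thesis using ideal_set_mult by metis
qed

text \<open>A monomial in a prime ideal has a variable in it, so the ideal is generated by the variables that
  it contains.\<close>

lemma monomial_prime_eq_face:
  fixes P :: "('n::finite, 'k::field) mpoly set"
  assumes mono: "monomial_ideal P" and prime: "primeideal P mpoly_ring"
  shows "P = sr_ideal {{a. variable a \<notin> P}}"
proof
  have id: "ideal_set P" and P: "P \<noteq> UNIV" "\<And>a b. a * b \<in> P \<Longrightarrow> a \<in> P \<or> b \<in> P"
    using prime by (auto simp: primeideal_mpoly_ring_iff)
  have one: "1 \<notin> P" using P(1) ideal_set_mult[OF id, of 1] by auto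
  have *: "\<exists>a\<in>Poly_Mapping.keys e. variable a \<in> P" if "power_product e \<in> P" for e
    using that
  proof (induction "deg e" arbitrary: e rule: less_induct)
    case less
    show ?case
    proof (cases "e = 0")
      case True then show ?thesis using less.prems one by (simp add: power_product_def)
    next
      case False
      then obtain a where a: "Poly_Mapping.lookup e a \<noteq> 0" by (metis poly_mapping_eqI lookup_zero)
      then obtain v where v: "e = Poly_Mapping.single a 1 + v" using exponent_minus[OF a] by blast
      have "power_product e = variable a * (power_product v :: ('n, 'k) mpoly)"
        by (simp add: v variable_def power_product_def mult_single)
      then have "variable a \<in> P \<or> power_product v \<in> P" using P(2) less.prems by simp
      then show ?thesis
      proof
        assume "variable a \<in> P"
        then show ?thesis using a by (auto simp: in_keys_iff)
      next
        assume "power_product v \<in> P"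
        moreover have "deg v < deg e" using deg_indicator_exp[of "{a}"] by (simp add: v deg_add indicator_exp_def)
        ultimately have "\<exists>a\<in>Poly_Mapping.keys v. variable a \<in> P" by (intro less.hyps)
        then show ?thesis unfolding v keys_add_nat by blast
      qed
    qed
  qed
  show "P \<subseteq> sr_ideal {{a. variable a \<notin> P}}"
  proof
    fix p assume "p \<in> P"
    then show "p \<in> sr_ideal {{a. variable a \<notin> P}}"
      using *[OF monomial_ideal_terms[OF mono]] unfolding sr_ideal_def by blast
  qed
  show "sr_ideal {{a. variable a \<notin> P}} \<subseteq> P"
  proof
    fix p :: "('n, 'k) mpoly" assume "p \<in> sr_ideal {{a. variable a \<notin> P}}"
    then obtain g where "p = (\<Sum>a\<in>- {a. variable a \<notin> P}. g a * variable a)" using sr_ideal_variables by blast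
    also have "\<dots> \<in> P" using id by (intro ideal_set_sum ideal_set_mult) auto
    finally show "p \<in> P" .
  qed
qed

section \<open>Krull dimension of face rings\<close>

text \<open>Gaussian elimination: an equation that involves \<open>u0\<close> is solved for \<open>u0\<close> and substituted in the others.\<close>

lemma underdetermined_system:
  fixes A :: "'e \<Rightarrow> 'u \<Rightarrow> 'k::field"
  assumes "finite E" "finite U" "card E < card U"
  shows "\<exists>c. (\<exists>u\<in>U. c u \<noteq> 0) \<and> (\<forall>e\<in>E. (\<Sum>u\<in>U. A e u * c u) = 0)"
  using assms
proof (induction E arbitrary: U A rule: finite_induct)
  case empty
  then have "U \<noteq> {}" by auto
  then show ?case by (intro exI[of _ "\<lambda>_. 1"]) auto
next
  case (insert e E)
  show ?case
  proof (cases "\<exists>u\<in>U. A e u \<noteq> 0")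
    case False
    have "card E < card U" using insert by simp
    from insert.IH[OF insert.prems(1) this, of A] False show ?thesis by auto
  next
    case True
    then obtain u0 where u0: "u0 \<in> U" "A e u0 \<noteq> 0" by blast
    define U' where "U' = U - {u0}"
    have U': "finite U'" "card E < card U'" "u0 \<notin> U'" "U = insert u0 U'"
      using insert.prems insert.hyps u0 by (auto simp: U'_def)
    obtain c where c: "\<exists>u\<in>U'. c u \<noteq> 0"
      "\<And>e'. e' \<in> E \<Longrightarrow> (\<Sum>u\<in>U'. (A e' u - A e' u0 * (A e u / A e u0)) * c u) = 0"
      using insert.IH[OF U'(1,2), of "\<lambda>e' u. A e' u - A e' u0 * (A e u / A e u0)"] by blast
    define t where "t = - (\<Sum>u\<in>U'. A e u / A e u0 * c u)"
    define c' where "c' = c(u0 := t)"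
    have split: "(\<Sum>u\<in>U. A e' u * c' u) = A e' u0 * t + (\<Sum>u\<in>U'. A e' u * c u)" for e'
    proof -
      have "(\<Sum>u\<in>U'. A e' u * c' u) = (\<Sum>u\<in>U'. A e' u * c u)"
        using U'(3) by (intro sum.cong) (auto simp: c'_def)
      then show ?thesis using U' by (simp add: c'_def)
    qed
    have "(\<Sum>u\<in>U. A e' u * c' u) = 0" if e': "e' \<in> insert e E" for e'
    proof (cases "e' = e")
      case True
      have "A e u0 * t = - (\<Sum>u\<in>U'. A e u * c u)"
        using u0(2) by (simp add: t_def sum_distrib_left field_simps)
      then show ?thesis using split[of e] True by simp
    next
      case False
      then have "(\<Sum>u\<in>U'. (A e' u - A e' u0 * (A e u / A e u0)) * c u) = 0" using c(2) e' by simp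
      then have "(\<Sum>u\<in>U'. A e' u * c u) - A e' u0 * (\<Sum>u\<in>U'. A e u / A e u0 * c u) = 0"
        by (simp add: algebra_simps sum_subtractf sum_distrib_left)
      then show ?thesis using split[of e'] by (simp add: t_def)
    qed
    moreover have "\<exists>u\<in>U. c' u \<noteq> 0" using c(1) U' by (auto simp: c'_def)
    ultimately show ?thesis by blast
  qed
qed

definition exponents_le :: "nat \<Rightarrow> ('n::finite, 'k::field) mpoly \<Rightarrow> bool" where
  "exponents_le d p \<longleftrightarrow> (\<forall>e\<in>monomials p. \<forall>a. Poly_Mapping.lookup e a \<le> d)"

lemma exponents_le_mult:
  assumes "exponents_le d p" "exponents_le d' q"
  shows "exponents_le (d + d') (p * q)"
  unfolding exponents_le_def
proof (intro ballI allI)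
  fix e a assume "e \<in> monomials (p * q)"
  then obtain u v where uv: "e = u + v" "u \<in> monomials p" "v \<in> monomials q"
    using monomials_mult_subset[of p q] by auto
  have "Poly_Mapping.lookup u a \<le> d" "Poly_Mapping.lookup v a \<le> d'"
    using assms uv(2,3) by (auto simp: exponents_le_def)
  then show "Poly_Mapping.lookup e a \<le> d + d'" by (simp add: uv(1) lookup_add)
qed

lemma exponents_le_one: "exponents_le 0 1"
  by (simp add: exponents_le_def)

lemma exponents_le_mono: "exponents_le d p \<Longrightarrow> d \<le> d' \<Longrightarrow> exponents_le d' p"
  unfolding exponents_le_def using order_trans by blast

lemma exponents_le_power: "exponents_le d p \<Longrightarrow> exponents_le (k * d) (p ^ k)"
  by (induction k) (auto simp: exponents_le_one intro: exponents_le_mult)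

lemma exponents_le_prod:
  assumes "finite A" "\<And>i. i \<in> A \<Longrightarrow> exponents_le (d i) (p i)"
  shows "exponents_le (\<Sum>i\<in>A. d i) (\<Prod>i\<in>A. p i)"
  using assms by (induction A rule: finite_induct) (auto simp: exponents_le_one intro: exponents_le_mult)

lemma exponents_le_exists: "\<exists>d. exponents_le d p"
proof -
  have "Poly_Mapping.lookup e a \<le> (\<Sum>e\<in>monomials p. deg e)" if "e \<in> monomials p" for e a
  proof -
    have "Poly_Mapping.lookup e a \<le> deg e" unfolding deg_def by (intro member_le_sum) auto
    also have "\<dots> \<le> (\<Sum>e\<in>monomials p. deg e)" using that by (intro member_le_sum) auto
    finally show ?thesis .
  qed
  then show ?thesis unfolding exponents_le_def by blast
qed

lemma card_bounded_exponents:
  fixes F :: "'n::finite set" and D :: nat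
  defines "M \<equiv> {e :: 'n \<Rightarrow>\<^sub>0 nat. Poly_Mapping.keys e \<subseteq> F \<and> (\<forall>a. Poly_Mapping.lookup e a \<le> D)}"
  shows "finite M" "card M \<le> Suc D ^ card F"
proof -
  let ?P = "PiE F (\<lambda>_. {..D})"
  let ?r = "\<lambda>e. restrict (Poly_Mapping.lookup e) F"
  have "inj_on ?r M"
  proof (rule inj_onI)
    fix e e' assume e: "e \<in> M" "e' \<in> M" "?r e = ?r e'"
    show "e = e'"
    proof (rule poly_mapping_eqI)
      fix a
      show "Poly_Mapping.lookup e a = Poly_Mapping.lookup e' a"
      proof (cases "a \<in> F")
        case True then show ?thesis using fun_cong[OF e(3), of a] by simp
      next
        case False then show ?thesis using e(1,2) unfolding M_def
          by (metis (no_types, lifting) in_keys_iff mem_Collect_eq subsetD)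
      qed
    qed
  qed
  moreover have "?r ` M \<subseteq> ?P" by (auto simp: M_def)
  moreover have "finite ?P" by (intro finite_PiE) auto
  ultimately show "finite M" "card M \<le> Suc D ^ card F"
    using inj_on_finite[of ?r M ?P] card_inj_on_le[of ?r M ?P] by (auto simp: card_PiE)
qed

text \<open>By counting. With \<open>w = card F\<close> there are \<open>(N + 1)\<^bsup>w+1\<^esup>\<close> products of powers up to \<open>N\<close>, while the monomials on \<open>F\<close> that can occur in them number
  at most \<open>(N m + 1)\<^bsup>w\<^esup>\<close> with \<open>m\<close> independent of \<open>N\<close>. For large \<open>N\<close> a linear relation exists. The
  relation is returned as a set \<open>T\<close> of exponents with nonzero coefficients \<open>c\<close>.\<close>

lemma algebraic_dependence:
  fixes y :: "nat \<Rightarrow> ('n::finite, 'k::field) mpoly" and F :: "'n set"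
  shows "\<exists>T c. finite T \<and> T \<noteq> {} \<and> (\<forall>\<alpha>\<in>T. c \<alpha> \<noteq> 0) \<and> (\<forall>\<alpha>\<in>T. \<forall>i. i \<notin> {0..card F} \<longrightarrow> \<alpha> i = (0::nat)) \<and>
    (\<Sum>\<alpha>\<in>T. Poly_Mapping.single 0 (c \<alpha>) * (\<Prod>i=0..card F. y i ^ \<alpha> i)) \<in> sr_ideal {F}"
proof -
  let ?w = "card F"
  have "\<forall>i. \<exists>d. exponents_le d (y i)" using exponents_le_exists by blast
  then obtain d where d: "\<And>i. exponents_le (d i) (y i)" by metis
  define m where "m = (\<Sum>i=0..?w. d i)"
  \<comment> \<open>This \<open>N\<close> gives \<open>(N m + 1)\<^bsup>w\<^esup> \<le> (m + 1)\<^bsup>w\<^esup> (N + 1)\<^bsup>w\<^esup> = N (N + 1)\<^bsup>w\<^esup> < (N + 1)\<^bsup>w+1\<^esup>\<close>.\<close>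
  define N where "N = Suc m ^ ?w"
  let ?Y = "\<lambda>\<alpha>. \<Prod>i=0..?w. y i ^ \<alpha> i"
  let ?E = "{e :: 'n \<Rightarrow>\<^sub>0 nat. Poly_Mapping.keys e \<subseteq> F \<and> (\<forall>a. Poly_Mapping.lookup e a \<le> N * m)}"
  define U where "U = {\<alpha> :: nat \<Rightarrow> nat. (\<forall>i\<in>{0..?w}. \<alpha> i \<in> {..N}) \<and> (\<forall>i. i \<notin> {0..?w} \<longrightarrow> \<alpha> i = 0)}"
  have U: "finite U" "card U = Suc N ^ Suc ?w"
  proof -
    have bij: "bij_betw (\<lambda>\<alpha> i. if i \<in> {0..?w} then \<alpha> i else 0) (PiE {0..?w} (\<lambda>_. {..N})) U"
      by (rule bij_betw_byWitness[where f' = "\<lambda>\<alpha>. restrict \<alpha> {0..?w}"])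
         (auto simp: U_def PiE_def extensional_def fun_eq_iff)
    have "finite (PiE {0..?w} (\<lambda>_. {..N}))" by (intro finite_PiE) simp_all
    then show "finite U" using bij_betw_finite[OF bij] by simp
    have "card (PiE {0..?w} (\<lambda>_. {..N})) = Suc N ^ Suc ?w" by (simp add: card_PiE)
    then show "card U = Suc N ^ Suc ?w" using bij_betw_same_card[OF bij] by simp
  qed
  have "card ?E \<le> Suc (N * m) ^ ?w" by (rule card_bounded_exponents)
  also have "\<dots> \<le> (Suc m * Suc N) ^ ?w" by (intro power_mono) auto
  also have "\<dots> = N * Suc N ^ ?w" by (simp only: power_mult_distrib N_def)
  also have "\<dots> < Suc N ^ Suc ?w" by simp
  finally have lt: "card ?E < card U" by (simp only: U)
  have "\<exists>c. (\<exists>u\<in>U. c u \<noteq> 0) \<and> (\<forall>e\<in>?E. (\<Sum>u\<in>U. coef (?Y u) e * c u) = 0)"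
    by (rule underdetermined_system[OF card_bounded_exponents(1) U(1) lt])
  then obtain c where c: "\<exists>u\<in>U. c u \<noteq> 0" "\<And>e. e \<in> ?E \<Longrightarrow> (\<Sum>u\<in>U. coef (?Y u) e * c u) = 0" by blast
  define T where "T = {u \<in> U. c u \<noteq> 0}"
  let ?p = "\<Sum>\<alpha>\<in>T. Poly_Mapping.single 0 (c \<alpha>) * ?Y \<alpha>"
  have Y: "exponents_le (N * m) (?Y u)" if "u \<in> U" for u
  proof -
    have "exponents_le (\<Sum>i=0..?w. u i * d i) (?Y u)"
      by (intro exponents_le_prod exponents_le_power d) simp
    moreover have "(\<Sum>i=0..?w. u i * d i) \<le> N * m" unfolding m_def sum_distrib_left
      using that by (intro sum_mono mult_right_mono) (auto simp: U_def)
    ultimately show ?thesis by (rule exponents_le_mono)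
  qed
  have cp: "coef ?p e = (\<Sum>u\<in>U. coef (?Y u) e * c u)" for e
  proof -
    have "coef ?p e = (\<Sum>u\<in>T. coef (?Y u) e * c u)"
    proof -
      have "coef (Poly_Mapping.single 0 a * p) e = coef p e * a" for a :: 'k and p :: "('n, 'k) mpoly"
        using coef_single_mult[of 0 a p e] by (simp add: mult.commute)
      then show ?thesis by (simp add: lookup_sum)
    qed
    also have "\<dots> = (\<Sum>u\<in>U. coef (?Y u) e * c u)"
      using U(1) by (intro sum.mono_neutral_left) (auto simp: T_def)
    finally show ?thesis .
  qed
  have "?p \<in> sr_ideal {F}" unfolding sr_ideal_def
  proof (intro CollectI ballI notI)
    fix e G assume e: "e \<in> monomials ?p" and "G \<in> {F}" "Poly_Mapping.keys e \<subseteq> G"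
    then have keys: "Poly_Mapping.keys e \<subseteq> F" by simp
    have nz: "(\<Sum>u\<in>U. coef (?Y u) e * c u) \<noteq> 0" using e unfolding in_keys_iff cp .
    then obtain u where u: "u \<in> U" "coef (?Y u) e * c u \<noteq> 0" by (rule sum.not_neutral_contains_not_neutral)
    then have "e \<in> monomials (?Y u)" by (simp add: in_keys_iff)
    then have "e \<in> ?E" using Y[OF u(1)] keys by (simp add: exponents_le_def)
    then show False using c(2) nz by blast
  qed
  moreover have "finite T" "T \<noteq> {}" using U(1) c(1) by (auto simp: T_def)
  moreover have "\<forall>\<alpha>\<in>T. c \<alpha> \<noteq> 0" "\<forall>\<alpha>\<in>T. \<forall>i. i \<notin> {0..?w} \<longrightarrow> \<alpha> i = 0" by (auto simp: T_def U_def)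
  ultimately show ?thesis by blast
qed

text \<open>Choose \<open>y\<^sub>i\<close> in \<open>C\<^bsub>i+1\<^esub>\<close> but not in \<open>C\<^sub>i\<close>. In an algebraic relation among \<open>y\<^sub>k, \<dots>, y\<^sub>w\<close> modulo \<open>C\<^sub>k\<close> the largest common
  power of \<open>y\<^sub>k\<close> can be cancelled since \<open>C\<^sub>k\<close> is prime; the terms then still divisible by \<open>y\<^sub>k\<close> lie in
  \<open>C\<^bsub>k+1\<^esub>\<close>, and a nontrivial relation among \<open>y\<^bsub>k+1\<^esub>, \<dots>, y\<^sub>w\<close> modulo \<open>C\<^bsub>k+1\<^esub>\<close> remains. At the end a nonzero
  constant lies in a prime ideal. The argument is close to the elementary characterization of Krull
  dimension by Coquand and Lombardi.\<close>

lemma prime_chain_length_le: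
  fixes C :: "nat \<Rightarrow> ('n::finite, 'k::field) mpoly set"
  assumes chain: "prime_chain mpoly_ring l C" and C0: "sr_ideal {F} \<subseteq> C 0"
  shows "l \<le> card F"
proof (rule ccontr)
  assume "\<not> l \<le> card F"
  then have l: "card F < l" by simp
  let ?w = "card F"
  have id: "ideal_set (C i)" and C1: "C i \<noteq> UNIV" and pr: "\<And>a b. a * b \<in> C i \<Longrightarrow> a \<in> C i \<or> b \<in> C i" if "i \<le> l" for i
    using chain that by (auto simp: prime_chain_def primeideal_mpoly_ring_iff)
  have sub: "C i \<subset> C (Suc i)" if "i < l" for i using chain that by (auto simp: prime_chain_def)
  then have "\<exists>y. y \<in> C (Suc i) \<and> y \<notin> C i" if "i < l" for i using that by blast
  then obtain y where y: "\<And>i. i < l \<Longrightarrow> y i \<in> C (Suc i) \<and> y i \<notin> C i" by metis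
  \<comment> \<open>Exponents vanish outside \<open>{k..w}\<close>, so different members of \<open>T\<close> are different monomials in
    \<open>y\<^sub>k, \<dots>, y\<^sub>w\<close>.\<close>
  define Rel where "Rel = (\<lambda>k. \<exists>T c. finite T \<and> T \<noteq> {} \<and> (\<forall>\<alpha>\<in>T. c \<alpha> \<noteq> (0::'k)) \<and>
    (\<forall>\<alpha>\<in>T. \<forall>i. i \<notin> {k..?w} \<longrightarrow> \<alpha> i = (0::nat)) \<and>
    (\<Sum>\<alpha>\<in>T. Poly_Mapping.single 0 (c \<alpha>) * (\<Prod>i=k..?w. y i ^ \<alpha> i)) \<in> C k)"
  have "Rel k" if "k \<le> Suc ?w" for k
    using that
  proof (induction k)
    case 0
    show ?case using algebraic_dependence[of F y] C0 unfolding Rel_def by blast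
  next
    case (Suc k)
    then have k: "k \<le> ?w" "k < l" using l by auto
    obtain T c where T: "finite T" "T \<noteq> {}" "\<And>\<alpha>. \<alpha> \<in> T \<Longrightarrow> c \<alpha> \<noteq> 0"
      "\<And>\<alpha> i. \<alpha> \<in> T \<Longrightarrow> i \<notin> {k..?w} \<Longrightarrow> \<alpha> i = 0"
      and inC: "(\<Sum>\<alpha>\<in>T. Poly_Mapping.single 0 (c \<alpha>) * (\<Prod>i=k..?w. y i ^ \<alpha> i)) \<in> C k"
      using Suc.IH[OF Suc_leD[OF Suc.prems]] unfolding Rel_def by blast
    define m where "m = Min ((\<lambda>\<alpha>. \<alpha> k) ` T)"
    have m_le: "m \<le> \<alpha> k" if "\<alpha> \<in> T" for \<alpha> using that T(1) by (simp add: m_def)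
    have "m \<in> (\<lambda>\<alpha>. \<alpha> k) ` T" unfolding m_def using T(1,2) by (intro Min_in) auto
    then obtain \<alpha>0 where \<alpha>0: "\<alpha>0 \<in> T" "\<alpha>0 k = m" by auto
    define T0 where "T0 = {\<alpha> \<in> T. \<alpha> k = m}"
    let ?Z = "\<lambda>\<alpha>. \<Prod>i=Suc k..?w. y i ^ \<alpha> i"
    let ?g = "\<lambda>\<alpha>. Poly_Mapping.single 0 (c \<alpha>) * (y k ^ (\<alpha> k - m) * ?Z \<alpha>)"
    have "(\<Sum>\<alpha>\<in>T. Poly_Mapping.single 0 (c \<alpha>) * (\<Prod>i=k..?w. y i ^ \<alpha> i)) = (\<Sum>\<alpha>\<in>T. y k ^ m * ?g \<alpha>)"
    proof (rule sum.cong[OF refl])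
      fix \<alpha> assume "\<alpha> \<in> T"
      then have "y k ^ \<alpha> k = y k ^ m * y k ^ (\<alpha> k - m)" using m_le by (simp flip: power_add)
      then show "Poly_Mapping.single 0 (c \<alpha>) * (\<Prod>i=k..?w. y i ^ \<alpha> i) = y k ^ m * ?g \<alpha>"
        using k(1) by (simp add: prod.atLeast_Suc_atMost mult.assoc mult.left_commute)
    qed
    then have "y k ^ m * (\<Sum>\<alpha>\<in>T. ?g \<alpha>) \<in> C k" using inC by (simp add: sum_distrib_left)
    moreover have "z \<in> C k" if "y k ^ j * z \<in> C k" for j z
      using that
    proof (induction j)
      case (Suc j)
      then have "y k * (y k ^ j * z) \<in> C k" by (simp add: mult.assoc)
      then have "y k ^ j * z \<in> C k" using pr[of k] y[OF k(2)] k(2) by (meson less_imp_le)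
      then show ?case by (rule Suc.IH)
    qed simp
    ultimately have "(\<Sum>\<alpha>\<in>T. ?g \<alpha>) \<in> C k" by blast
    then have 1: "(\<Sum>\<alpha>\<in>T. ?g \<alpha>) \<in> C (Suc k)" using sub[OF k(2)] by blast
    have idS: "ideal_set (C (Suc k))" using id k(2) by simp
    have 2: "(\<Sum>\<alpha>\<in>T - T0. ?g \<alpha>) \<in> C (Suc k)"
    proof (rule ideal_set_sum[OF idS])
      fix \<alpha> assume \<alpha>: "\<alpha> \<in> T - T0"
      then have "m < \<alpha> k" using m_le[of \<alpha>] by (auto simp: T0_def)
      then obtain j where "\<alpha> k - m = Suc j" by (metis Suc_diff_Suc)
      then have "?g \<alpha> = (Poly_Mapping.single 0 (c \<alpha>) * (y k ^ j * ?Z \<alpha>)) * y k"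
        by (simp add: algebra_simps)
      moreover have "y k \<in> C (Suc k)" using y[OF k(2)] by blast
      ultimately show "?g \<alpha> \<in> C (Suc k)" by (simp only: ideal_set_mult[OF idS])
    qed
    have "(\<Sum>\<alpha>\<in>T. ?g \<alpha>) = (\<Sum>\<alpha>\<in>T - T0. ?g \<alpha>) + (\<Sum>\<alpha>\<in>T0. ?g \<alpha>)"
      using T(1) by (intro sum.subset_diff) (auto simp: T0_def)
    then have "(\<Sum>\<alpha>\<in>T0. ?g \<alpha>) \<in> C (Suc k)" using ideal_set_diff[OF idS 1 2] by simp
    also have "(\<Sum>\<alpha>\<in>T0. ?g \<alpha>) = (\<Sum>\<beta>\<in>(\<lambda>\<alpha>. \<alpha>(k := 0)) ` T0. Poly_Mapping.single 0 (c (\<beta>(k := m))) * ?Z \<beta>)"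
    proof -
      have "inj_on (\<lambda>\<alpha>. \<alpha>(k := 0)) T0"
      proof (rule inj_onI)
        fix \<alpha> \<beta> assume "\<alpha> \<in> T0" "\<beta> \<in> T0" "\<alpha>(k := 0) = \<beta>(k := 0)"
        then show "\<alpha> = \<beta>" unfolding T0_def by (metis (mono_tags, lifting) fun_upd_triv fun_upd_upd mem_Collect_eq)
      qed
      moreover have "?g \<alpha> = Poly_Mapping.single 0 (c ((\<alpha>(k := 0))(k := m))) * ?Z (\<alpha>(k := 0))" if "\<alpha> \<in> T0" for \<alpha>
      proof -
        have "(\<alpha>(k := 0))(k := m) = \<alpha>" using that by (auto simp: T0_def fun_eq_iff)
        moreover have "?Z (\<alpha>(k := 0)) = ?Z \<alpha>" by (intro prod.cong) auto
        moreover have "\<alpha> k - m = 0" using that by (simp add: T0_def)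
        ultimately show ?thesis by simp
      qed
      ultimately show ?thesis by (subst sum.reindex) (auto intro!: sum.cong)
    qed
    finally have "(\<Sum>\<beta>\<in>(\<lambda>\<alpha>. \<alpha>(k := 0)) ` T0. Poly_Mapping.single 0 (c (\<beta>(k := m))) * ?Z \<beta>) \<in> C (Suc k)" .
    moreover have "finite ((\<lambda>\<alpha>. \<alpha>(k := 0)) ` T0)" "(\<lambda>\<alpha>. \<alpha>(k := 0)) ` T0 \<noteq> {}"
      using T(1) \<alpha>0 by (auto simp: T0_def)
    moreover have "\<forall>\<beta>\<in>(\<lambda>\<alpha>. \<alpha>(k := 0)) ` T0. c (\<beta>(k := m)) \<noteq> 0"
    proof
      fix \<beta> assume "\<beta> \<in> (\<lambda>\<alpha>. \<alpha>(k := 0)) ` T0"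
      then obtain \<alpha> where "\<alpha> \<in> T0" "\<beta> = \<alpha>(k := 0)" by auto
      then have "\<beta>(k := m) = \<alpha>" "\<alpha> \<in> T" by (auto simp: T0_def fun_eq_iff)
      then show "c (\<beta>(k := m)) \<noteq> 0" using T(3) by simp
    qed
    moreover have "\<forall>\<beta>\<in>(\<lambda>\<alpha>. \<alpha>(k := 0)) ` T0. \<forall>i. i \<notin> {Suc k..?w} \<longrightarrow> \<beta> i = 0"
      using T(4) by (auto simp: T0_def)
    ultimately show ?case unfolding Rel_def
      by (intro exI[of _ "(\<lambda>\<alpha>. \<alpha>(k := 0)) ` T0"] exI[of _ "\<lambda>\<beta>. c (\<beta>(k := m))"]) simp
  qed
  then have "Rel (Suc ?w)" by simp
  then obtain T c where T: "finite T" "T \<noteq> {}" "\<And>\<alpha>. \<alpha> \<in> T \<Longrightarrow> c \<alpha> \<noteq> (0::'k)"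
      and Ti: "\<And>\<alpha> i. \<alpha> \<in> T \<Longrightarrow> i \<notin> {Suc ?w..?w} \<Longrightarrow> \<alpha> i = (0::nat)"
      and inC': "(\<Sum>\<alpha>\<in>T. Poly_Mapping.single 0 (c \<alpha>) * (\<Prod>i=Suc ?w..?w. y i ^ \<alpha> i)) \<in> C (Suc ?w)"
    unfolding Rel_def by blast
  from inC' have inC: "(\<Sum>\<alpha>\<in>T. Poly_Mapping.single 0 (c \<alpha>)) \<in> C (Suc ?w)" by simp
  have "T = {\<lambda>_. 0}"
  proof -
    have "\<alpha> = (\<lambda>_. 0)" if "\<alpha> \<in> T" for \<alpha> using Ti[OF that] by (intro ext) simp
    then show ?thesis using T(2) by blast
  qed
  then have "Poly_Mapping.single 0 (c (\<lambda>_. 0)) \<in> C (Suc ?w)" "c (\<lambda>_. 0) \<noteq> 0" using inC T(3) by auto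
  moreover have "Poly_Mapping.single 0 (inverse (c (\<lambda>_. 0))) * Poly_Mapping.single 0 (c (\<lambda>_. 0)) = (1 :: ('n, 'k) mpoly)"
    using calculation(2) by (simp add: mult_single)
  ultimately have "1 \<in> C (Suc ?w)" using ideal_set_mult[OF id] l by (metis Suc_leI)
  then have "x \<in> C (Suc ?w)" for x using ideal_set_mult[OF id, of "Suc ?w" 1 x] l by simp
  then show False using C1[of "Suc ?w"] l by auto
qed

text \<open>Drop the vertices of \<open>F\<close> one at a time.\<close>

lemma prime_chain_exists:
  fixes F :: "'n::finite set"
  shows "\<exists>C. prime_chain mpoly_ring (card F) C \<and> (\<forall>i. sr_ideal {F} \<subseteq> (C i :: ('n, 'k::field) mpoly set)) \<and>
    C (card F) = sr_ideal {{}}"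
proof -
  obtain xs where xs: "set xs = F" "distinct xs" using finite_distinct_list[of F] by auto
  then have len: "length xs = card F" using distinct_card by metis
  define C where "C = (\<lambda>i. sr_ideal {set (drop i xs)} :: ('n, 'k) mpoly set)"
  have "C i \<subset> C (Suc i)" if "i < card F" for i
  proof -
    have "drop i xs = xs ! i # drop (Suc i) xs" using that len by (simp add: Cons_nth_drop_Suc)
    moreover have "distinct (drop i xs)" using xs by simp
    ultimately have "set (drop (Suc i) xs) \<subset> set (drop i xs)" by auto
    then show ?thesis unfolding C_def psubset_eq sr_ideal_face_subset_iff sr_ideal_face_inject by blast
  qed
  then have "prime_chain mpoly_ring (card F) C"
    by (simp add: prime_chain_def C_def primeideal_face)
  moreover have "sr_ideal {F} \<subseteq> C i" for i
    unfolding C_def sr_ideal_face_subset_iff using xs set_drop_subset by metis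
  moreover have "C (card F) = sr_ideal {{}}" using len by (simp add: C_def)
  ultimately show ?thesis by blast
qed

text \<open>The ideal of the variables is the only prime ideal above itself, so its height is the length of the
  longest chain ending there.\<close>

lemma ideal_height_irrelevant:
  "ideal_height mpoly_ring (sr_ideal {{}} :: ('n::finite, 'k::field) mpoly set) = enat (card (UNIV :: 'n set))"
proof -
  have "P = sr_ideal {{}}" if P: "primeideal P mpoly_ring" "sr_ideal {{}} \<subseteq> P" for P :: "('n, 'k) mpoly set"
  proof
    have id: "ideal_set P" and "P \<noteq> UNIV" using P(1) by (auto simp: primeideal_mpoly_ring_iff)
    have one: "1 \<notin> P" using \<open>P \<noteq> UNIV\<close> ideal_set_mult[OF id, of 1] by auto
    show "P \<subseteq> sr_ideal {{}}"
    proof (rule ccontr)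
      assume "\<not> P \<subseteq> sr_ideal {{}}"
      then obtain p where p: "p \<in> P" "p \<notin> sr_ideal {{}}" by blast
      then have c: "coef p 0 \<noteq> 0" by (auto simp: sr_ideal_def in_keys_iff)
      have "p - Poly_Mapping.single 0 (coef p 0) \<in> sr_ideal {{}}"
        by (auto simp: sr_ideal_def in_keys_iff lookup_minus)
      then have "p - (p - Poly_Mapping.single 0 (coef p 0)) \<in> P"
        by (intro ideal_set_diff[OF id p(1)] subsetD[OF P(2)])
      then have "Poly_Mapping.single 0 (coef p 0) \<in> P" by simp
      then have "Poly_Mapping.single 0 (inverse (coef p 0)) * Poly_Mapping.single 0 (coef p 0) \<in> P"
        by (rule ideal_set_mult[OF id])
      then show False using one c by (simp add: mult_single)
    qed
  qed (use that in blast)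
  then have "{prime_height mpoly_ring P | P. primeideal P mpoly_ring \<and> (sr_ideal {{}} :: ('n, 'k) mpoly set) \<subseteq> P} =
      {prime_height mpoly_ring (sr_ideal {{}} :: ('n, 'k) mpoly set)}"
    using primeideal_face[of "{}"] by blast
  then have "ideal_height mpoly_ring (sr_ideal {{}} :: ('n, 'k) mpoly set) = prime_height mpoly_ring (sr_ideal {{}} :: ('n, 'k) mpoly set)"
    by (simp add: ideal_height_def)
  also have "\<dots> = enat (card (UNIV :: 'n set))" unfolding prime_height_def
  proof (rule antisym)
    have "l \<le> card (UNIV :: 'n set)" if "prime_chain mpoly_ring l C" for l and C :: "nat \<Rightarrow> ('n, 'k) mpoly set"
    proof (rule prime_chain_length_le[OF that])
      have "ideal_set (C 0)" using that by (auto simp: prime_chain_def primeideal_mpoly_ring_iff)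
      then show "sr_ideal {UNIV} \<subseteq> C 0" by (simp add: sr_ideal_UNIV ideal_set_zero)
    qed
    then show "Sup {enat l | l. \<exists>C. prime_chain mpoly_ring l C \<and> C l = (sr_ideal {{}} :: ('n, 'k) mpoly set)} \<le> enat (card (UNIV :: 'n set))"
      by (intro Sup_least) auto
    show "enat (card (UNIV :: 'n set)) \<le> Sup {enat l | l. \<exists>C. prime_chain mpoly_ring l C \<and> C l = (sr_ideal {{}} :: ('n, 'k) mpoly set)}"
      using prime_chain_exists[of "UNIV :: 'n set", where 'k = 'k] by (intro Sup_upper) blast
  qed
  finally show ?thesis .
qed

text \<open>Prime chains correspond under preimage and image along the projection \<open>h\<close>.\<close>

lemma krull_dim_quotient:
  fixes J :: "('n::finite, 'k::field) mpoly set"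
  assumes J: "ideal_set J"
  shows "krull_dim (mpoly_ring Quot J) = Sup {enat l | l. \<exists>C. prime_chain mpoly_ring l C \<and> (\<forall>i\<le>l. J \<subseteq> C i)}"
proof -
  let ?R = "mpoly_ring :: ('n, 'k) mpoly ring"
  interpret R: cring ?R by (rule cring_mpoly_ring)
  interpret J: ideal J ?R using J by (simp add: ideal_mpoly_ring_iff)
  let ?h = "\<lambda>a. J +>\<^bsub>?R\<^esub> a"
  interpret h: ring_hom_ring ?R "?R Quot J" ?h by (rule J.rcos_ring_hom_ring)
  have h_eq: "?h a = {j + a | j. j \<in> J}" for a by (auto simp: a_r_coset_def r_coset_def)
  have carr: "carrier (?R Quot J) = range ?h" by (auto simp: FactRing_def A_RCOSETS_def RCOSETS_def a_r_coset_def)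
  have mult: "?h a \<otimes>\<^bsub>?R Quot J\<^esub> ?h b = ?h (a * b)" for a b using h.hom_mult[of a b] by simp
  have mem: "?h a \<in> ?h ` Q \<longleftrightarrow> a \<in> Q" if "ideal_set Q" "J \<subseteq> Q" for a Q
  proof
    assume "?h a \<in> ?h ` Q"
    then obtain b where b: "b \<in> Q" "?h a = ?h b" by auto
    have "a \<in> ?h a" using ideal_set_zero[OF J] by (auto simp: h_eq)
    then have "a \<in> {j + b | j. j \<in> J}" unfolding b(2) h_eq[of b] .
    then obtain j where "a = j + b" "j \<in> J" by blast
    then show "a \<in> Q" using that b(1) by (auto intro: ideal_set_add)
  qed auto
  have J_eq: "?h j = J" if "j \<in> J" for j
    using that J.a_rcos_const[of j] by simp
  have "(\<exists>D. prime_chain (?R Quot J) l D) \<longleftrightarrow> (\<exists>C. prime_chain ?R l C \<and> (\<forall>i\<le>l. J \<subseteq> C i))" for l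
  proof
    assume "\<exists>D. prime_chain (?R Quot J) l D"
    then obtain D where D: "\<And>i. i \<le> l \<Longrightarrow> primeideal (D i) (?R Quot J)" "\<And>i. i < l \<Longrightarrow> D i \<subset> D (Suc i)"
      by (auto simp: prime_chain_def)
    define C where "C = (\<lambda>i. {r. ?h r \<in> D i})"
    have "primeideal (C i) ?R" if "i \<le> l" for i
      using h.primeideal_vimage[OF R.is_cring D(1)[OF that]] by (simp add: C_def)
    moreover have "C i \<subset> C (Suc i)" if i: "i < l" for i
    proof -
      obtain x where x: "x \<in> D (Suc i)" "x \<notin> D i" using D(2)[OF i] by blast
      interpret Di: primeideal "D (Suc i)" "?R Quot J" using D(1)[of "Suc i"] i by simp
      obtain r where "x = ?h r" using Di.a_subset x(1) carr by blast
      then have "r \<in> C (Suc i)" "r \<notin> C i" using x by (auto simp: C_def)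
      moreover have "C i \<subseteq> C (Suc i)" using D(2)[OF i] by (auto simp: C_def)
      ultimately show ?thesis by blast
    qed
    moreover have "J \<subseteq> C i" if "i \<le> l" for i
    proof
      fix j assume "j \<in> J"
      interpret Di: primeideal "D i" "?R Quot J" using D(1)[OF that] .
      have "\<zero>\<^bsub>?R Quot J\<^esub> \<in> D i" by (rule additive_subgroup.zero_closed[OF Di.is_additive_subgroup])
      then show "j \<in> C i" using J_eq[OF \<open>j \<in> J\<close>] by (simp add: C_def FactRing_def)
    qed
    ultimately show "\<exists>C. prime_chain ?R l C \<and> (\<forall>i\<le>l. J \<subseteq> C i)"
      by (intro exI[of _ C]) (simp add: prime_chain_def)
  next
    assume "\<exists>C. prime_chain ?R l C \<and> (\<forall>i\<le>l. J \<subseteq> C i)"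
    then obtain C where C: "\<And>i. i \<le> l \<Longrightarrow> primeideal (C i) ?R" "\<And>i. i < l \<Longrightarrow> C i \<subset> C (Suc i)"
      "\<And>i. i \<le> l \<Longrightarrow> J \<subseteq> C i" by (auto simp: prime_chain_def)
    have id: "ideal_set (C i)" "C i \<noteq> UNIV" "\<And>a b. a * b \<in> C i \<Longrightarrow> a \<in> C i \<or> b \<in> C i" if "i \<le> l" for i
      using C(1)[OF that] by (auto simp: primeideal_mpoly_ring_iff)
    note mem' = mem[OF id(1) C(3)]
    have "primeideal (?h ` C i) (?R Quot J)" if i: "i \<le> l" for i
    proof (rule primeidealI)
      show "ideal (?h ` C i) (?R Quot J)"
        using R.ring_ideal_imp_quot_ideal[OF J.is_ideal] id(1)[OF that] by (simp add: ideal_mpoly_ring_iff)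
      show "cring (?R Quot J)" by (rule J.quotient_is_cring[OF R.is_cring])
      obtain r where "r \<notin> C i" using id(2)[OF i] by blast
      then have "?h r \<notin> ?h ` C i" by (simp only: mem'[OF i i] not_False_eq_True)
      moreover have "?h r \<in> carrier (?R Quot J)" unfolding carr by (rule rangeI)
      ultimately show "carrier (?R Quot J) \<noteq> ?h ` C i" by metis
      fix a b assume ab: "a \<in> carrier (?R Quot J)" "b \<in> carrier (?R Quot J)" "a \<otimes>\<^bsub>?R Quot J\<^esub> b \<in> ?h ` C i"
      then obtain x y where xy: "a = ?h x" "b = ?h y" unfolding carr by (elim rangeE)
      have "?h (x * y) \<in> ?h ` C i" using ab(3) unfolding xy mult .
      then have "x * y \<in> C i" by (simp only: mem'[OF i i])
      then have "x \<in> C i \<or> y \<in> C i" by (rule id(3)[OF i])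
      then show "a \<in> ?h ` C i \<or> b \<in> ?h ` C i" unfolding xy by (elim disjE) (simp_all only: imageI simp_thms)
    qed
    moreover have "?h ` C i \<subset> ?h ` C (Suc i)" if i: "i < l" for i
    proof -
      obtain r where "r \<in> C (Suc i)" "r \<notin> C i" using C(2)[OF i] by blast
      moreover have il: "i \<le> l" using i by simp
      ultimately have "?h r \<in> ?h ` C (Suc i)" "?h r \<notin> ?h ` C i"
        by (simp_all only: imageI mem'[OF il il] not_False_eq_True)
      moreover have "?h ` C i \<subseteq> ?h ` C (Suc i)" using C(2)[OF i] by (intro image_mono) blast
      ultimately show ?thesis by (metis psubsetI)
    qed
    ultimately show "\<exists>D. prime_chain (?R Quot J) l D"
      by (intro exI[of _ "\<lambda>i. ?h ` C i"]) (simp add: prime_chain_def)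
  qed
  then show ?thesis by (simp add: krull_dim_def)
qed

lemma krull_dim_face_ring:
  fixes F :: "'n::finite set"
  shows "krull_dim (mpoly_ring Quot (sr_ideal {F} :: ('n, 'k::field) mpoly set)) = enat (card F)"
  unfolding krull_dim_quotient[OF ideal_set_sr_ideal]
proof (rule antisym)
  have "l \<le> card F" if "prime_chain mpoly_ring l C" "\<forall>i\<le>l. sr_ideal {F} \<subseteq> C i" for l and C :: "nat \<Rightarrow> ('n, 'k) mpoly set"
    using prime_chain_length_le[OF that(1)] that(2) by blast
  then show "Sup {enat l | l. \<exists>C. prime_chain mpoly_ring l C \<and> (\<forall>i\<le>l. (sr_ideal {F} :: ('n, 'k) mpoly set) \<subseteq> C i)} \<le> enat (card F)"
    by (intro Sup_least) auto
  show "enat (card F) \<le> Sup {enat l | l. \<exists>C. prime_chain mpoly_ring l C \<and> (\<forall>i\<le>l. (sr_ideal {F} :: ('n, 'k) mpoly set) \<subseteq> C i)}"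
    using prime_chain_exists[of F, where 'k = 'k] by (intro Sup_upper) blast
qed

section \<open>Depth in terms of the associated graph\<close>

text \<open>The complement of the graph, as a symmetric relation on its vertices.\<close>

definition nonedge_relation :: "nat \<Rightarrow> nat set \<times> nat set set \<Rightarrow> (nat \<times> nat) set" where
  "nonedge_relation s G = {(i, j). i \<in> {1..s} \<and> j \<in> {1..s} \<and> i \<noteq> j \<and> {i, j} \<notin> snd G}"

lemma ideal_sum_faces:
  fixes P :: "'i \<Rightarrow> ('n::finite, 'k::field) mpoly set"
  assumes "\<And>i. i \<in> T \<Longrightarrow> P i = sr_ideal {F i}"
  shows "ideal_sum mpoly_ring (P ` T) = sr_ideal {\<Inter>(F ` T)}"
proof
  show "ideal_sum mpoly_ring (P ` T) \<subseteq> sr_ideal {\<Inter>(F ` T)}" unfolding ideal_sum_def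
  proof (rule genideal_subset[OF ideal_set_sr_ideal])
    have "P i \<subseteq> sr_ideal {\<Inter>(F ` T)}" if "i \<in> T" for i
      unfolding assms[OF that] sr_ideal_face_subset_iff using that by blast
    then show "\<Union>(P ` T) \<subseteq> sr_ideal {\<Inter>(F ` T)}" by blast
  qed
  show "sr_ideal {\<Inter>(F ` T)} \<subseteq> ideal_sum mpoly_ring (P ` T)"
  proof
    fix p :: "('n, 'k) mpoly" assume "p \<in> sr_ideal {\<Inter>(F ` T)}"
    then obtain g where p: "p = (\<Sum>a\<in>- \<Inter>(F ` T). g a * variable a)" using sr_ideal_variables by blast
    have "variable a \<in> genideal mpoly_ring (\<Union>(P ` T))" if a: "a \<in> - \<Inter>(F ` T)" for a
    proof -
      obtain i where i: "i \<in> T" "a \<notin> F i" using a by blast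
      then have "variable a \<in> P i" using assms by (simp add: variable_in_sr_ideal)
      then show ?thesis using i(1) by (intro subsetD[OF genideal_superset]) blast
    qed
    then show "p \<in> ideal_sum mpoly_ring (P ` T)" unfolding p ideal_sum_def
      by (intro ideal_set_sum ideal_set_mult ideal_set_genideal)
  qed
qed

text \<open>Let \<open>F i\<close> be the set of variables outside \<open>P i\<close>. As the ideal of the variables has height \<open>n\<close>, bigsize two
  means that the number \<open>t\<close> in its definition is three. So any three facets have empty intersection,
  and some two facets meet, which makes \<open>q_invariant\<close> finite. Two facets are disjoint exactly if
  their indices form an edge of the associated graph, and \<open>dim S / (P i + P j)\<close> is the size of
  \<open>F i \<inter> F j\<close>; hence \<open>grade_of_graph\<close> gives the value of the depth.\<close>

theorem depth_from_graph:
  fixes I :: "('n::finite, 'k::field) mpoly set" and P :: "nat \<Rightarrow> ('n, 'k) mpoly set"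
  assumes bij: "bij_betw P {1..s} (minimal_primes mpoly_ring I)"
    and mono: "\<forall>i\<in>{1..s}. monomial_ideal (P i)"
    and I: "I = (\<Inter>i\<in>{1..s}. P i)"
    and sum: "ideal_sum mpoly_ring (P ` {1..s}) = irrelevant_ideal"
    and big: "bigsize I = 2"
  shows "depth mpoly_ring irrelevant_ideal (ideal_module mpoly_ring I) = enat
    (if \<exists>i\<in>{1..s}. \<exists>j\<in>{1..s}. (i, j) \<notin> (nonedge_relation s (associated_graph s P))\<^sup>* then 2
     else if has_cycle (nonedge_relation s (associated_graph s P)) then 3
     else the_enat (q_invariant I) + 2)"
proof -
  let ?V = "{1..s}"
  define F where "F = (\<lambda>i. {a. variable a \<notin> P i})"
  have im: "P ` ?V = minimal_primes mpoly_ring I" and inj: "inj_on P ?V" using bij by (auto simp: bij_betw_def)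
  have prime: "primeideal (P i) mpoly_ring" "I \<subseteq> P i"
    and minimal: "\<And>Q. primeideal Q mpoly_ring \<Longrightarrow> I \<subseteq> Q \<Longrightarrow> Q \<subseteq> P i \<Longrightarrow> Q = P i" if "i \<in> ?V" for i
  proof -
    have "P i \<in> minimal_primes mpoly_ring I" using im that by blast
    then show "primeideal (P i) mpoly_ring" "I \<subseteq> P i"
      "\<And>Q. primeideal Q mpoly_ring \<Longrightarrow> I \<subseteq> Q \<Longrightarrow> Q \<subseteq> P i \<Longrightarrow> Q = P i"
      by (auto simp: minimal_primes_def)
  qed
  have PF: "P i = sr_ideal {F i}" if "i \<in> ?V" for i
    unfolding F_def using monomial_prime_eq_face prime(1)[OF that] mono that by blast
  have IF: "I = sr_ideal (F ` ?V)"
  proof -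
    have "(\<Inter>i\<in>T. sr_ideal {F i}) = (sr_ideal (F ` T) :: ('n, 'k) mpoly set)" for T
      by (auto simp: sr_ideal_def)
    then show ?thesis unfolding I using PF by simp
  qed
  have anti: "\<not> F i \<subseteq> F j" if ij: "i \<in> ?V" "j \<in> ?V" "i \<noteq> j" for i j
  proof
    assume "F i \<subseteq> F j"
    then have "P j \<subseteq> P i" using PF ij by (simp add: sr_ideal_face_subset_iff)
    then have "P j = P i" by (rule minimal[OF ij(1) prime(1)[OF ij(2)] prime(2)[OF ij(2)]])
    then show False using inj_onD[OF inj _ ij(2,1)] ij(3) by simp
  qed
  have add: "P i <+>\<^bsub>mpoly_ring\<^esub> P j = sr_ideal {F i \<inter> F j}" if "i \<in> ?V" "j \<in> ?V" for i j
  proof -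
    have "{A \<inter> B | A B. A \<in> {F i} \<and> B \<in> {F j}} = {F i \<inter> F j}" by auto
    then show ?thesis unfolding set_add_mpoly_ring PF[OF that(1)] PF[OF that(2)] ideal_plus_sr_ideal by simp
  qed
  have sums: "ideal_sum mpoly_ring (P ` T) = irrelevant_ideal \<longleftrightarrow> \<Inter>(F ` T) = {}" if "T \<subseteq> ?V" for T
  proof -
    have "ideal_sum mpoly_ring (P ` T) = sr_ideal {\<Inter>(F ` T)}" using PF that by (intro ideal_sum_faces) blast
    then show ?thesis by (simp only: irrelevant_ideal_eq sr_ideal_face_inject)
  qed
  \<comment> \<open>The property of \<open>e\<close> whose least solution is the number \<open>t\<close>. It holds for \<open>e = s + 1\<close> because there
    are only \<open>s\<close> minimal primes, so a least solution exists.\<close>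
  define Q where "Q = (\<lambda>e. e \<ge> 1 \<and> (\<forall>\<A> \<subseteq> minimal_primes mpoly_ring I. finite \<A> \<and> card \<A> = e \<longrightarrow>
     ideal_sum mpoly_ring \<A> = ideal_sum mpoly_ring (minimal_primes mpoly_ring I)))"
  have t: "bigsize_t I = (LEAST e. Q e)" by (simp add: bigsize_t_def Q_def)
  have "bigsize I = int (bigsize_t I) - 1"
    using sum unfolding bigsize_def im[symmetric] by (simp add: irrelevant_ideal_eq ideal_height_irrelevant)
  then have t3: "(LEAST e. Q e) = 3" using big t by simp
  have "Q (Suc s)" unfolding Q_def
  proof (intro conjI allI impI)
    fix \<A> assume "\<A> \<subseteq> minimal_primes mpoly_ring I" "finite \<A> \<and> card \<A> = Suc s"
    moreover have "card (minimal_primes mpoly_ring I) = s" using bij_betw_same_card[OF bij] by simp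
    moreover have "finite (minimal_primes mpoly_ring I)" unfolding im[symmetric] by simp
    ultimately have "Suc s \<le> s" using card_mono by metis
    then show "ideal_sum mpoly_ring \<A> = ideal_sum mpoly_ring (minimal_primes mpoly_ring I)" by simp
  qed simp
  then have "Q 3" using LeastI[of Q] t3 by metis
  have "\<not> Q 2" using not_less_Least[of 2 Q] t3 by simp
  have QT: "\<Inter>(F ` T) = {}" if "T \<subseteq> ?V" "card T = 3" for T
  proof -
    have "card (P ` T) = 3" using card_image[of P T] inj_on_subset[OF inj that(1)] that(2) by simp
    moreover have "finite (P ` T)" using finite_subset[OF that(1)] by simp
    moreover have "P ` T \<subseteq> minimal_primes mpoly_ring I" using im that(1) by blast
    ultimately have "ideal_sum mpoly_ring (P ` T) = irrelevant_ideal"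
      using \<open>Q 3\<close> sum unfolding Q_def im[symmetric] by blast
    then show ?thesis using sums that(1) by blast
  qed
  have triple: "F i \<inter> F j \<inter> F k = {}"
    if "i \<in> ?V" "j \<in> ?V" "k \<in> ?V" "i \<noteq> j" "j \<noteq> k" "i \<noteq> k" for i j k
    using QT[of "{i, j, k}"] that by (simp add: Int_assoc)
  let ?R = "meet_graph ?V F"
  have R_eq: "?R = nonedge_relation s (associated_graph s P)"
  proof -
    have "F i \<inter> F j \<noteq> {} \<longleftrightarrow> {i, j} \<notin> snd (associated_graph s P)" if ij: "i \<in> ?V" "j \<in> ?V" "i \<noteq> j" for i j
    proof -
      have "{i, j} \<in> snd (associated_graph s P) \<longleftrightarrow> P i <+>\<^bsub>mpoly_ring\<^esub> P j = irrelevant_ideal"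
      proof
        assume "{i, j} \<in> snd (associated_graph s P)"
        then obtain k l where kl: "{i, j} = {k, l}" "k \<in> ?V" "l \<in> ?V" "P k <+>\<^bsub>mpoly_ring\<^esub> P l = irrelevant_ideal"
          by (auto simp: associated_graph_def)
        then have "(i = k \<and> j = l) \<or> (i = l \<and> j = k)" by (simp add: doubleton_eq_iff)
        then show "P i <+>\<^bsub>mpoly_ring\<^esub> P j = irrelevant_ideal" using kl add by (auto simp: Int_commute)
      next
        assume "P i <+>\<^bsub>mpoly_ring\<^esub> P j = irrelevant_ideal"
        then show "{i, j} \<in> snd (associated_graph s P)" using ij unfolding associated_graph_def snd_conv by blast
      qed
      then show ?thesis using add[OF ij(1,2)] by (simp add: irrelevant_ideal_eq sr_ideal_face_inject)
    qed
    then show ?thesis by (auto simp: meet_graph_def nonedge_relation_def)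
  qed
  have "?R \<noteq> {}"
  proof -
    obtain \<A> where A: "\<A> \<subseteq> minimal_primes mpoly_ring I" "card \<A> = 2"
      "ideal_sum mpoly_ring \<A> \<noteq> irrelevant_ideal"
      using \<open>\<not> Q 2\<close> sum unfolding Q_def im by auto
    obtain p p' where p: "\<A> = {p, p'}" "p \<noteq> p'" using A(2) by (auto simp: card_2_iff)
    then have "p \<in> P ` ?V" "p' \<in> P ` ?V" using A(1) unfolding im by simp_all
    then obtain i j where ij: "i \<in> ?V" "p = P i" "j \<in> ?V" "p' = P j" by (elim imageE)
    then have "\<A> = P ` {i, j}" "i \<noteq> j" using p by auto
    then have "F i \<inter> F j \<noteq> {}" using sums[of "{i, j}"] A(3) ij by simp
    then show ?thesis using ij \<open>i \<noteq> j\<close> by (auto simp: meet_graph_def)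
  qed
  have finR: "finite ?R" by (rule finite_subset[of _ "?V \<times> ?V"]) (auto simp: meet_graph_def)
  define q where "q = Min ((\<lambda>(i, j). card (F i \<inter> F j)) ` ?R)"
  have q_le: "q \<le> card (F i \<inter> F j)" if "(i, j) \<in> ?R" for i j
    unfolding q_def using finR that by (intro Min_le) force+
  have "q \<in> (\<lambda>(i, j). card (F i \<inter> F j)) ` ?R" unfolding q_def using finR \<open>?R \<noteq> {}\<close> by (intro Min_in) auto
  then obtain i0 j0 where ij0: "(i0, j0) \<in> ?R" "card (F i0 \<inter> F j0) = q" by auto
  have "q_invariant I = Inf {enat (card (F i \<inter> F j)) | i j. (i, j) \<in> ?R}"
  proof -
    have "{krull_dim (mpoly_ring Quot (A <+>\<^bsub>mpoly_ring\<^esub> B)) | A B.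
           A \<in> minimal_primes mpoly_ring I \<and> B \<in> minimal_primes mpoly_ring I \<and> A \<noteq> B \<and>
           A <+>\<^bsub>mpoly_ring\<^esub> B \<noteq> irrelevant_ideal} = {enat (card (F i \<inter> F j)) | i j. (i, j) \<in> ?R}" (is "?X = ?Y")
    proof (intro subset_antisym subsetI)
      fix x assume "x \<in> ?X"
      then obtain A B where AB: "x = krull_dim (mpoly_ring Quot (A <+>\<^bsub>mpoly_ring\<^esub> B))" "A \<in> P ` ?V" "B \<in> P ` ?V"
        "A \<noteq> B" "A <+>\<^bsub>mpoly_ring\<^esub> B \<noteq> irrelevant_ideal" unfolding im by blast
      then obtain i j where ij: "i \<in> ?V" "j \<in> ?V" "A = P i" "B = P j" by blast
      then have "i \<noteq> j" "F i \<inter> F j \<noteq> {}" using AB add[OF ij(1,2)] by (auto simp: irrelevant_ideal_eq)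
      then have "(i, j) \<in> ?R" using ij by (simp add: meet_graph_def)
      then show "x \<in> ?Y" using AB(1) add[OF ij(1,2)] ij by (auto simp: krull_dim_face_ring)
    next
      fix x assume "x \<in> ?Y"
      then obtain i j where x: "x = enat (card (F i \<inter> F j))" and "(i, j) \<in> ?R" by blast
      then have ij: "i \<in> ?V" "j \<in> ?V" "i \<noteq> j" "F i \<inter> F j \<noteq> {}" by (auto simp: meet_graph_def)
      have "P i \<noteq> P j" using inj_onD[OF inj _ ij(1,2)] ij(3) by blast
      moreover have "P i <+>\<^bsub>mpoly_ring\<^esub> P j \<noteq> irrelevant_ideal"
        using add[OF ij(1,2)] ij(4) by (simp add: irrelevant_ideal_eq sr_ideal_face_inject)
      moreover have "x = krull_dim (mpoly_ring Quot (P i <+>\<^bsub>mpoly_ring\<^esub> P j))"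
        using add[OF ij(1,2)] x by (simp add: krull_dim_face_ring)
      moreover have "P i \<in> minimal_primes mpoly_ring I" "P j \<in> minimal_primes mpoly_ring I" using im ij by blast+
      ultimately show "x \<in> ?X" by blast
    qed
    then show ?thesis by (simp only: q_invariant_def)
  qed
  also have "\<dots> = enat q"
  proof (rule antisym)
    show "Inf {enat (card (F i \<inter> F j)) | i j. (i, j) \<in> ?R} \<le> enat q" using ij0 by (intro Inf_lower) blast
    show "enat q \<le> Inf {enat (card (F i \<inter> F j)) | i j. (i, j) \<in> ?R}" using q_le by (intro Inf_greatest) auto
  qed
  finally have q: "the_enat (q_invariant I) = q" by simp
  have "UNIV \<notin> F ` ?V"
  proof
    assume "UNIV \<in> F ` ?V"
    then obtain i where i: "i \<in> ?V" "F i = UNIV" by auto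
    obtain j where "j \<in> ?V" "j \<noteq> i" using ij0 by (auto simp: meet_graph_def)
    then show False using anti[of j i] i by simp
  qed
  moreover have "has_grade (sr_ideal (F ` ?V) :: ('n, 'k) mpoly set)
    (if \<exists>i\<in>?V. \<exists>j\<in>?V. (i, j) \<notin> ?R\<^sup>* then 2 else if has_cycle ?R then 3 else q + 2)"
    by (rule grade_of_graph[OF finite_atLeastAtMost anti triple ij0 q_le])
  ultimately have "depth mpoly_ring irrelevant_ideal (ideal_module mpoly_ring (sr_ideal (F ` ?V) :: ('n, 'k) mpoly set)) =
    enat (if \<exists>i\<in>?V. \<exists>j\<in>?V. (i, j) \<notin> ?R\<^sup>* then 2 else if has_cycle ?R then 3 else q + 2)"
    by (rule depth_eq_grade)
  then show ?thesis by (simp only: IF[symmetric] R_eq q)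
qed

theorem corollary2p9:
  fixes I I' :: "('n::finite, 'k::field) mpoly set"
    and P P' :: "nat \<Rightarrow> ('n, 'k) mpoly set"
    and s :: nat
  assumes "squarefree_monomial_ideal I" and "squarefree_monomial_ideal I'"
    and "bij_betw P {1..s} (minimal_primes mpoly_ring I)"
    and "bij_betw P' {1..s} (minimal_primes mpoly_ring I')"
    and "\<forall>i\<in>{1..s}. monomial_ideal (P i)" and "\<forall>i\<in>{1..s}. monomial_ideal (P' i)"
    and "I = (\<Inter>i\<in>{1..s}. P i)" and "I' = (\<Inter>i\<in>{1..s}. P' i)"
    and "ideal_sum mpoly_ring (P ` {1..s}) = irrelevant_ideal"
    and "ideal_sum mpoly_ring (P' ` {1..s}) = irrelevant_ideal"
    and "bigsize I = 2" and "bigsize I' = 2"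
    and "q_invariant I = q_invariant I'"
    and "associated_graph s P = associated_graph s P'"
  shows "depth mpoly_ring irrelevant_ideal (ideal_module mpoly_ring I) =
         depth mpoly_ring irrelevant_ideal (ideal_module mpoly_ring I')"
  using depth_from_graph[OF assms(3,5,7,9,11)] depth_from_graph[OF assms(4,6,8,10,12)] assms(13,14)
  by simp

end
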